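(* Let $n\ge 3$, $m>0$, and consider the Schwarzschild manifold $(\mathbb{R}^n\setminus\{\mathbf{0}\},g^S)$ with $g^S=\left(1+\frac{m}{2r^{n-2}}\right)^{\frac{4}{n-2}}\delta$, $r=|\vec x|$. There are exactly two types of boundaries of simple non-generic domains in $(\mathbb{R}^n\setminus\{\mathbf{0}\},g^S)$: (i) the Euclidean spheres centered at $\mathbf{0}$ with radii $$r_\pm=\left(\frac{(n-1)\pm\sqrt{n^2-2n}}{2}\,m\right)^{\frac1{n-2}},$$ (ii) the Euclidean hyperplanes containing $\mathbf{0}$ (with $\mathbf{0}$ removed). That is, a hypersurface $\Sigma\subset\mathbb{R}^n\setminus\{\mathbf{0}\}$ is the boundary of some simple non-generic domain $(\Omega,\Sigma)$ in $(\mathbb{R}^n\setminus\{\mathbf{0}\},g^S)$ if and only if it is of one of these types.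
   Context: Here $\delta$ is the Euclidean metric. A domain $(\Omega,\Sigma)$ in an $n$-dimensional Riemannian manifold $(M,g)$ is a complete, connected, smooth domain $\Omega\subset M$ with (nonempty) smooth boundary hypersurface $\Sigma=\partial\Omega$ (boundary taken in $M$), so that $\overline{\Omega}$ is itself a complete Riemannian manifold with boundary. Let $\nu$ be the outward unit normal to $\Sigma$, $\hat g$ the induced metric on $\Sigma$, and $h(X,Y)=-\langle \nu, D_XY\rangle$ the second fundamental form of $\Sigma$. For $u\in C^\infty(\overline\Omega)$ put $L^*u=-(\Delta u)g+\operatorname{Hess}u-u\operatorname{Ric}$. The domain $(\Omega,\Sigma)$ is called non-generic if there is a function $u\in C^\infty(\overline\Omega)$, not identically zero, with $L^*u=0$ in $\Omega$ and $u_\nu\hat g=u h$ on $\Sigma$. It is called simple if $\Sigma$ has exactly one connected component. *)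

theory Defs
  imports "HOL-Analysis.Analysis"
begin

section \<open>Smooth functions\<close>

text \<open>\<open>Ck_on k f S\<close> is meant for open \<open>S\<close>.\<close>

fun Ck_on :: "nat \<Rightarrow> ('a::real_normed_vector \<Rightarrow> 'b::real_normed_vector) \<Rightarrow> 'a set \<Rightarrow> bool" where
  "Ck_on 0 f S \<longleftrightarrow> continuous_on S f"
| "Ck_on (Suc k) f S \<longleftrightarrow>
     (\<forall>x\<in>S. f differentiable (at x)) \<and>
     (\<forall>v. Ck_on k (\<lambda>x. frechet_derivative f (at x) v) S)"

definition smooth_on :: "('a::real_normed_vector) set \<Rightarrow> ('a \<Rightarrow> 'b::real_normed_vector) \<Rightarrow> bool" where
  "smooth_on S f \<longleftrightarrow> (\<forall>k. Ck_on k f S)"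

text \<open>Smoothness on a set that need not be open, such as the closure of a smooth domain:
  local extendability to smooth functions on open sets.\<close>

definition smooth_on_subset :: "('a::real_normed_vector) set \<Rightarrow> ('a \<Rightarrow> 'b::real_normed_vector) \<Rightarrow> bool" where
  "smooth_on_subset A f \<longleftrightarrow>
     (\<forall>p\<in>A. \<exists>V F. open V \<and> p \<in> V \<and> smooth_on V F \<and> (\<forall>x\<in>V \<inter> A. F x = f x))"

section \<open>Riemannian geometry in a global chart\<close>

text \<open>
  The manifold is an open subset \<open>M\<close> of \<open>real ^ 'n\<close>, and the Riemannian metric is given by its matrix
  \<open>g x = (g\<^sub>i\<^sub>j(x))\<close> in the Cartesian coordinates. Tensors are given by their components in these
  coordinates.
\<close>

type_synonym 'n metric = "real ^ 'n \<Rightarrow> real ^ 'n ^ 'n"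

definition metric_ip :: "('n::finite) metric \<Rightarrow> real ^ 'n \<Rightarrow> real ^ 'n \<Rightarrow> real ^ 'n \<Rightarrow> real" where
  "metric_ip g x v w = v \<bullet> (g x *v w)"

definition partial :: "'n::finite \<Rightarrow> (real ^ 'n \<Rightarrow> real) \<Rightarrow> real ^ 'n \<Rightarrow> real" where
  "partial i f x = frechet_derivative f (at x) (axis i 1)"

text \<open>\<open>christoffel g k i j\<close> is $\Gamma^k_{ij}$, with \<open>matrix_inv (g x) $ k $ l\<close> in the role of $g^{kl}$.\<close>

definition christoffel :: "('n::finite) metric \<Rightarrow> 'n \<Rightarrow> 'n \<Rightarrow> 'n \<Rightarrow> real ^ 'n \<Rightarrow> real" where
  "christoffel g k i j x =
     (1/2) * (\<Sum>l\<in>UNIV. matrix_inv (g x) $ k $ l *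
       (partial i (\<lambda>y. g y $ j $ l) x + partial j (\<lambda>y. g y $ i $ l) x
        - partial l (\<lambda>y. g y $ i $ j) x))"

text \<open>The Levi-Civita derivative $D_X Y$ of a vector field \<open>Y\<close> along \<open>X\<close>.\<close>

definition cov_deriv ::
  "('n::finite) metric \<Rightarrow> (real ^ 'n \<Rightarrow> real ^ 'n) \<Rightarrow> (real ^ 'n \<Rightarrow> real ^ 'n) \<Rightarrow> real ^ 'n \<Rightarrow> real ^ 'n" where
  "cov_deriv g X Y x =
     frechet_derivative Y (at x) (X x) +
     (\<chi> k. \<Sum>i\<in>UNIV. \<Sum>j\<in>UNIV. christoffel g k i j x * X x $ i * Y x $ j)"

definition hessian :: "('n::finite) metric \<Rightarrow> (real ^ 'n \<Rightarrow> real) \<Rightarrow> real ^ 'n \<Rightarrow> real ^ 'n ^ 'n" where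
  "hessian g u x =
     (\<chi> i j. partial i (partial j u) x - (\<Sum>k\<in>UNIV. christoffel g k i j x * partial k u x))"

definition laplacian :: "('n::finite) metric \<Rightarrow> (real ^ 'n \<Rightarrow> real) \<Rightarrow> real ^ 'n \<Rightarrow> real" where
  "laplacian g u x = (\<Sum>i\<in>UNIV. \<Sum>j\<in>UNIV. matrix_inv (g x) $ i $ j * hessian g u x $ i $ j)"

text \<open>
  \<open>riemann g l k i j\<close> is the component $R^l{}_{kij}$ of the curvature tensor,
  $R(\partial_i,\partial_j)\partial_k = R^l{}_{kij}\,\partial_l$ with
  $R(X,Y) = [D_X,D_Y] - D_{[X,Y]}$, and $\mathrm{Ric}_{jk} = R^i{}_{kij}$, so that
  round spheres have positive Ricci curvature.
\<close>

definition riemann :: "('n::finite) metric \<Rightarrow> 'n \<Rightarrow> 'n \<Rightarrow> 'n \<Rightarrow> 'n \<Rightarrow> real ^ 'n \<Rightarrow> real" where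
  "riemann g l k i j x =
     partial i (christoffel g l j k) x - partial j (christoffel g l i k) x
     + (\<Sum>m\<in>UNIV. christoffel g l i m x * christoffel g m j k x
                 - christoffel g l j m x * christoffel g m i k x)"

definition ricci :: "('n::finite) metric \<Rightarrow> real ^ 'n \<Rightarrow> real ^ 'n ^ 'n" where
  "ricci g x = (\<chi> j k. \<Sum>i\<in>UNIV. riemann g i k i j x)"

text \<open>$L^*u = -(\Delta u) g + \mathrm{Hess}\, u - u\, \mathrm{Ric}$\<close>

definition Lstar :: "('n::finite) metric \<Rightarrow> (real ^ 'n \<Rightarrow> real) \<Rightarrow> real ^ 'n \<Rightarrow> real ^ 'n ^ 'n" where
  "Lstar g u x = - (laplacian g u x *\<^sub>R g x) + hessian g u x - u x *\<^sub>R ricci g x"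

section \<open>Distance and completeness\<close>

text \<open>
  The length is a nonnegative Lebesgue integral, so that piecewise $C^1$ paths whose derivative is not
  integrable near a break point have infinite length.
\<close>

definition riem_length :: "('n::finite) metric \<Rightarrow> (real \<Rightarrow> real ^ 'n) \<Rightarrow> ennreal" where
  "riem_length g c =
     (\<integral>\<^sup>+ t\<in>{0..1}. ennreal (sqrt (metric_ip g (c t) (vector_derivative c (at t)) (vector_derivative c (at t))))
        \<partial>lborel)"

definition riem_dist :: "('n::finite) metric \<Rightarrow> (real ^ 'n) set \<Rightarrow> real ^ 'n \<Rightarrow> real ^ 'n \<Rightarrow> ennreal" where
  "riem_dist g A x y =
     (INF c\<in>{c. valid_path c \<and> path_image c \<subseteq> A \<and> pathstart c = x \<and> pathfinish c = y}. riem_length g c)"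

definition riem_complete :: "('n::finite) metric \<Rightarrow> (real ^ 'n) set \<Rightarrow> bool" where
  "riem_complete g A \<longleftrightarrow>
     (\<forall>s::nat \<Rightarrow> real ^ 'n.
        (\<forall>i. s i \<in> A) \<and> (\<forall>e>0. \<exists>N. \<forall>i\<ge>N. \<forall>j\<ge>N. riem_dist g A (s i) (s j) < e) \<longrightarrow>
        (\<exists>x\<in>A. (\<lambda>i. riem_dist g A (s i) x) \<longlonglongrightarrow> 0))"

section \<open>Domains with smooth boundary\<close>

definition boundary_in :: "(real ^ 'n::finite) set \<Rightarrow> (real ^ 'n) set \<Rightarrow> (real ^ 'n) set" where
  "boundary_in M \<Omega> = M \<inter> frontier \<Omega>"

definition closure_in :: "(real ^ 'n::finite) set \<Rightarrow> (real ^ 'n) set \<Rightarrow> (real ^ 'n) set" where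
  "closure_in M \<Omega> = M \<inter> closure \<Omega>"

text \<open>
  Near \<open>p\<close>, the domain is the sublevel set \<open>\<rho> < 0\<close> of a smooth function without critical points;
  existence of such a \<open>\<rho>\<close> at every boundary point says that the closure is a smooth manifold with
  boundary (in particular, the domain lies locally on one side of its boundary).
\<close>

definition defining_function ::
  "(real ^ 'n::finite) set \<Rightarrow> (real ^ 'n) set \<Rightarrow> real ^ 'n \<Rightarrow> (real ^ 'n \<Rightarrow> real) \<Rightarrow> bool" where
  "defining_function M \<Omega> p \<rho> \<longleftrightarrow>
     (\<exists>U. open U \<and> p \<in> U \<and> U \<subseteq> M \<and> smooth_on U \<rho> \<and> \<rho> p = 0 \<and>
          (\<forall>x\<in>U. frechet_derivative \<rho> (at x) \<noteq> (\<lambda>v. 0)) \<and>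
          U \<inter> \<Omega> = {x\<in>U. \<rho> x < 0})"

definition riem_domain ::
  "(real ^ 'n::finite) set \<Rightarrow> 'n metric \<Rightarrow> (real ^ 'n) set \<Rightarrow> (real ^ 'n) set \<Rightarrow> bool" where
  "riem_domain M g \<Omega> S \<longleftrightarrow>
     \<Omega> \<subseteq> M \<and> open \<Omega> \<and> \<Omega> \<noteq> {} \<and> connected \<Omega> \<and>
     S = boundary_in M \<Omega> \<and> S \<noteq> {} \<and>
     (\<forall>p\<in>S. \<exists>\<rho>. defining_function M \<Omega> p \<rho>) \<and>
     riem_complete g (closure_in M \<Omega>)"

text \<open>The tangent space at \<open>p\<close> of the boundary of \<open>\<Omega>\<close>, a regular level set of \<open>\<rho>\<close>.\<close>

definition boundary_tangent_space ::
  "(real ^ 'n::finite) set \<Rightarrow> (real ^ 'n) set \<Rightarrow> real ^ 'n \<Rightarrow> (real ^ 'n) set" where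
  "boundary_tangent_space M \<Omega> p =
     {v. \<exists>\<rho>. defining_function M \<Omega> p \<rho> \<and> frechet_derivative \<rho> (at p) v = 0}"

definition outward_normal ::
  "(real ^ 'n::finite) set \<Rightarrow> 'n metric \<Rightarrow> (real ^ 'n) set \<Rightarrow> real ^ 'n \<Rightarrow> real ^ 'n" where
  "outward_normal M g \<Omega> p =
     (THE \<nu>. metric_ip g p \<nu> \<nu> = 1 \<and>
             (\<forall>v\<in>boundary_tangent_space M \<Omega> p. metric_ip g p \<nu> v = 0) \<and>
             (\<exists>\<rho>. defining_function M \<Omega> p \<rho> \<and> frechet_derivative \<rho> (at p) \<nu> > 0))"

text \<open>
  \<open>u\<close> is only given on the closure of \<open>\<Omega>\<close>, so its derivative along the outward normal is the
  one-sided derivative at \<open>t = 0\<close> of \<open>u (p + t\<nu>)\<close>, \<open>t \<le> 0\<close>.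
\<close>

definition normal_deriv ::
  "(real ^ 'n::finite) set \<Rightarrow> 'n metric \<Rightarrow> (real ^ 'n) set \<Rightarrow> (real ^ 'n \<Rightarrow> real) \<Rightarrow> real ^ 'n \<Rightarrow> real" where
  "normal_deriv M g \<Omega> u p =
     vector_derivative (\<lambda>t. u (p + t *\<^sub>R outward_normal M g \<Omega> p)) (at 0 within {..0})"

text \<open>Local smooth extensions \<open>X\<close> to open sets \<open>V\<close> of tangent vector fields of the boundary.\<close>

definition boundary_tangent_field ::
  "(real ^ 'n::finite) set \<Rightarrow> (real ^ 'n) set \<Rightarrow> (real ^ 'n) set \<Rightarrow> (real ^ 'n \<Rightarrow> real ^ 'n) \<Rightarrow> bool" where
  "boundary_tangent_field M \<Omega> V X \<longleftrightarrow>
     smooth_on V X \<and> (\<forall>q\<in>V \<inter> boundary_in M \<Omega>. X q \<in> boundary_tangent_space M \<Omega> q)"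

definition second_fundamental_form ::
  "(real ^ 'n::finite) set \<Rightarrow> 'n metric \<Rightarrow> (real ^ 'n) set \<Rightarrow>
   (real ^ 'n \<Rightarrow> real ^ 'n) \<Rightarrow> (real ^ 'n \<Rightarrow> real ^ 'n) \<Rightarrow> real ^ 'n \<Rightarrow> real" where
  "second_fundamental_form M g \<Omega> X Y p =
     - metric_ip g p (outward_normal M g \<Omega> p) (cov_deriv g X Y p)"

definition non_generic ::
  "(real ^ 'n::finite) set \<Rightarrow> 'n metric \<Rightarrow> (real ^ 'n) set \<Rightarrow> (real ^ 'n) set \<Rightarrow> bool" where
  "non_generic M g \<Omega> S \<longleftrightarrow>
     (\<exists>u. smooth_on_subset (closure_in M \<Omega>) u \<and>
          (\<exists>x\<in>closure_in M \<Omega>. u x \<noteq> 0) \<and>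
          (\<forall>x\<in>\<Omega>. Lstar g u x = 0) \<and>
          (\<forall>p\<in>S. \<forall>V X Y.
             open V \<and> p \<in> V \<and> V \<subseteq> M \<and>
             boundary_tangent_field M \<Omega> V X \<and> boundary_tangent_field M \<Omega> V Y \<longrightarrow>
             normal_deriv M g \<Omega> u p * metric_ip g p (X p) (Y p)
               = u p * second_fundamental_form M g \<Omega> X Y p))"

definition simple_boundary :: "(real ^ 'n::finite) set \<Rightarrow> bool" where
  "simple_boundary S \<longleftrightarrow> (\<exists>!C. C \<in> components S)"

section \<open>The Schwarzschild manifold\<close>

definition schwarzschild_space :: "(real ^ 'n::finite) set" where
  "schwarzschild_space = UNIV - {0}"

definition schwarzschild_metric :: "real \<Rightarrow> ('n::finite) metric" where
  "schwarzschild_metric m x =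
     ((1 + m / (2 * norm x ^ (CARD('n) - 2))) powr (4 / (real CARD('n) - 2))) *\<^sub>R mat 1"

definition schwarzschild_radius_plus :: "nat \<Rightarrow> real \<Rightarrow> real" where
  "schwarzschild_radius_plus n m =
     (((real n - 1) + sqrt (real n ^ 2 - 2 * real n)) / 2 * m) powr (1 / (real n - 2))"

definition schwarzschild_radius_minus :: "nat \<Rightarrow> real \<Rightarrow> real" where
  "schwarzschild_radius_minus n m =
     (((real n - 1) - sqrt (real n ^ 2 - 2 * real n)) / 2 * m) powr (1 / (real n - 2))"

end

theory Submission
  imports Defs
begin

text \<open>
  Write \<open>s = m / (2 r\<^bsup>n - 2\<^esup>)\<close>, and let \<open>exp (2w)\<close> be the conformal factor, so that the gradient of \<open>w\<close> is radial.

  Static potentials. The Schwarzschild metric is scalar flat, so \<open>L\<^sup>*u = 0\<close> means \<open>Hess u = u Ric\<close>. For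
  \<open>v = exp (- w) u\<close> this gives \<open>D\<^sup>2v = f x \<otimes> x + \<mu> I\<close> with \<open>f\<close> a nowhere vanishing radial multiple of \<open>v\<close>.
  Symmetry of the third derivatives of \<open>v\<close> forces \<open>Df\<close>, and hence \<open>Du\<close>, to vanish orthogonally to \<open>x\<close>; what
  remains is a first-order equation, whose solutions are the multiples of \<open>u\<^sub>0 = (1 - s) / (1 + s)\<close>
  (\<open>static_potential_unique\<close>).

  The boundary condition. With \<open>u\<close> known, the condition becomes a statement about the Euclidean unit
  normal \<open>N\<close> (\<open>boundary_condition_iff\<close>, \<open>non_generic_umbilicity\<close>): where \<open>u\<^sub>0 \<noteq> 0\<close>,
  the boundary is umbilical with Euclidean principal curvature \<open>\<kappa> = k (x \<bullet> N)\<close> for an explicit radial \<open>k\<close>;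
  where \<open>u\<^sub>0 = 0\<close>, it satisfies \<open>x \<bullet> N = 0\<close>.

  From the boundary condition to spheres and hyperplanes. Codazzi's equation makes \<open>\<kappa>\<close> locally
  constant (\<open>codazzi\<close>; this needs \<open>n - 1 \<ge> 2\<close>). On the other hand, differentiating \<open>k (x \<bullet> N)\<close> along a
  tangent vector \<open>v\<close> gives \<open>- (n - 1) B (x \<bullet> N) (x \<bullet> v)\<close>, where \<open>B > 0\<close> measures the trace-free Ricci
  curvature. So at each boundary point either \<open>x \<bullet> N = 0\<close> or \<open>x\<close> is normal to the boundary
  (\<open>non_generic_dichotomy\<close>), and on a connected boundary one alternative holds throughout. In the
  first case \<open>N\<close> is constant and the boundary is a hyperplane through the origin; in the second \<open>r\<close> is
  constant, and the condition for the curvature \<open>1 / r\<close> is \<open>s\<^sup>2 - 2 (n - 1) s + 1 = 0\<close>, whose roots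
  correspond to the two radii (\<open>schwarzschild_radius_iff\<close>).

  Conversely, the half-space and the punctured ball satisfy the boundary condition with \<open>u = u\<^sub>0\<close>. They
  are complete because the metric dominates the Euclidean one and the origin is infinitely far away:
  the metric also dominates the pull-back of a multiple of the Euclidean metric under inversion (\<open>riem_complete_convex\<close>).
\<close>

section \<open>Calculus of smooth functions\<close>

abbreviation dderiv :: "'a \<Rightarrow> ('a::real_normed_vector \<Rightarrow> 'b::real_normed_vector) \<Rightarrow> 'a \<Rightarrow> 'b" where
  "dderiv v f x \<equiv> frechet_derivative f (at x) v"

lemma frechet_derivative_cong_open:
  assumes "open S" "x \<in> S" "\<And>y. y \<in> S \<Longrightarrow> f y = g y"
  shows "frechet_derivative f (at x) = frechet_derivative g (at x)"
proof -
  have "(f has_derivative f') (at x) \<longleftrightarrow> (g has_derivative f') (at x)" for f'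
    using has_derivative_transform_within_open[OF _ assms(1,2)] assms(3) by metis
  then show ?thesis
    by (simp add: frechet_derivative_def)
qed

lemma dderiv_eqI:
  "(f has_derivative f') (at x) \<Longrightarrow> dderiv v f x = f' v"
  using frechet_derivative_at by metis

lemma dderiv_cmul:
  "f differentiable (at x) \<Longrightarrow> dderiv (c *\<^sub>R v) f x = c *\<^sub>R dderiv v f x"
  by (simp add: linear_frechet_derivative linear_cmul)

lemma dderiv_add:
  "f differentiable (at x) \<Longrightarrow> dderiv (v + w) f x = dderiv v f x + dderiv w f x"
  by (simp add: linear_frechet_derivative linear_add)

lemma dderiv_0: "f differentiable (at x) \<Longrightarrow> dderiv 0 f x = 0"
  by (simp add: linear_frechet_derivative linear_0)

lemma dderiv_sum:
  "f differentiable (at x) \<Longrightarrow> dderiv (\<Sum>i\<in>I. V i) f x = (\<Sum>i\<in>I. dderiv (V i) f x)"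
  by (simp add: linear_frechet_derivative linear_sum)

lemma Ck_on_subset: "Ck_on k f S \<Longrightarrow> T \<subseteq> S \<Longrightarrow> Ck_on k f T"
  by (induction k arbitrary: f) (auto intro: continuous_on_subset)

lemma Ck_on_cong:
  assumes "open S" "\<And>x. x \<in> S \<Longrightarrow> f x = g x" and "Ck_on k f S"
  shows "Ck_on k g S"
  using assms(2,3)
proof (induction k arbitrary: f g)
  case 0 then show ?case by (simp cong: continuous_on_cong)
next
  case (Suc k)
  have eq: "frechet_derivative f (at x) = frechet_derivative g (at x)" if "x \<in> S" for x
    using frechet_derivative_cong_open[OF assms(1) that] Suc.prems(1) by blast
  have "g differentiable (at x)" if "x \<in> S" for x
    using Suc.prems that differentiable_def has_derivative_transform_within_open[OF _ assms(1) that]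
    by (metis Ck_on.simps(2))
  moreover have "Ck_on k (dderiv v g) S" for v
    using Suc.IH[of "dderiv v f" "dderiv v g"] Suc.prems(2) eq by simp
  ultimately show ?case by simp
qed

lemma Ck_on_local:
  assumes "\<And>x. x \<in> S \<Longrightarrow> \<exists>T. open T \<and> x \<in> T \<and> Ck_on k f T"
  shows "Ck_on k f S"
  using assms
proof (induction k arbitrary: f)
  case 0
  have "continuous (at x within S) f" if "x \<in> S" for x
    using 0[OF that] by (auto simp: continuous_on_eq_continuous_at intro: continuous_at_imp_continuous_at_within)
  then show ?case by (simp add: continuous_on_eq_continuous_within)
next
  case (Suc k)
  have "f differentiable (at x)" if "x \<in> S" for x
    using Suc.prems[OF that] by auto
  moreover have "Ck_on k (dderiv v f) S" for v
    by (rule Suc.IH) (use Suc.prems in fastforce)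
  ultimately show ?case by simp
qed

lemma Ck_on_SucI:
  assumes "open S" and "\<And>x. x \<in> S \<Longrightarrow> (f has_derivative f' x) (at x)"
    and "\<And>v. Ck_on k (\<lambda>x. f' x v) S"
  shows "Ck_on (Suc k) f S"
proof -
  have "Ck_on k (dderiv v f) S" for v
    by (rule Ck_on_cong[OF assms(1) _ assms(3)[of v]]) (simp add: dderiv_eqI[OF assms(2)])
  then show ?thesis
    using assms(2) by (auto simp: differentiable_def)
qed

lemma Ck_on_Suc_imp: "Ck_on (Suc k) f S \<Longrightarrow> Ck_on k f S"
proof (induction k arbitrary: f)
  case 0 then show ?case
    by (auto intro: continuous_at_imp_continuous_on differentiable_imp_continuous_within)
next
  case (Suc k)
  then show ?case by (metis Ck_on.simps(2))
qed

lemma Ck_on_has_derivative: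
  "Ck_on (Suc k) f S \<Longrightarrow> x \<in> S \<Longrightarrow> (f has_derivative (\<lambda>v. dderiv v f x)) (at x)"
  using frechet_derivative_works by fastforce

lemma Ck_on_const: "Ck_on k (\<lambda>x. c) S"
  by (induction k arbitrary: c) auto

lemma Ck_on_bounded_linear:
  assumes "bounded_linear L" "open S" and "Ck_on k f S"
  shows "Ck_on k (\<lambda>x. L (f x)) S"
  using assms(3)
proof (induction k arbitrary: f)
  case 0 then show ?case by (simp add: bounded_linear.continuous_on[OF assms(1)])
next
  case (Suc k)
  show ?case
    by (rule Ck_on_SucI[OF assms(2) bounded_linear.has_derivative[OF assms(1) Ck_on_has_derivative[OF Suc.prems]]])
       (use Suc in auto)
qed

lemma Ck_on_ident: "Ck_on k (\<lambda>x. x) S"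
proof (cases k)
  case (Suc j) then show ?thesis
    using Ck_on_subset[OF Ck_on_SucI[of UNIV "\<lambda>x. x" "\<lambda>x v. v" j]] by (simp add: Ck_on_const)
qed simp

lemma Ck_on_add:
  assumes "open S" "Ck_on k f S" "Ck_on k g S"
  shows "Ck_on k (\<lambda>x. f x + g x) S"
  using assms(2,3)
proof (induction k arbitrary: f g)
  case 0 then show ?case by (simp add: continuous_on_add)
next
  case (Suc k)
  show ?case
    by (rule Ck_on_SucI[OF assms(1) has_derivative_add[OF Ck_on_has_derivative[OF Suc.prems(1)] Ck_on_has_derivative[OF Suc.prems(2)]]])
       (use Suc in auto)
qed

lemma Ck_on_bilinear:
  assumes "bounded_bilinear P" "open S" "Ck_on k f S" "Ck_on k g S"
  shows "Ck_on k (\<lambda>x. P (f x) (g x)) S"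
  using assms(3,4)
proof (induction k arbitrary: f g)
  case 0 then show ?case by (simp add: bounded_bilinear.continuous_on[OF assms(1)])
next
  case (Suc k)
  have "Ck_on k (\<lambda>x. P (f x) (dderiv v g x) + P (dderiv v f x) (g x)) S" for v
    using Suc.prems by (intro Ck_on_add assms(2) Suc.IH Ck_on_Suc_imp[OF Suc.prems(1)] Ck_on_Suc_imp[OF Suc.prems(2)]) auto
  then show ?case
    by (intro Ck_on_SucI[OF assms(2) bounded_bilinear.FDERIV[OF assms(1) Ck_on_has_derivative[OF Suc.prems(1)] Ck_on_has_derivative[OF Suc.prems(2)]]])
qed

text \<open>Real powers, together with the algebraic operations, produce reciprocals, square roots and norms. The
  exponent varies in the induction because differentiation lowers it.\<close>

lemma Ck_on_powr:
  fixes f :: "'a::real_normed_vector \<Rightarrow> real"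
  assumes "open S" "Ck_on k f S" "\<And>x. x \<in> S \<Longrightarrow> f x > 0"
  shows "Ck_on k (\<lambda>x. f x powr a) S"
  using assms(2)
proof (induction k arbitrary: a)
  case 0 then show ?case using assms(3) by (force intro!: continuous_intros)
next
  case (Suc k)
  have d: "((\<lambda>x. f x powr a) has_derivative (\<lambda>v. (a * f x powr (a - 1)) * dderiv v f x)) (at x)" if "x \<in> S" for x
  proof -
    have "f x powr (a - 1) = f x powr a / f x"
      using assms(3)[OF that] by (simp add: powr_diff)
    then show ?thesis
      by (intro has_derivative_eq_rhs[OF has_derivative_powr[OF Ck_on_has_derivative[OF Suc.prems that] has_derivative_const assms(3)[OF that]]])
         (simp_all add: mult_ac)
  qed
  have "Ck_on k (\<lambda>x. (a * f x powr (a - 1)) * dderiv v f x) S" for v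
    using Suc.prems
    by (intro Ck_on_bilinear[OF bounded_bilinear_mult] Ck_on_const assms(1) Suc.IH[OF Ck_on_Suc_imp[OF Suc.prems]]) auto
  then show ?case
    by (intro Ck_on_SucI[where f' = "\<lambda>x v. (a * f x powr (a - 1)) * dderiv v f x"] assms(1) d)
qed

lemma smooth_on_subset_set: "smooth_on S f \<Longrightarrow> T \<subseteq> S \<Longrightarrow> smooth_on T f"
  by (auto simp: smooth_on_def intro: Ck_on_subset)

lemma smooth_on_cong:
  "open S \<Longrightarrow> (\<And>x. x \<in> S \<Longrightarrow> f x = g x) \<Longrightarrow> smooth_on S f \<Longrightarrow> smooth_on S g"
  unfolding smooth_on_def by (meson Ck_on_cong)

lemma smooth_on_local:
  assumes "\<And>x. x \<in> S \<Longrightarrow> \<exists>T. open T \<and> x \<in> T \<and> smooth_on T f"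
  shows "smooth_on S f"
  unfolding smooth_on_def
proof
  fix k show "Ck_on k f S"
    by (rule Ck_on_local) (use assms in \<open>metis smooth_on_def\<close>)
qed

lemma smooth_on_has_derivative:
  "smooth_on S f \<Longrightarrow> x \<in> S \<Longrightarrow> (f has_derivative (\<lambda>v. dderiv v f x)) (at x)"
  unfolding smooth_on_def using Ck_on_has_derivative by metis

lemma smooth_on_differentiable: "smooth_on S f \<Longrightarrow> x \<in> S \<Longrightarrow> f differentiable (at x)"
  using smooth_on_has_derivative differentiable_def by blast

lemma smooth_on_continuous_on: "smooth_on S f \<Longrightarrow> continuous_on S f"
  unfolding smooth_on_def by (metis Ck_on.simps(1))

lemma smooth_on_dderiv: "smooth_on S f \<Longrightarrow> smooth_on S (dderiv v f)"
  unfolding smooth_on_def by (metis Ck_on.simps(2))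

named_theorems smooth_intros

lemma smooth_on_const [smooth_intros]: "smooth_on S (\<lambda>x. c)"
  and smooth_on_ident [smooth_intros]: "smooth_on S (\<lambda>x. x)"
  by (auto simp: smooth_on_def Ck_on_const Ck_on_ident)

lemma smooth_on_add [smooth_intros]:
  "open S \<Longrightarrow> smooth_on S f \<Longrightarrow> smooth_on S g \<Longrightarrow> smooth_on S (\<lambda>x. f x + g x)"
  by (auto simp: smooth_on_def Ck_on_add)

lemma smooth_on_linear:
  "bounded_linear L \<Longrightarrow> open S \<Longrightarrow> smooth_on S f \<Longrightarrow> smooth_on S (\<lambda>x. L (f x))"
  by (auto simp: smooth_on_def Ck_on_bounded_linear)

lemma smooth_on_minus [smooth_intros]:
  "open S \<Longrightarrow> smooth_on S f \<Longrightarrow> smooth_on S (\<lambda>x. - f x)"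
  by (rule smooth_on_linear[OF bounded_linear_minus[OF bounded_linear_ident]])

lemma smooth_on_diff [smooth_intros]:
  "open S \<Longrightarrow> smooth_on S f \<Longrightarrow> smooth_on S g \<Longrightarrow> smooth_on S (\<lambda>x. f x - g x)"
  using smooth_on_add[of S f "\<lambda>x. - g x"] smooth_on_minus[of S g] by simp

lemma smooth_on_mult [smooth_intros]:
  fixes f g :: "'a::real_normed_vector \<Rightarrow> real"
  shows "open S \<Longrightarrow> smooth_on S f \<Longrightarrow> smooth_on S g \<Longrightarrow> smooth_on S (\<lambda>x. f x * g x)"
  by (auto simp: smooth_on_def intro: Ck_on_bilinear[OF bounded_bilinear_mult])

lemma smooth_on_scaleR [smooth_intros]:
  "open S \<Longrightarrow> smooth_on S f \<Longrightarrow> smooth_on S g \<Longrightarrow> smooth_on S (\<lambda>x. f x *\<^sub>R g x)"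
  by (auto simp: smooth_on_def intro: Ck_on_bilinear[OF bounded_bilinear_scaleR])

lemma smooth_on_inner [smooth_intros]:
  "open S \<Longrightarrow> smooth_on S f \<Longrightarrow> smooth_on S g \<Longrightarrow> smooth_on S (\<lambda>x. f x \<bullet> g x)"
  by (auto simp: smooth_on_def intro: Ck_on_bilinear[OF bounded_bilinear_inner])

lemma smooth_on_powr [smooth_intros]:
  fixes f :: "'a::real_normed_vector \<Rightarrow> real"
  shows "open S \<Longrightarrow> smooth_on S f \<Longrightarrow> (\<And>x. x \<in> S \<Longrightarrow> f x > 0) \<Longrightarrow> smooth_on S (\<lambda>x. f x powr a)"
  by (auto simp: smooth_on_def intro: Ck_on_powr)

lemma smooth_on_sum [smooth_intros]:
  assumes "open S" "finite I" "\<And>i. i \<in> I \<Longrightarrow> smooth_on S (f i)"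
  shows "smooth_on S (\<lambda>x. \<Sum>i\<in>I. f i x)"
  using assms(2,3) by (induction I) (auto intro!: smooth_intros assms(1))

lemma smooth_on_divide_pos:
  fixes f g :: "'a::real_normed_vector \<Rightarrow> real"
  assumes "open S" "smooth_on S f" "smooth_on S g" "\<And>x. x \<in> S \<Longrightarrow> g x > 0"
  shows "smooth_on S (\<lambda>x. f x / g x)"
proof (rule smooth_on_cong[OF assms(1)])
  show "smooth_on S (\<lambda>x. f x * g x powr (-1))"
    by (intro smooth_intros assms)
qed (use assms(4) in \<open>force simp: powr_minus_divide\<close>)

text \<open>Differentiating along a moving direction: expanding the direction in a basis turns
  \<open>dderiv (X x) f x\<close> into a finite sum of products.\<close>

lemma has_derivative_dderiv_field:
  fixes f :: "'a::euclidean_space \<Rightarrow> 'b::real_normed_vector" and X :: "'a \<Rightarrow> 'a"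
  assumes "open S" "smooth_on S f" "x \<in> S" and X: "(X has_derivative X') (at x)"
  shows "((\<lambda>y. dderiv (X y) f y) has_derivative
           (\<lambda>v. dderiv v (dderiv (X x) f) x + dderiv (X' v) f x)) (at x)"
proof -
  have fd: "f differentiable (at y)" if "y \<in> S" for y
    using smooth_on_differentiable assms(2) that by blast
  have exp: "dderiv v f y = (\<Sum>b\<in>Basis. (v \<bullet> b) *\<^sub>R dderiv b f y)" if "y \<in> S" for v y
    by (subst (1) euclidean_representation[of v, symmetric])
       (simp add: dderiv_sum[OF fd[OF that]] dderiv_cmul[OF fd[OF that]])
  have fb: "(dderiv b f has_derivative (\<lambda>v. dderiv v (dderiv b f) x)) (at x)" for b
    by (rule smooth_on_has_derivative[OF smooth_on_dderiv[OF assms(2)] assms(3)])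
  have dd: "dderiv v (dderiv w f) x = (\<Sum>b\<in>Basis. (w \<bullet> b) *\<^sub>R dderiv v (dderiv b f) x)" for v w
  proof -
    have "frechet_derivative (dderiv w f) (at x) = frechet_derivative (\<lambda>y. \<Sum>b\<in>Basis. (w \<bullet> b) *\<^sub>R dderiv b f y) (at x)"
      by (rule frechet_derivative_cong_open[OF assms(1,3)]) (rule exp)
    moreover have "((\<lambda>y. \<Sum>b\<in>Basis. (w \<bullet> b) *\<^sub>R dderiv b f y) has_derivative (\<lambda>v. \<Sum>b\<in>Basis. (w \<bullet> b) *\<^sub>R dderiv v (dderiv b f) x)) (at x)"
      by (intro has_derivative_sum has_derivative_scaleR_right fb)
    ultimately show ?thesis by (simp add: dderiv_eqI)
  qed
  have "((\<lambda>y. \<Sum>b\<in>Basis. (X y \<bullet> b) *\<^sub>R dderiv b f y) has_derivative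
          (\<lambda>v. \<Sum>b\<in>Basis. (X x \<bullet> b) *\<^sub>R dderiv v (dderiv b f) x + (X' v \<bullet> b) *\<^sub>R dderiv b f x)) (at x)"
    by (intro has_derivative_sum has_derivative_scaleR fb has_derivative_inner_left X)
  then have "((\<lambda>y. \<Sum>b\<in>Basis. (X y \<bullet> b) *\<^sub>R dderiv b f y) has_derivative
          (\<lambda>v. dderiv v (dderiv (X x) f) x + dderiv (X' v) f x)) (at x)"
    by (simp add: sum.distrib dd[where w = "X x"] exp[OF assms(3), of "X' _"])
  then show ?thesis
    by (rule has_derivative_transform_within_open[OF _ assms(1,3)]) (simp add: exp)
qed

lemma smooth_on_dderiv_field:
  fixes f :: "'a::euclidean_space \<Rightarrow> 'b::real_normed_vector" and X :: "'a \<Rightarrow> 'a"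
  assumes "open S" "smooth_on S f" "smooth_on S X"
  shows "smooth_on S (\<lambda>y. dderiv (X y) f y)"
proof (rule smooth_on_cong[OF assms(1)])
  show "smooth_on S (\<lambda>y. \<Sum>b\<in>Basis. (X y \<bullet> b) *\<^sub>R dderiv b f y)"
    by (intro smooth_intros assms smooth_on_dderiv finite_Basis)
  fix y assume "y \<in> S"
  then have fd: "f differentiable (at y)"
    using smooth_on_differentiable assms(2) by blast
  show "(\<Sum>b\<in>Basis. (X y \<bullet> b) *\<^sub>R dderiv b f y) = dderiv (X y) f y"
    by (subst (2) euclidean_representation[of "X y", symmetric])
       (simp add: dderiv_sum[OF fd] dderiv_cmul[OF fd])
qed

text \<open>Schwarz's theorem. The second difference over the parallelogram spanned by \<open>h *\<^sub>R a\<close> and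
  \<open>h *\<^sub>R b\<close> is, by two applications of the mean value theorem, \<open>h\<^sup>2\<close> times either mixed
  derivative at some nearby points.\<close>

lemma second_difference_mvt:
  fixes f :: "'a::real_normed_vector \<Rightarrow> real"
  assumes S: "\<And>s t. 0 \<le> s \<Longrightarrow> s \<le> h \<Longrightarrow> 0 \<le> t \<Longrightarrow> t \<le> h \<Longrightarrow> x + s *\<^sub>R a + t *\<^sub>R b \<in> S"
    and "smooth_on S f" "h > 0"
  shows "\<exists>s t. 0 < s \<and> s < h \<and> 0 < t \<and> t < h \<and>
     f (x + h *\<^sub>R a + h *\<^sub>R b) - f (x + h *\<^sub>R a) - f (x + h *\<^sub>R b) + f x
       = h * h * dderiv b (dderiv a f) (x + s *\<^sub>R a + t *\<^sub>R b)"
proof -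
  have line: "((\<lambda>s. F (w + s *\<^sub>R v)) has_real_derivative dderiv v F (w + s *\<^sub>R v)) (at s)"
    if "smooth_on S F" "w + s *\<^sub>R v \<in> S" for F :: "'a \<Rightarrow> real" and w v s
  proof -
    have "((\<lambda>s. w + s *\<^sub>R v) has_derivative (\<lambda>r. r *\<^sub>R v)) (at s)"
      by (auto intro!: derivative_eq_intros)
    from has_derivative_compose[OF this smooth_on_has_derivative[OF that]]
    have "((\<lambda>s. F (w + s *\<^sub>R v)) has_derivative (\<lambda>r. r * dderiv v F (w + s *\<^sub>R v))) (at s)"
      by (simp add: dderiv_cmul[OF smooth_on_differentiable[OF that]])
    then show ?thesis
      by (rule has_derivative_imp_has_field_derivative) simp
  qed
  let ?g = "\<lambda>s. f (x + h *\<^sub>R b + s *\<^sub>R a) - f (x + s *\<^sub>R a)"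
  have "\<exists>s. 0 < s \<and> s < h \<and> ?g h - ?g 0 = (h - 0) * (dderiv a f (x + h *\<^sub>R b + s *\<^sub>R a) - dderiv a f (x + s *\<^sub>R a))"
    by (rule MVT2[OF \<open>h > 0\<close>], intro DERIV_diff line assms)
       (use S[of _ 0] S[of _ h] \<open>h > 0\<close> in \<open>auto simp: algebra_simps\<close>)
  then obtain s where s: "0 < s" "s < h" "?g h - ?g 0 = h * (dderiv a f (x + h *\<^sub>R b + s *\<^sub>R a) - dderiv a f (x + s *\<^sub>R a))"
    by auto
  let ?k = "\<lambda>t. dderiv a f (x + s *\<^sub>R a + t *\<^sub>R b)"
  have "\<exists>t. 0 < t \<and> t < h \<and> ?k h - ?k 0 = (h - 0) * dderiv b (dderiv a f) (x + s *\<^sub>R a + t *\<^sub>R b)"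
    by (rule MVT2[OF \<open>h > 0\<close>], intro line smooth_on_dderiv assms)
       (use S[of s] s in \<open>auto simp: algebra_simps\<close>)
  then obtain t where t: "0 < t" "t < h" "?k h - ?k 0 = h * dderiv b (dderiv a f) (x + s *\<^sub>R a + t *\<^sub>R b)"
    by auto
  have "?g h - ?g 0 = h * h * dderiv b (dderiv a f) (x + s *\<^sub>R a + t *\<^sub>R b)"
    using s(3) t(3) by (simp add: algebra_simps)
  moreover have "?g h - ?g 0 = f (x + h *\<^sub>R a + h *\<^sub>R b) - f (x + h *\<^sub>R a) - f (x + h *\<^sub>R b) + f x"
    by (simp add: algebra_simps)
  ultimately show ?thesis using s t by metis
qed

lemma dderiv_commute_real:
  fixes f :: "'a::real_normed_vector \<Rightarrow> real"
  assumes "open S" "smooth_on S f" "x \<in> S"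
  shows "dderiv a (dderiv b f) x = dderiv b (dderiv a f) x"
proof (rule ccontr)
  define F G where "F = dderiv a (dderiv b f)" and "G = dderiv b (dderiv a f)"
  assume "\<not> ?thesis"
  then have e: "\<bar>F x - G x\<bar> / 2 > 0" by (simp add: F_def G_def)
  have "isCont F x" "isCont G x"
    using smooth_on_continuous_on[OF smooth_on_dderiv[OF smooth_on_dderiv[OF assms(2)]]]
      continuous_on_eq_continuous_at[OF assms(1)] assms(3) unfolding F_def G_def by blast+
  then have "\<forall>\<^sub>F y in nhds x. dist (F y) (F x) < \<bar>F x - G x\<bar> / 2"
     "\<forall>\<^sub>F y in nhds x. dist (G y) (G x) < \<bar>F x - G x\<bar> / 2"
    by (metis e tendstoD continuous_at tendsto_at_iff_tendsto_nhds)+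
  then have "\<forall>\<^sub>F y in nhds x. y \<in> S \<and> dist (F y) (F x) < \<bar>F x - G x\<bar> / 2 \<and> dist (G y) (G x) < \<bar>F x - G x\<bar> / 2"
    using assms by (auto intro: eventually_conj eventually_nhds_in_open)
  then obtain d where d: "d > 0" "\<And>y. dist y x < d \<Longrightarrow> y \<in> S \<and> dist (F y) (F x) < \<bar>F x - G x\<bar> / 2 \<and> dist (G y) (G x) < \<bar>F x - G x\<bar> / 2"
    unfolding eventually_nhds_metric by blast
  define h where "h = d / (2 * (norm a + norm b + 1))"
  have "norm a + norm b + 1 > 0"
    by (smt (verit) norm_ge_zero)
  then have h: "h > 0" "h * (norm a + norm b) < d"
    using d(1) unfolding h_def by (auto simp: field_simps) (smt (verit) mult_nonneg_nonneg norm_ge_zero)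
  have near: "dist (x + s *\<^sub>R a + t *\<^sub>R b) x < d" if "0 \<le> s" "s \<le> h" "0 \<le> t" "t \<le> h" for s t
  proof -
    have "dist (x + s *\<^sub>R a + t *\<^sub>R b) x = norm (s *\<^sub>R a + t *\<^sub>R b)"
      by (simp add: dist_norm)
    also have "\<dots> \<le> s * norm a + t * norm b"
      using norm_triangle_ineq[of "s *\<^sub>R a" "t *\<^sub>R b"] that by simp
    also have "\<dots> \<le> h * norm a + h * norm b"
      using that by (intro add_mono mult_right_mono) auto
    finally show ?thesis using h by (simp add: algebra_simps)
  qed
  obtain s t where 1: "0 < s" "s < h" "0 < t" "t < h" "f (x + h *\<^sub>R a + h *\<^sub>R b) - f (x + h *\<^sub>R a) - f (x + h *\<^sub>R b) + f x
       = h * h * G (x + s *\<^sub>R a + t *\<^sub>R b)"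
    using second_difference_mvt[of h x a b S f] near d(2) assms(2) h unfolding G_def by meson
  have near': "dist (x + s *\<^sub>R b + t *\<^sub>R a) x < d" if "0 \<le> s" "s \<le> h" "0 \<le> t" "t \<le> h" for s t
    using near[of t s] that by (simp add: algebra_simps)
  obtain s' t' where 2: "0 < s'" "s' < h" "0 < t'" "t' < h" "f (x + h *\<^sub>R b + h *\<^sub>R a) - f (x + h *\<^sub>R b) - f (x + h *\<^sub>R a) + f x
       = h * h * F (x + s' *\<^sub>R b + t' *\<^sub>R a)"
    using second_difference_mvt[of h x b a S f] near' d(2) assms(2) h unfolding F_def by meson
  have "h * h * G (x + s *\<^sub>R a + t *\<^sub>R b) = h * h * F (x + s' *\<^sub>R b + t' *\<^sub>R a)"
    using 1(5) 2(5) by (simp add: algebra_simps)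
  then have "G (x + s *\<^sub>R a + t *\<^sub>R b) = F (x + s' *\<^sub>R b + t' *\<^sub>R a)"
    using h by simp
  moreover have "dist (F (x + s' *\<^sub>R b + t' *\<^sub>R a)) (F x) < \<bar>F x - G x\<bar> / 2"
    using d(2) near'[of s' t'] 2 by auto
  moreover have "dist (G (x + s *\<^sub>R a + t *\<^sub>R b)) (G x) < \<bar>F x - G x\<bar> / 2"
    using d(2) near[of s t] 1 by auto
  ultimately have "dist (F x) (G x) < \<bar>F x - G x\<bar>"
    using dist_triangle_half_r by metis
  then show False
    by (simp add: dist_real_def)
qed

lemma dderiv_inner:
  assumes "f differentiable (at x)"
  shows "dderiv v (\<lambda>y. f y \<bullet> c) x = dderiv v f x \<bullet> c"
  by (rule dderiv_eqI) (use assms in \<open>auto intro!: has_derivative_inner_left simp: frechet_derivative_works\<close>)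

lemma dderiv_commute:
  fixes f :: "'a::real_normed_vector \<Rightarrow> 'b::euclidean_space"
  assumes "open S" "smooth_on S f" "x \<in> S"
  shows "dderiv a (dderiv b f) x = dderiv b (dderiv a f) x"
proof (rule euclidean_eqI)
  fix c :: 'b
  have fc: "smooth_on S (\<lambda>y. f y \<bullet> c)"
    by (intro smooth_intros assms)
  have 1: "dderiv a (dderiv b f) x \<bullet> c = dderiv a (dderiv b (\<lambda>y. f y \<bullet> c)) x" for a b
  proof -
    have "dderiv a (dderiv b f) x \<bullet> c = dderiv a (\<lambda>y. dderiv b f y \<bullet> c) x"
      by (rule dderiv_inner[symmetric]) (rule smooth_on_differentiable[OF smooth_on_dderiv[OF assms(2)] assms(3)])
    also have "\<dots> = dderiv a (dderiv b (\<lambda>y. f y \<bullet> c)) x"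
      using frechet_derivative_cong_open[OF assms(1,3), of "\<lambda>y. dderiv b f y \<bullet> c" "dderiv b (\<lambda>y. f y \<bullet> c)"]
        dderiv_inner[OF smooth_on_differentiable[OF assms(2)]] by simp
    finally show ?thesis .
  qed
  show "dderiv a (dderiv b f) x \<bullet> c = dderiv b (dderiv a f) x \<bullet> c"
    using dderiv_commute_real[OF assms(1) fc assms(3), of a b] by (simp add: 1)
qed

section \<open>Regular level sets\<close>

text \<open>Replacing the coordinate in the direction \<open>e\<close> by the defining function \<open>\<rho>\<close> gives a local
  diffeomorphism. Its inverse \<open>\<Psi>\<close>, restricted to the hyperplane orthogonal to \<open>e\<close>, parametrises the
  zero set of \<open>\<rho>\<close>.\<close>

lemma level_set_chart:
  fixes \<rho> :: "'a::euclidean_space \<Rightarrow> real"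
  assumes "open U" "smooth_on U \<rho>" "p \<in> U" "norm e = 1" and ne: "dderiv e \<rho> p \<noteq> 0"
    and P: "\<And>x. P x = x - (e \<bullet> x) *\<^sub>R e"
  obtains U' W \<Psi> \<Psi>' where "open U'" "p \<in> U'" "U' \<subseteq> U" "open W"
    "\<And>z. z \<in> W \<Longrightarrow> (\<Psi> has_derivative \<Psi>' z) (at z)"
    "\<And>z. z \<in> W \<Longrightarrow> \<Psi> z \<in> U'"
    "\<And>z. z \<in> W \<Longrightarrow> P (\<Psi> z) + \<rho> (\<Psi> z) *\<^sub>R e = z"
    "\<And>x. x \<in> U' \<Longrightarrow> P x + \<rho> x *\<^sub>R e \<in> W"
    "\<And>x. x \<in> U' \<Longrightarrow> \<Psi> (P x + \<rho> x *\<^sub>R e) = x"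
    "\<And>z v. z \<in> W \<Longrightarrow> P (\<Psi>' z v) + dderiv (\<Psi>' z v) \<rho> (\<Psi> z) *\<^sub>R e = v"
proof -
  have ee: "e \<bullet> e = 1"
    using assms(4) by (simp add: norm_eq_1)
  define \<Phi> where "\<Phi> x = x - (e \<bullet> x) *\<^sub>R e + \<rho> x *\<^sub>R e" for x
  define D where "D x v = v - (e \<bullet> v) *\<^sub>R e + dderiv v \<rho> x *\<^sub>R e" for x v
  have d\<rho>: "(\<rho> has_derivative (\<lambda>v. dderiv v \<rho> x)) (at x)" if "x \<in> U" for x
    using smooth_on_has_derivative[OF assms(2) that] .
  have d\<Phi>: "(\<Phi> has_derivative D x) (at x)" if "x \<in> U" for x
    unfolding \<Phi>_def D_def by (intro derivative_intros d\<rho> that)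
  have bl: "bounded_linear (D x)" if "x \<in> U" for x
    using d\<Phi>[OF that] has_derivative_bounded_linear by blast
  define F where "F x = Blinfun (D x)" for x
  have F: "blinfun_apply (F x) = D x" if "x \<in> U" for x
    unfolding F_def using bl[OF that] by (rule bounded_linear_Blinfun_apply)
  have d\<Phi>': "(\<Phi> has_derivative blinfun_apply (F x)) (at x)" if "x \<in> U" for x
    using d\<Phi>[OF that] F[OF that] by simp
  have contF: "continuous_on U F"
  proof (rule continuous_on_blinfun_componentwise)
    fix i :: 'a
    have "continuous_on U (\<lambda>x. D x i)"
      unfolding D_def by (intro continuous_intros smooth_on_continuous_on[OF smooth_on_dderiv[OF assms(2)]])
    then show "continuous_on U (\<lambda>x. blinfun_apply (F x) i)"
      using F by (simp cong: continuous_on_cong)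
  qed
  define R where "R v = (v - (e \<bullet> v) *\<^sub>R e) + ((e \<bullet> v - dderiv (v - (e \<bullet> v) *\<^sub>R e) \<rho> p) / dderiv e \<rho> p) *\<^sub>R e" for v
  have blR: "bounded_linear R"
  proof -
    have "bounded_linear (\<lambda>v. dderiv (v - (e \<bullet> v) *\<^sub>R e) \<rho> p)"
      by (rule bounded_linear_compose[OF has_derivative_bounded_linear[OF d\<rho>[OF assms(3)]]])
         (intro bounded_linear_sub bounded_linear_ident bounded_linear_scaleR_const bounded_linear_inner_right)
    then show ?thesis
      unfolding R_def
      by (intro bounded_linear_add bounded_linear_sub bounded_linear_ident bounded_linear_scaleR_const
          bounded_linear_inner_right bounded_linear_divide[THEN bounded_linear_compose])
  qed
  have RD: "R (D p v) = v" for v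
  proof -
    have fd: "\<rho> differentiable at p" using smooth_on_differentiable assms by blast
    have PD: "D p v - (e \<bullet> D p v) *\<^sub>R e = v - (e \<bullet> v) *\<^sub>R e" and E: "e \<bullet> D p v = dderiv v \<rho> p"
      unfolding D_def by (simp_all add: algebra_simps ee)
    have "v = (v - (e \<bullet> v) *\<^sub>R e) + (e \<bullet> v) *\<^sub>R e" by simp
    then have "dderiv v \<rho> p = dderiv (v - (e \<bullet> v) *\<^sub>R e) \<rho> p + (e \<bullet> v) * dderiv e \<rho> p"
      by (metis dderiv_add[OF fd] dderiv_cmul[OF fd] real_scaleR_def)
    then have "(dderiv v \<rho> p - dderiv (v - (e \<bullet> v) *\<^sub>R e) \<rho> p) / dderiv e \<rho> p = e \<bullet> v"
      using ne by simp
    then show ?thesis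
      unfolding R_def PD unfolding E by simp
  qed
  have inv: "Blinfun R o\<^sub>L F p = id_blinfun"
    by (rule blinfun_eqI) (simp add: bounded_linear_Blinfun_apply[OF blR] F[OF assms(3)] RD)
  obtain U' W \<Psi> \<Psi>' where c: "open U'" "U' \<subseteq> U" "p \<in> U'" "open W" "\<Phi> p \<in> W" "homeomorphism U' W \<Phi> \<Psi>"
    and d\<Psi>: "\<And>y. y \<in> W \<Longrightarrow> (\<Psi> has_derivative \<Psi>' y) (at y)"
    using inverse_function_theorem[OF assms(1) d\<Phi>' contF assms(3) inv] by metis
  have i1: "\<And>z. z \<in> W \<Longrightarrow> \<Psi> z \<in> U'" "\<And>z. z \<in> W \<Longrightarrow> \<Phi> (\<Psi> z) = z"
    "\<And>x. x \<in> U' \<Longrightarrow> \<Phi> x \<in> W" "\<And>x. x \<in> U' \<Longrightarrow> \<Psi> (\<Phi> x) = x"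
    using c(6) unfolding homeomorphism_def by auto
  have "D (\<Psi> z) (\<Psi>' z v) = v" if "z \<in> W" for z v
  proof -
    have "((\<lambda>z. \<Phi> (\<Psi> z)) has_derivative (\<lambda>v. D (\<Psi> z) (\<Psi>' z v))) (at z)"
      using has_derivative_compose[OF d\<Psi>[OF that] d\<Phi>] i1(1)[OF that] c(2) by blast
    moreover have "((\<lambda>z. \<Phi> (\<Psi> z)) has_derivative (\<lambda>v. v)) (at z)"
      by (rule has_derivative_transform_within_open[OF has_derivative_ident c(4) that]) (simp add: i1)
    ultimately show ?thesis
      by (metis has_derivative_unique)
  qed
  then show thesis
    using that[of U' W \<Psi> \<Psi>'] c d\<Psi> i1 unfolding \<Phi>_def D_def P by blast
qed

text \<open>The form in which the chart is used: \<open>P\<close> is the orthogonal projection along \<open>e\<close>, and \<open>\<Psi> \<circ> P\<close> maps a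
  neighbourhood of \<open>p\<close> into the level set and its derivative into the tangent spaces.\<close>

lemma level_set_parametrisation:
  fixes \<rho> :: "'a::euclidean_space \<Rightarrow> real"
  assumes U: "open U" "smooth_on U \<rho>" "p \<in> U" "\<rho> p = 0" and e: "norm e = 1" "dderiv e \<rho> p \<noteq> 0"
    and P: "\<And>x. P x = x - (e \<bullet> x) *\<^sub>R e"
  obtains U' W \<Psi> \<Psi>' where "open U'" "p \<in> U'" "U' \<subseteq> U" "open W" "P p \<in> W" "bounded_linear P"
    "\<And>z. z \<in> W \<Longrightarrow> (\<Psi> has_derivative \<Psi>' z) (at z)"
    "\<And>x. P x \<in> W \<Longrightarrow> \<Psi> (P x) \<in> U \<and> \<rho> (\<Psi> (P x)) = 0 \<and> P (\<Psi> (P x)) = P x"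
    "\<And>x v. P x \<in> W \<Longrightarrow> dderiv (\<Psi>' (P x) (P v)) \<rho> (\<Psi> (P x)) = 0 \<and> P (\<Psi>' (P x) (P v)) = P v"
    "\<And>x. x \<in> U' \<Longrightarrow> \<rho> x = 0 \<Longrightarrow> \<Psi> (P x) = x"
proof -
  have ee: "e \<bullet> e = 1"
    using e by (simp add: norm_eq_1)
  have eP: "e \<bullet> P x = 0" for x by (simp add: P ee algebra_simps)
  have blP: "bounded_linear P"
    unfolding P
    by (intro bounded_linear_sub bounded_linear_ident bounded_linear_scaleR_const bounded_linear_inner_right)
  obtain U' W \<Psi> \<Psi>' where c: "open U'" "p \<in> U'" "U' \<subseteq> U" "open W"
    "\<And>z. z \<in> W \<Longrightarrow> (\<Psi> has_derivative \<Psi>' z) (at z)"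
    "\<And>z. z \<in> W \<Longrightarrow> \<Psi> z \<in> U'"
    "\<And>z. z \<in> W \<Longrightarrow> P (\<Psi> z) + \<rho> (\<Psi> z) *\<^sub>R e = z"
    "\<And>x. x \<in> U' \<Longrightarrow> P x + \<rho> x *\<^sub>R e \<in> W"
    "\<And>x. x \<in> U' \<Longrightarrow> \<Psi> (P x + \<rho> x *\<^sub>R e) = x"
    "\<And>z v. z \<in> W \<Longrightarrow> P (\<Psi>' z v) + dderiv (\<Psi>' z v) \<rho> (\<Psi> z) *\<^sub>R e = v"
    by (rule level_set_chart[OF U(1,2,3) e P], rule that)
  have split: "k = 0 \<and> P y = P x" if "P y + k *\<^sub>R e = P x" for x y k
  proof -
    have "e \<bullet> (P y + k *\<^sub>R e) = e \<bullet> P x" using that by simp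
    then have "k = 0" by (simp add: inner_add_right eP ee)
    then show ?thesis using that by simp
  qed
  show thesis
  proof (rule that[OF c(1-4) _ blP c(5)])
    show "P p \<in> W" using c(8)[OF c(2)] U(4) by simp
    show "\<Psi> (P x) \<in> U \<and> \<rho> (\<Psi> (P x)) = 0 \<and> P (\<Psi> (P x)) = P x" if "P x \<in> W" for x
      using split[OF c(7)[OF that]] c(3) c(6)[OF that] by blast
    show "dderiv (\<Psi>' (P x) (P v)) \<rho> (\<Psi> (P x)) = 0 \<and> P (\<Psi>' (P x) (P v)) = P v" if "P x \<in> W" for x v
      using split[OF c(10)[OF that, of "P v"]] .
    show "\<Psi> (P x) = x" if "x \<in> U'" "\<rho> x = 0" for x
      using c(9)[OF that(1)] that(2) by simp
  qed
qed

text \<open>A function that vanishes on a regular level set has vanishing tangential derivatives, since every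
  tangent vector is the velocity of a curve in the level set.\<close>

lemma level_set_tangential_derivative_0:
  fixes \<rho> :: "'a::euclidean_space \<Rightarrow> real" and G :: "'a \<Rightarrow> 'b::real_normed_vector"
  assumes U: "open U" "smooth_on U \<rho>" "p \<in> U" "\<rho> p = 0" and ne: "dderiv w \<rho> p \<noteq> 0"
    and G: "(G has_derivative G') (at p)" "\<And>x. x \<in> U \<Longrightarrow> \<rho> x = 0 \<Longrightarrow> G x = 0"
    and v: "dderiv v \<rho> p = 0"
  shows "G' v = 0"
proof -
  have fd: "\<rho> differentiable at p" using smooth_on_differentiable U by blast
  define e where "e = w /\<^sub>R norm w"
  have "w \<noteq> 0" using ne dderiv_0[OF fd] by auto
  then have e: "norm e = 1" "dderiv e \<rho> p \<noteq> 0"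
    using ne by (auto simp: e_def dderiv_cmul[OF fd])
  define P where "P x = x - (e \<bullet> x) *\<^sub>R e" for x
  obtain U' W \<Psi> \<Psi>' where c: "open U'" "p \<in> U'" "U' \<subseteq> U" "open W" "P p \<in> W" "bounded_linear P"
    "\<And>z. z \<in> W \<Longrightarrow> (\<Psi> has_derivative \<Psi>' z) (at z)"
    "\<And>x. P x \<in> W \<Longrightarrow> \<Psi> (P x) \<in> U \<and> \<rho> (\<Psi> (P x)) = 0 \<and> P (\<Psi> (P x)) = P x"
    "\<And>x v. P x \<in> W \<Longrightarrow> dderiv (\<Psi>' (P x) (P v)) \<rho> (\<Psi> (P x)) = 0 \<and> P (\<Psi>' (P x) (P v)) = P v"
    "\<And>x. x \<in> U' \<Longrightarrow> \<rho> x = 0 \<Longrightarrow> \<Psi> (P x) = x"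
    by (rule level_set_parametrisation[OF U e P_def], rule that)
  have z0: "\<Psi> (P p) = p" by (rule c(10)[OF c(2) U(4)])
  define y where "y = \<Psi>' (P p) (P v)"
  have y: "dderiv y \<rho> p = 0" "P y = P v"
    using c(9)[OF c(5), of v] z0 by (simp_all add: y_def)
  then have y3: "y = v + (e \<bullet> y - e \<bullet> v) *\<^sub>R e" by (simp add: P_def algebra_simps)
  have "dderiv y \<rho> p = dderiv v \<rho> p + (e \<bullet> y - e \<bullet> v) * dderiv e \<rho> p"
    by (subst y3) (simp add: dderiv_add[OF fd] dderiv_cmul[OF fd])
  then have "y = v" using y(1) v e(2) y3 by simp
  have "((\<lambda>x. G (\<Psi> (P x))) has_derivative (\<lambda>v. G' (\<Psi>' (P p) (P v)))) (at p)"
    using has_derivative_compose[OF has_derivative_compose[OF bounded_linear_imp_has_derivative[OF c(6)] c(7)[OF c(5)]]]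
      G(1) z0 by simp
  moreover have "((\<lambda>x. G (\<Psi> (P x))) has_derivative (\<lambda>v. 0)) (at p)"
  proof (rule has_derivative_transform_within_open[OF has_derivative_const])
    show "open (P -` W)" by (intro open_vimage c(4) linear_continuous_on[OF c(6)])
    show "p \<in> P -` W" using c(5) by simp
    show "0 = G (\<Psi> (P x))" if "x \<in> P -` W" for x
      using c(8)[of x] that G(2) by simp
  qed
  ultimately have "(\<lambda>v. G' (\<Psi>' (P p) (P v))) = (\<lambda>v. 0)"
    by (rule has_derivative_unique)
  then have "G' (\<Psi>' (P p) (P v)) = 0" by metis
  then show ?thesis using \<open>y = v\<close> y_def by simp
qed

text \<open>In the chart, a function with vanishing tangential derivatives has derivative zero on a ball of the
  parameter hyperplane.\<close>

lemma level_set_locally_constant: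
  fixes \<rho> :: "'a::euclidean_space \<Rightarrow> real" and G :: "'a \<Rightarrow> 'b::real_normed_vector"
  assumes U: "open U" "smooth_on U \<rho>" "p \<in> U" "\<rho> p = 0" and ne: "dderiv w \<rho> p \<noteq> 0"
    and G: "\<And>x. x \<in> U \<Longrightarrow> \<rho> x = 0 \<Longrightarrow> (G has_derivative G' x) (at x)"
    and tang: "\<And>x v. x \<in> U \<Longrightarrow> \<rho> x = 0 \<Longrightarrow> dderiv v \<rho> x = 0 \<Longrightarrow> G' x v = 0"
  obtains V where "open V" "p \<in> V" "V \<subseteq> U" "\<And>x. x \<in> V \<Longrightarrow> \<rho> x = 0 \<Longrightarrow> G x = G p"
proof -
  have fd: "\<rho> differentiable at p" using smooth_on_differentiable U by blast
  define e where "e = w /\<^sub>R norm w"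
  have "w \<noteq> 0" using ne dderiv_0[OF fd] by auto
  then have e: "norm e = 1" "dderiv e \<rho> p \<noteq> 0"
    using ne by (auto simp: e_def dderiv_cmul[OF fd])
  define P where "P x = x - (e \<bullet> x) *\<^sub>R e" for x
  obtain U' W \<Psi> \<Psi>' where c: "open U'" "p \<in> U'" "U' \<subseteq> U" "open W" "P p \<in> W" "bounded_linear P"
    "\<And>z. z \<in> W \<Longrightarrow> (\<Psi> has_derivative \<Psi>' z) (at z)"
    "\<And>x. P x \<in> W \<Longrightarrow> \<Psi> (P x) \<in> U \<and> \<rho> (\<Psi> (P x)) = 0 \<and> P (\<Psi> (P x)) = P x"
    "\<And>x v. P x \<in> W \<Longrightarrow> dderiv (\<Psi>' (P x) (P v)) \<rho> (\<Psi> (P x)) = 0 \<and> P (\<Psi>' (P x) (P v)) = P v"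
    "\<And>x. x \<in> U' \<Longrightarrow> \<rho> x = 0 \<Longrightarrow> \<Psi> (P x) = x"
    by (rule level_set_parametrisation[OF U e P_def], rule that)
  have "open (P -` W)"
    by (intro open_vimage c(4) linear_continuous_on[OF c(6)])
  then obtain r where r: "r > 0" "ball p r \<subseteq> P -` W"
    using c(5) open_contains_ball by (metis vimageI2)
  have d0: "((\<lambda>x. G (\<Psi> (P x))) has_derivative (\<lambda>v. 0)) (at x)" if "x \<in> ball p r" for x
  proof -
    have W: "P x \<in> W" using that r by auto
    then have L: "\<Psi> (P x) \<in> U" "\<rho> (\<Psi> (P x)) = 0" using c(8) by auto
    have "((\<lambda>x. G (\<Psi> (P x))) has_derivative (\<lambda>v. G' (\<Psi> (P x)) (\<Psi>' (P x) (P v)))) (at x)"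
      by (rule has_derivative_compose[OF has_derivative_compose[OF bounded_linear_imp_has_derivative[OF c(6)] c(7)[OF W]] G[OF L]])
    then show ?thesis using tang[OF L] c(9)[OF W] by simp
  qed
  show thesis
  proof
    show "open (U' \<inter> ball p r)" "p \<in> U' \<inter> ball p r" "U' \<inter> ball p r \<subseteq> U"
      using c r by auto
    fix x assume x: "x \<in> U' \<inter> ball p r" "\<rho> x = 0"
    have "G (\<Psi> (P x)) = G (\<Psi> (P p))"
      using has_derivative_zero_unique[OF convex_ball has_derivative_at_withinI[OF d0]] x r(1) by (metis IntD2 centre_in_ball)
    then show "G x = G p"
      using c(10)[of x] c(10)[OF c(2) U(4)] x by simp
  qed
qed

text \<open>The parametrisation moves each point of the hyperplane only in the transversal direction \<open>e\<close>.\<close>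

lemma level_set_meets_lines:
  fixes \<rho> :: "'a::euclidean_space \<Rightarrow> real"
  assumes U: "open U" "smooth_on U \<rho>" "p \<in> U" "\<rho> p = 0" and e: "norm e = 1" "dderiv e \<rho> p \<noteq> 0"
    and "\<epsilon> > 0"
  obtains V where "open V" "p \<in> V"
    "\<And>x. x \<in> V \<Longrightarrow> \<exists>t. x + t *\<^sub>R e \<in> U \<inter> ball p \<epsilon> \<and> \<rho> (x + t *\<^sub>R e) = 0"
proof -
  define P where "P x = x - (e \<bullet> x) *\<^sub>R e" for x
  have U2: "open (U \<inter> ball p \<epsilon>)" "smooth_on (U \<inter> ball p \<epsilon>) \<rho>" "p \<in> U \<inter> ball p \<epsilon>"
    using U \<open>\<epsilon> > 0\<close> by (auto intro: smooth_on_subset_set)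
  obtain W \<Psi> where c: "open W" "P p \<in> W" "bounded_linear P"
    "\<And>x. P x \<in> W \<Longrightarrow> \<Psi> (P x) \<in> U \<inter> ball p \<epsilon> \<and> \<rho> (\<Psi> (P x)) = 0 \<and> P (\<Psi> (P x)) = P x"
    by (rule level_set_parametrisation[OF U2 U(4) e P_def], rule that)
  show thesis
  proof
    show "open (P -` W)" by (intro open_vimage c(1) linear_continuous_on[OF c(3)])
    show "p \<in> P -` W" using c(2) by simp
    fix x assume "x \<in> P -` W"
    then have W: "P x \<in> W" by simp
    have "\<Psi> (P x) = x + (e \<bullet> \<Psi> (P x) - e \<bullet> x) *\<^sub>R e"
      using c(4)[OF W] by (simp add: P_def algebra_simps)
    then show "\<exists>t. x + t *\<^sub>R e \<in> U \<inter> ball p \<epsilon> \<and> \<rho> (x + t *\<^sub>R e) = 0"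
      using c(4)[OF W] by metis
  qed
qed

section \<open>Curvature of the Schwarzschild metric\<close>

definition mass_ratio :: "real \<Rightarrow> real ^ 'n::finite \<Rightarrow> real" where
  "mass_ratio m x = m / (2 * norm x ^ (CARD('n) - 2))"

text \<open>The metric is \<open>exp (2w)\<close> times the Euclidean one with \<open>exp w = (1 + s) powr (2 / (n - 2))\<close>,
  \<open>s\<close> the mass ratio; the Euclidean gradient of \<open>w\<close> at \<open>x\<close> is \<open>log_slope m x *\<^sub>R x\<close>.\<close>

definition log_slope :: "real \<Rightarrow> real ^ 'n::finite \<Rightarrow> real" where
  "log_slope m x = - 2 * mass_ratio m x / ((1 + mass_ratio m x) * (x \<bullet> x))"

definition conformal_factor :: "real \<Rightarrow> real ^ 'n::finite \<Rightarrow> real" where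
  "conformal_factor m x = (1 + mass_ratio m x) powr (4 / (real CARD('n) - 2))"

text \<open>The gradient of \<open>log_slope m\<close> at \<open>x\<close> is \<open>log_slope_slope m x *\<^sub>R x\<close>.\<close>

definition log_slope_slope :: "real \<Rightarrow> real ^ 'n::finite \<Rightarrow> real" where
  "log_slope_slope m x = (4 * mass_ratio m x ^ 2 + 2 * real CARD('n) * mass_ratio m x)
     / ((1 + mass_ratio m x) ^ 2 * (x \<bullet> x) ^ 2)"

text \<open>The Ricci tensor is \<open>R I - (n - 2) B x \<otimes> x\<close> with \<open>R\<close>, \<open>B\<close> the following functions. The factor \<open>n - 2\<close> is split
  off because \<open>B\<close> is then also the coefficient of \<open>x \<otimes> x\<close> in \<open>D\<^sup>2w - dw \<otimes> dw\<close>.\<close>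

definition ricci_tangential :: "real \<Rightarrow> real ^ 'n::finite \<Rightarrow> real" where
  "ricci_tangential m x = 2 * (real CARD('n) - 2) * mass_ratio m x / ((1 + mass_ratio m x) ^ 2 * (x \<bullet> x))"

definition ricci_radial :: "real \<Rightarrow> real ^ 'n::finite \<Rightarrow> real" where
  "ricci_radial m x = 2 * real CARD('n) * mass_ratio m x / ((1 + mass_ratio m x) ^ 2 * (x \<bullet> x) ^ 2)"

lemma schwarzschild_metric_eq: "schwarzschild_metric m x = conformal_factor m x *\<^sub>R mat 1"
  by (simp add: schwarzschild_metric_def conformal_factor_def mass_ratio_def)

lemma mass_ratio_pos: "m > 0 \<Longrightarrow> x \<noteq> 0 \<Longrightarrow> mass_ratio m x > 0"
  by (simp add: mass_ratio_def)

lemma mass_ratio_nonneg: "m > 0 \<Longrightarrow> mass_ratio m x \<ge> 0"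
  by (simp add: mass_ratio_def)

lemma conformal_factor_ge_1:
  fixes x :: "real ^ 'n::finite"
  assumes "m > 0" "CARD('n) \<ge> 3"
  shows "conformal_factor m x \<ge> 1"
  using mass_ratio_nonneg[OF assms(1), of x] assms(2)
  by (simp add: conformal_factor_def ge_one_powr_ge_zero)

lemma has_derivative_mass_ratio:
  fixes x :: "real ^ 'n::finite"
  assumes "m > 0" "CARD('n) \<ge> 3" "x \<noteq> 0"
  shows "(mass_ratio m has_derivative
     (\<lambda>v. - (real CARD('n) - 2) * mass_ratio m x / (x \<bullet> x) * (x \<bullet> v))) (at x)"
proof -
  define j where "j = CARD('n) - 2"
  have j: "real CARD('n) - 2 = real j" and j0: "j > 0"
    using assms(2) by (auto simp: j_def)
  have r: "norm x > 0" using assms(3) by simp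
  have xx: "x \<bullet> x = norm x * norm x" by (simp add: dot_square_norm power2_eq_square)
  have pw: "norm x ^ j = norm x ^ (j - 1) * norm x"
    using j0 by (metis One_nat_def Suc_diff_1 power_Suc2)
  define N :: "real ^ 'n \<Rightarrow> real" where "N = norm"
  have N: "(N has_derivative (\<lambda>v. sgn x \<bullet> v)) (at x)"
    unfolding N_def using has_derivative_norm[OF assms(3)] by (simp add: inner_commute)
  have "((\<lambda>x. m / (2 * N x ^ j)) has_derivative
     (\<lambda>v. - m * (2 * (real j * (sgn x \<bullet> v) * norm x ^ (j - 1))) / (2 * norm x ^ j) ^ 2)) (at x)"
    apply (rule has_derivative_eq_rhs)
     apply (rule derivative_intros N)+
    using r apply (simp add: N_def)
    apply (rule ext)
    using r by (simp add: N_def power2_eq_square divide_simps)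
  moreover have "- m * (2 * (real j * (sgn x \<bullet> v) * norm x ^ (j - 1))) / (2 * norm x ^ j) ^ 2
     = - real j * (m / (2 * norm x ^ j)) / (x \<bullet> x) * (x \<bullet> v)" for v
    using r unfolding pw xx by (simp add: sgn_div_norm field_simps power2_eq_square)
  ultimately show ?thesis
    by (simp only: mass_ratio_def[abs_def] j j_def[symmetric] N_def)
qed

lemma has_derivative_radial_inner:
  "((\<lambda>x. x \<bullet> x) has_derivative (\<lambda>v. 2 * (x \<bullet> v))) (at x)"
  by (rule has_derivative_eq_rhs[OF has_derivative_inner[OF has_derivative_ident has_derivative_ident]])
     (simp add: inner_commute fun_eq_iff)

lemma has_derivative_conformal_factor:
  fixes x :: "real ^ 'n::finite"
  assumes "m > 0" "CARD('n) \<ge> 3" "x \<noteq> 0"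
  shows "(conformal_factor m has_derivative (\<lambda>v. 2 * log_slope m x * conformal_factor m x * (x \<bullet> v))) (at x)"
proof -
  define a where "a = 4 / (real CARD('n) - 2)"
  have "real CARD('n) - 2 \<noteq> 0" using assms(2) by simp
  then have a: "a * (real CARD('n) - 2) = 4" unfolding a_def by (rule nonzero_eq_divide_eq[THEN iffD1, OF _ refl])
  have s: "1 + mass_ratio m x > 0" using mass_ratio_pos[OF assms(1,3)] by simp
  have d: "((\<lambda>x. 1 + mass_ratio m x) has_derivative
     (\<lambda>v. - (real CARD('n) - 2) * mass_ratio m x / (x \<bullet> x) * (x \<bullet> v))) (at x)"
    using has_derivative_add[OF has_derivative_const has_derivative_mass_ratio[OF assms]] by simp
  have gen: "- k * s / r * y * a / t = - (a * k) * s / r * y / t" for k s r y t :: real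
    by (simp add: mult_ac)
  have eq: "(1 + mass_ratio m x) powr a * (0 * ln (1 + mass_ratio m x) + - (real CARD('n) - 2) * mass_ratio m x / (x \<bullet> x) * (x \<bullet> v) * a / (1 + mass_ratio m x))
     = 2 * log_slope m x * (1 + mass_ratio m x) powr a * (x \<bullet> v)" for v
  proof -
    have "- (real CARD('n) - 2) * mass_ratio m x / (x \<bullet> x) * (x \<bullet> v) * a / (1 + mass_ratio m x)
       = - (a * (real CARD('n) - 2)) * mass_ratio m x / (x \<bullet> x) * (x \<bullet> v) / (1 + mass_ratio m x)"
      by (rule gen)
    then show ?thesis unfolding a by (simp add: log_slope_def mult_ac)
  qed
  show ?thesis
    unfolding conformal_factor_def[abs_def] a_def[symmetric]
    by (rule has_derivative_eq_rhs[OF has_derivative_powr[OF d has_derivative_const s UNIV_I]]) (simp only: eq)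
qed

lemma has_derivative_log_slope:
  fixes x :: "real ^ 'n::finite"
  assumes "m > 0" "CARD('n) \<ge> 3" "x \<noteq> 0"
  shows "(log_slope m has_derivative (\<lambda>v. log_slope_slope m x * (x \<bullet> v))) (at x)"
proof -
  have s: "1 + mass_ratio m x > 0" using mass_ratio_pos[OF assms(1,3)] by simp
  have xx: "x \<bullet> x > 0" using assms(3) by simp
  define q :: "real ^ 'n \<Rightarrow> real" where "q x = x \<bullet> x" for x
  have q: "(q has_derivative (\<lambda>v. 2 * (x \<bullet> v))) (at x)"
    unfolding q_def[abs_def] by (rule has_derivative_radial_inner)
  have "((\<lambda>x. - 2 * mass_ratio m x / ((1 + mass_ratio m x) * q x)) has_derivative
     (\<lambda>v. log_slope_slope m x * (x \<bullet> v))) (at x)"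
    apply (rule has_derivative_eq_rhs)
     apply (rule derivative_intros has_derivative_mass_ratio[OF assms] q)+
    using s xx apply (simp add: q_def)
    apply (rule ext)
    using s xx unfolding log_slope_slope_def q_def
    apply (simp add: divide_simps)
    apply (simp add: algebra_simps power2_eq_square)
    done
  then show ?thesis
    by (simp add: log_slope_def[abs_def] q_def)
qed

lemma log_slope_slope_eq:
  assumes "m > 0" "x \<noteq> 0"
  shows "log_slope_slope m x = ricci_radial m x + log_slope m x ^ 2"
  using mass_ratio_pos[OF assms] assms(2)
  unfolding log_slope_slope_def ricci_radial_def log_slope_def power_divide power_mult_distrib
  by (simp add: add_divide_distrib)

lemma matrix_inv_scalar:
  fixes c :: real
  assumes "c \<noteq> 0"
  shows "matrix_inv (c *\<^sub>R (mat 1 :: real ^ 'n::finite ^ 'n)) = (1 / c) *\<^sub>R mat 1"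
proof -
  have "(c *\<^sub>R (mat 1 :: real ^ 'n ^ 'n)) ** ((1 / c) *\<^sub>R mat 1) = mat 1"
    "((1 / c) *\<^sub>R (mat 1 :: real ^ 'n ^ 'n)) ** (c *\<^sub>R mat 1) = mat 1"
    using assms by (simp_all add: scalar_matrix_assoc matrix_scalar_ac)
  then have inv: "(c *\<^sub>R (mat 1 :: real ^ 'n ^ 'n)) ** matrix_inv (c *\<^sub>R mat 1) = mat 1"
    and l: "((1 / c) *\<^sub>R (mat 1 :: real ^ 'n ^ 'n)) ** (c *\<^sub>R mat 1) = mat 1"
    unfolding matrix_inv_def by (metis (mono_tags, lifting) someI_ex, blast)
  have "matrix_inv (c *\<^sub>R (mat 1 :: real ^ 'n ^ 'n))
      = (((1 / c) *\<^sub>R mat 1) ** (c *\<^sub>R mat 1)) ** matrix_inv (c *\<^sub>R mat 1)"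
    by (simp add: l)
  also have "\<dots> = (1 / c) *\<^sub>R mat 1"
    by (simp add: inv flip: matrix_mul_assoc)
  finally show ?thesis .
qed

lemma metric_ip_schwarzschild:
  "metric_ip (schwarzschild_metric m) x v w = conformal_factor m x * (v \<bullet> w)"
  by (simp add: metric_ip_def schwarzschild_metric_eq scaleR_matrix_vector_assoc[symmetric])

text \<open>From here on the Kronecker deltas are written out as conditionals, so that the simplifier can
  contract them.\<close>

lemma partial_metric:
  fixes x :: "real ^ 'n::finite"
  assumes "m > 0" "CARD('n) \<ge> 3" "x \<noteq> 0"
  shows "partial i (\<lambda>y. schwarzschild_metric m y $ j $ l) x =
     (if j = l then 2 * log_slope m x * conformal_factor m x * x $ i else 0)"
proof -
  have "((\<lambda>y. conformal_factor m y * (if j = l then 1 else 0)) has_derivative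
     (\<lambda>v. 2 * log_slope m x * conformal_factor m x * (x \<bullet> v) * (if j = l then 1 else 0))) (at x)"
    by (rule has_derivative_mult_left[OF has_derivative_conformal_factor[OF assms]])
  from dderiv_eqI[OF this, of "axis i 1"] show ?thesis
    by (simp add: partial_def schwarzschild_metric_eq mat_def inner_axis)
qed

lemma sum_if_const: "(\<Sum>j\<in>A. if P then f j else 0) = (if P then \<Sum>j\<in>A. f j else 0)"
  for f :: "'b \<Rightarrow> 'c::comm_monoid_add"
  by simp

lemma christoffel_schwarzschild:
  fixes x :: "real ^ 'n::finite"
  assumes "m > 0" "CARD('n) \<ge> 3" "x \<noteq> 0"
  shows "christoffel (schwarzschild_metric m) k i j x = log_slope m x *
     ((if k = j then x $ i else 0) + (if k = i then x $ j else 0) - (if i = j then x $ k else 0))"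
proof -
  have c: "conformal_factor m x > 0"
    using conformal_factor_ge_1[OF assms(1,2), of x] by simp
  have g: "matrix_inv (schwarzschild_metric m x) $ k $ l = (if k = l then 1 / conformal_factor m x else 0)" for l
    using c by (simp add: schwarzschild_metric_eq matrix_inv_scalar) (simp add: mat_def)
  show ?thesis
    unfolding christoffel_def partial_metric[OF assms] g mult_delta_left sum.delta'[OF finite] UNIV_I if_True
    using c by (simp add: divide_simps)
qed

lemma cov_deriv_schwarzschild:
  fixes x :: "real ^ 'n::finite"
  assumes "m > 0" "CARD('n) \<ge> 3" "x \<noteq> 0"
  shows "cov_deriv (schwarzschild_metric m) X Y x = dderiv (X x) Y x +
     log_slope m x *\<^sub>R ((x \<bullet> X x) *\<^sub>R Y x + (x \<bullet> Y x) *\<^sub>R X x - (X x \<bullet> Y x) *\<^sub>R x)"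
proof -
  let ?l = "log_slope m x"
  have inner: "(\<Sum>j\<in>UNIV. christoffel (schwarzschild_metric m) k i j x * X x $ i * Y x $ j) =
    ?l * (x $ i * X x $ i * Y x $ k + (if k = i then X x $ k * (x \<bullet> Y x) else 0) - x $ k * (X x $ i * Y x $ i))" for k i
  proof -
    have "christoffel (schwarzschild_metric m) k i j x * X x $ i * Y x $ j =
      ?l * ((if k = j then x $ i * X x $ i * Y x $ k else 0) + (if k = i then X x $ k * (x $ j * Y x $ j) else 0)
        - (if i = j then x $ k * (X x $ i * Y x $ i) else 0))" for j
      by (simp add: christoffel_schwarzschild[OF assms] algebra_simps)
    then show ?thesis
      by (simp add: sum.distrib sum_subtractf inner_vec_def sum_if_const flip: sum_distrib_left)
  qed
  have "(\<Sum>i\<in>UNIV. \<Sum>j\<in>UNIV. christoffel (schwarzschild_metric m) k i j x * X x $ i * Y x $ j) =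
    ?l * ((x \<bullet> X x) * Y x $ k + (x \<bullet> Y x) * X x $ k - (X x \<bullet> Y x) * x $ k)" for k
    unfolding inner
    by (simp add: sum.distrib sum_subtractf mult.commute[of "x $ k"] mult.commute[of "X x $ k"] inner_vec_def flip: sum_distrib_left sum_distrib_right)
  then show ?thesis
    by (simp add: cov_deriv_def vec_eq_iff)
qed

lemma hessian_schwarzschild:
  fixes x :: "real ^ 'n::finite"
  assumes "m > 0" "CARD('n) \<ge> 3" "x \<noteq> 0"
  shows "hessian (schwarzschild_metric m) u x $ i $ j = partial i (partial j u) x - log_slope m x *
     (x $ i * partial j u x + x $ j * partial i u x - (if i = j then \<Sum>k\<in>UNIV. x $ k * partial k u x else 0))"
  unfolding hessian_def christoffel_schwarzschild[OF assms]
  by (simp add: distrib_left distrib_right left_diff_distrib right_diff_distrib sum.distrib sum_subtractf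
        mult_delta_left mult_delta_right sum_distrib_left mult_ac cong: if_cong)

lemma partial_christoffel:
  fixes x :: "real ^ 'n::finite"
  assumes "m > 0" "CARD('n) \<ge> 3" "x \<noteq> 0"
  shows "partial a (christoffel (schwarzschild_metric m) k i j) x =
     log_slope_slope m x * x $ a * ((if k = j then x $ i else 0) + (if k = i then x $ j else 0) - (if i = j then x $ k else 0))
     + log_slope m x * ((if k = j \<and> i = a then 1 else 0) + (if k = i \<and> j = a then 1 else 0) - (if i = j \<and> k = a then 1 else 0))"
proof -
  define c where "c P = (if P then 1 else 0 :: real)" for P
  have ch: "christoffel (schwarzschild_metric m) k i j y =
     log_slope m y * (c (k = j) * y $ i + c (k = i) * y $ j - c (i = j) * y $ k)" if "y \<in> - {0}" for y
    using christoffel_schwarzschild[OF assms(1,2), of y] that by (simp add: c_def)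
  have co: "((\<lambda>y. y $ b) has_derivative (\<lambda>v. v $ b)) (at x)" for b :: 'n
    by (rule bounded_linear_imp_has_derivative[OF bounded_linear_vec_nth])
  have "((\<lambda>y. log_slope m y * (c (k = j) * y $ i + c (k = i) * y $ j - c (i = j) * y $ k)) has_derivative
     (\<lambda>v. log_slope m x * (c (k = j) * v $ i + c (k = i) * v $ j - c (i = j) * v $ k) +
       log_slope_slope m x * (x \<bullet> v) * (c (k = j) * x $ i + c (k = i) * x $ j - c (i = j) * x $ k))) (at x)"
    by (intro has_derivative_mult has_derivative_log_slope[OF assms] has_derivative_diff has_derivative_add
        has_derivative_mult_right co)
  then have "partial a (\<lambda>y. log_slope m y * (c (k = j) * y $ i + c (k = i) * y $ j - c (i = j) * y $ k)) x =
     log_slope m x * (c (k = j) * axis a 1 $ i + c (k = i) * axis a 1 $ j - c (i = j) * axis a 1 $ k) +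
       log_slope_slope m x * x $ a * (c (k = j) * x $ i + c (k = i) * x $ j - c (i = j) * x $ k)"
    unfolding partial_def by (subst dderiv_eqI, assumption) (simp add: inner_axis)
  moreover have "partial a (christoffel (schwarzschild_metric m) k i j) x =
     partial a (\<lambda>y. log_slope m y * (c (k = j) * y $ i + c (k = i) * y $ j - c (i = j) * y $ k)) x"
    unfolding partial_def
    by (rule fun_cong[OF frechet_derivative_cong_open[of "- {0}"]]) (use assms(3) ch in \<open>auto intro: ch\<close>)
  moreover have "axis a 1 $ b = c (b = a)" for b
    by (simp add: c_def axis_def)
  moreover have "(if P then y else 0) = c P * y" "(if P \<and> Q then 1 else 0) = c P * c Q" for P Q and y :: real
    by (simp_all add: c_def)
  ultimately show ?thesis
    by (simp only: add.commute mult.commute)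
qed

lemma ricci_tangential_identity:
  fixes x :: "real ^ 'n::finite"
  assumes "m > 0" "x \<noteq> 0"
  shows "log_slope_slope m x * (x \<bullet> x) + (2 * real CARD('n) - 2) * log_slope m x
      + (real CARD('n) - 2) * log_slope m x ^ 2 * (x \<bullet> x) = - ricci_tangential m x"
proof -
  define n s q where "n = real CARD('n)" and "s = mass_ratio m x" and "q = x \<bullet> x"
  have s: "1 + s \<noteq> 0" and q: "q \<noteq> 0"
    using mass_ratio_pos[OF assms] assms(2) by (auto simp: s_def q_def)
  let ?d = "(1 + s) ^ 2 * q"
  have "log_slope_slope m x * q = (4 * s ^ 2 + 2 * n * s) / ?d"
    using q by (simp add: log_slope_slope_def n_def s_def q_def power2_eq_square)
  moreover have "log_slope m x = - 2 * s * (1 + s) / ?d"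
    using s by (simp add: log_slope_def s_def q_def power2_eq_square)
  moreover have "log_slope m x ^ 2 * q = 4 * s ^ 2 / ?d"
    using q by (simp add: log_slope_def s_def q_def power2_eq_square)
  ultimately have "log_slope_slope m x * q + (2 * n - 2) * log_slope m x + (n - 2) * (log_slope m x ^ 2 * q)
     = ((4 * s ^ 2 + 2 * n * s) + (2 * n - 2) * (- 2 * s * (1 + s)) + (n - 2) * (4 * s ^ 2)) / ?d"
    by (simp only: add_divide_distrib times_divide_eq_right)
  also have "(4 * s ^ 2 + 2 * n * s) + (2 * n - 2) * (- 2 * s * (1 + s)) + (n - 2) * (4 * s ^ 2) = - (2 * (n - 2) * s)"
    by (simp add: algebra_simps power2_eq_square)
  finally show ?thesis
    by (simp add: ricci_tangential_def n_def s_def q_def mult.assoc)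
qed

lemma ricci_schwarzschild:
  fixes x :: "real ^ 'n::finite"
  assumes "m > 0" "CARD('n) \<ge> 3" "x \<noteq> 0"
  shows "ricci (schwarzschild_metric m) x $ j $ k =
     ricci_tangential m x * (if j = k then 1 else 0) - (real CARD('n) - 2) * ricci_radial m x * x $ j * x $ k"
proof -
  let ?l = "log_slope m x" and ?L = "log_slope_slope m x"
  have xx: "x \<bullet> x = (\<Sum>i\<in>UNIV. x $ i * x $ i)"
    by (simp add: inner_vec_def)
  let ?\<Gamma> = "christoffel (schwarzschild_metric m)"
  note delta_simps = distrib_left distrib_right left_diff_distrib right_diff_distrib sum.distrib sum_subtractf
        mult_delta_left mult_delta_right sum_distrib_left sum_if_const mult_ac
  have 1: "(\<Sum>i\<in>UNIV. partial i (?\<Gamma> i j k) x) =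
     ?L * (2 * x $ j * x $ k - (if j = k then x \<bullet> x else 0)) + (2 - real CARD('n)) * ?l * (if j = k then 1 else 0)"
  proof -
    have conj: "(if P \<and> Q then a else 0) = (if P then if Q then a else 0 else 0)" for P Q and a :: real by simp
    show ?thesis
      unfolding partial_christoffel[OF assms] xx conj
      by (simp add: delta_simps eq_commute[of k j] cong: if_cong)
  qed
  have 2: "(\<Sum>i\<in>UNIV. partial j (?\<Gamma> i i k) x) = real CARD('n) * (?L * x $ j * x $ k + ?l * (if j = k then 1 else 0))"
  proof -
    have conj: "(if P \<and> Q then a else 0) = (if Q then if P then a else 0 else 0)" for P Q and a :: real by simp
    show ?thesis
      unfolding partial_christoffel[OF assms] xx
      by (simp add: delta_simps conj eq_commute[of k j] cong: if_cong)
  qed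
  have tr: "(\<Sum>i\<in>UNIV. ?\<Gamma> i i a x) = real CARD('n) * ?l * x $ a" for a
    unfolding christoffel_schwarzschild[OF assms]
    by (simp add: delta_simps cong: if_cong)
  have 3: "(\<Sum>i\<in>UNIV. \<Sum>a\<in>UNIV. ?\<Gamma> i i a x * ?\<Gamma> a j k x) =
     real CARD('n) * ?l ^ 2 * (2 * x $ j * x $ k - (if j = k then x \<bullet> x else 0))"
  proof -
    have "(\<Sum>i\<in>UNIV. \<Sum>a\<in>UNIV. ?\<Gamma> i i a x * ?\<Gamma> a j k x) = (\<Sum>a\<in>UNIV. (\<Sum>i\<in>UNIV. ?\<Gamma> i i a x) * ?\<Gamma> a j k x)"
      by (subst sum.swap) (simp add: sum_distrib_right)
    also have "\<dots> = real CARD('n) * ?l ^ 2 * (2 * x $ j * x $ k - (if j = k then x \<bullet> x else 0))"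
      unfolding tr christoffel_schwarzschild[OF assms] xx
      by (simp add: delta_simps power2_eq_square cong: if_cong)
    finally show ?thesis .
  qed
  have 4: "(\<Sum>i\<in>UNIV. \<Sum>a\<in>UNIV. ?\<Gamma> i j a x * ?\<Gamma> a i k x) =
     ?l ^ 2 * ((real CARD('n) + 2) * x $ j * x $ k - 2 * (if j = k then x \<bullet> x else 0))"
    unfolding christoffel_schwarzschild[OF assms] xx
    by (simp add: delta_simps power2_eq_square sum_negf eq_commute[of k j] cong: if_cong)
  have "ricci (schwarzschild_metric m) x $ j $ k =
     ?L * (2 * x $ j * x $ k - (if j = k then x \<bullet> x else 0)) + (2 - real CARD('n)) * ?l * (if j = k then 1 else 0)
     - real CARD('n) * (?L * x $ j * x $ k + ?l * (if j = k then 1 else 0))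
     + real CARD('n) * ?l ^ 2 * (2 * x $ j * x $ k - (if j = k then x \<bullet> x else 0))
     - ?l ^ 2 * ((real CARD('n) + 2) * x $ j * x $ k - 2 * (if j = k then x \<bullet> x else 0))"
    by (simp add: ricci_def riemann_def sum.distrib sum_subtractf 1 2 3 4)
  also have "\<dots> = (2 - real CARD('n)) * (?L - ?l ^ 2) * x $ j * x $ k
     - (?L * (x \<bullet> x) + (2 * real CARD('n) - 2) * ?l + (real CARD('n) - 2) * ?l ^ 2 * (x \<bullet> x)) * (if j = k then 1 else 0)"
  proof -
    define d :: real where "d = (if j = k then 1 else 0)"
    have d: "(if j = k then x \<bullet> x else 0) = (x \<bullet> x) * d"
      by (simp add: d_def)
    show ?thesis
      unfolding d unfolding d_def[symmetric] by (simp add: algebra_simps)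
  qed
  finally have eq: "ricci (schwarzschild_metric m) x $ j $ k = \<dots>" .
  have gen: "(2 - n) * R * a * b - - T * d = T * d - (n - 2) * R * a * b" for n R a b T d :: real
    by (simp add: algebra_simps)
  have rad: "?L - ?l ^ 2 = ricci_radial m x"
    using log_slope_slope_eq[OF assms(1,3)] by simp
  show ?thesis
    unfolding eq rad ricci_tangential_identity[OF assms(1,3)] by (rule gen)
qed

text \<open>The Schwarzschild metric is scalar flat.\<close>

lemma ricci_schwarzschild_trace:
  fixes x :: "real ^ 'n::finite"
  assumes "m > 0" "CARD('n) \<ge> 3" "x \<noteq> 0"
  shows "(\<Sum>i\<in>UNIV. ricci (schwarzschild_metric m) x $ i $ i) = 0"
proof -
  have "(\<Sum>i\<in>UNIV. ricci (schwarzschild_metric m) x $ i $ i) =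
    real CARD('n) * ricci_tangential m x - (real CARD('n) - 2) * ricci_radial m x * (x \<bullet> x)"
    unfolding ricci_schwarzschild[OF assms]
    by (simp add: sum_subtractf inner_vec_def sum_distrib_left mult.assoc)
  also have "\<dots> = 0"
  proof -
    have "ricci_radial m x * (x \<bullet> x) = 2 * real CARD('n) * mass_ratio m x / ((1 + mass_ratio m x) ^ 2 * (x \<bullet> x))"
      using assms(3) by (simp add: ricci_radial_def power2_eq_square)
    then show ?thesis
      by (simp add: ricci_tangential_def mult.assoc)
  qed
  finally show ?thesis .
qed

text \<open>Because the metric is scalar flat, the trace of \<open>L\<^sup>*u = 0\<close> says that \<open>u\<close> is harmonic, and the
  equation becomes \<open>Hess u = u Ric\<close>.\<close>

lemma Lstar_schwarzschild_eq_0_iff: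
  fixes x :: "real ^ 'n::finite"
  assumes "m > 0" "CARD('n) \<ge> 3" "x \<noteq> 0"
  shows "Lstar (schwarzschild_metric m) u x = 0 \<longleftrightarrow>
     (\<forall>i j. hessian (schwarzschild_metric m) u x $ i $ j = u x * ricci (schwarzschild_metric m) x $ i $ j)"
proof -
  let ?g = "schwarzschild_metric m" and ?c = "conformal_factor m x"
  have c: "?c > 0"
    using conformal_factor_ge_1[OF assms(1,2), of x] by simp
  have g: "matrix_inv (?g x) $ k $ l = (if k = l then 1 / ?c else 0)" for k l
    using c by (simp add: schwarzschild_metric_eq matrix_inv_scalar) (simp add: mat_def)
  have lap: "laplacian ?g u x = (\<Sum>i\<in>UNIV. hessian ?g u x $ i $ i) / ?c"
    unfolding laplacian_def g by (simp add: mult_delta_left sum_divide_distrib)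
  have entry: "Lstar ?g u x $ i $ j = - laplacian ?g u x * ?c * (if i = j then 1 else 0)
     + hessian ?g u x $ i $ j - u x * ricci ?g x $ i $ j" for i j
    by (simp add: Lstar_def schwarzschild_metric_eq mat_def)
  have 1: "laplacian ?g u x = 0" if "Lstar ?g u x = 0"
  proof -
    have "0 = (\<Sum>i\<in>UNIV. Lstar ?g u x $ i $ i)"
      using that by simp
    also have "\<dots> = - real CARD('n) * (laplacian ?g u x * ?c) + laplacian ?g u x * ?c"
      unfolding entry using c
      by (simp add: sum.distrib sum_subtractf lap ricci_schwarzschild_trace[OF assms] flip: sum_distrib_left)
    also have "\<dots> = (1 - real CARD('n)) * (laplacian ?g u x * ?c)"
      by (simp add: algebra_simps)
    finally show ?thesis using c assms(2) by auto
  qed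
  have 2: "laplacian ?g u x = 0"
    if "\<And>i j. hessian ?g u x $ i $ j = u x * ricci ?g x $ i $ j"
    unfolding lap that sum_distrib_left[symmetric] ricci_schwarzschild_trace[OF assms] by simp
  have 3: "Lstar ?g u x = 0 \<longleftrightarrow> (\<forall>i j. Lstar ?g u x $ i $ j = 0)"
    by (simp add: vec_eq_iff)
  show ?thesis
  proof
    assume L: "Lstar ?g u x = 0"
    then show "\<forall>i j. hessian ?g u x $ i $ j = u x * ricci ?g x $ i $ j"
      using 3 entry 1[OF L] by simp
  next
    assume h: "\<forall>i j. hessian ?g u x $ i $ j = u x * ricci ?g x $ i $ j"
    show "Lstar ?g u x = 0"
      unfolding 3 entry using h 2 by simp
  qed
qed

text \<open>Written bilinearly in constant vectors \<open>v\<close> and \<open>w\<close>, the equation can be tested in directions adapted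
  to the radius instead of the coordinate directions; the left-hand side is the Hessian of the metric.\<close>

lemma static_equation:
  fixes u :: "real ^ 'n::finite \<Rightarrow> real"
  assumes "m > 0" "CARD('n) \<ge> 3" and S: "open S" "smooth_on S u" "x \<in> S" and "x \<noteq> 0"
  shows "Lstar (schwarzschild_metric m) u x = 0 \<longleftrightarrow>
    (\<forall>v w. dderiv v (dderiv w u) x
         - log_slope m x * ((x \<bullet> v) * dderiv w u x + (x \<bullet> w) * dderiv v u x - (v \<bullet> w) * dderiv x u x)
       = u x * (ricci_tangential m x * (v \<bullet> w) - (real CARD('n) - 2) * ricci_radial m x * (x \<bullet> v) * (x \<bullet> w)))"
proof -
  define F where "F v w = dderiv v (dderiv w u) x
      - log_slope m x * ((x \<bullet> v) * dderiv w u x + (x \<bullet> w) * dderiv v u x - (v \<bullet> w) * dderiv x u x)" for v w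
  define R where "R v w = u x * (ricci_tangential m x * (v \<bullet> w) - (real CARD('n) - 2) * ricci_radial m x * (x \<bullet> v) * (x \<bullet> w))" for v w
  have l1: "linear (\<lambda>v. dderiv v u x)"
    by (rule linear_frechet_derivative[OF smooth_on_differentiable[OF S(2,3)]])
  have l2: "linear (\<lambda>v. dderiv v (dderiv w u) x)" for w
    by (rule linear_frechet_derivative[OF smooth_on_differentiable[OF smooth_on_dderiv[OF S(2)] S(3)]])
  have l3: "linear (\<lambda>w. dderiv v (dderiv w u) x)" for v
    using l2[of v] by (simp add: dderiv_commute_real[OF S, of v])
  note lin = linear_add[OF l1] linear_cmul[OF l1] linear_add[OF l2] linear_cmul[OF l2] linear_add[OF l3] linear_cmul[OF l3]
  have bF: "bilinear F"
    unfolding bilinear_def by (intro conjI allI linearI) (simp_all add: F_def lin algebra_simps)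
  have bR: "bilinear R"
    unfolding bilinear_def by (intro conjI allI linearI) (simp_all add: R_def algebra_simps)
  have gx: "(\<Sum>k\<in>UNIV. x $ k * partial k u x) = dderiv x u x"
  proof -
    have "dderiv x u x = dderiv (\<Sum>k\<in>UNIV. x $ k *\<^sub>R axis k 1) u x"
      by (simp add: basis_expansion flip: scalar_mult_eq_scaleR)
    then show ?thesis
      by (simp add: linear_sum[OF l1] linear_cmul[OF l1] partial_def)
  qed
  have F: "hessian (schwarzschild_metric m) u x $ i $ j = F (axis i 1) (axis j 1)" for i j
    unfolding hessian_schwarzschild[OF assms(1,2,6)] gx F_def
    by (simp add: partial_def[abs_def] inner_axis) (simp add: axis_def inner_axis' inner_vec_def if_distrib cong: if_cong)
  have R: "u x * ricci (schwarzschild_metric m) x $ i $ j = R (axis i 1) (axis j 1)" for i j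
    unfolding ricci_schwarzschild[OF assms(1,2,6)] R_def
    by (simp add: inner_axis) (simp add: axis_def)
  have "Lstar (schwarzschild_metric m) u x = 0 \<longleftrightarrow> (\<forall>i j. F (axis i 1) (axis j 1) = R (axis i 1) (axis j 1))"
    unfolding Lstar_schwarzschild_eq_0_iff[OF assms(1,2,6)] F R ..
  also have "\<dots> \<longleftrightarrow> (\<forall>b\<in>Basis. \<forall>c\<in>Basis. F b c = R b c)"
    by (auto simp: Basis_vec_def)
  also have "\<dots> \<longleftrightarrow> (\<forall>v w. F v w = R v w)"
    using bilinear_eq_stdbasis[OF bF bR] by (metis (full_types))
  finally show ?thesis
    unfolding F_def R_def .
qed

section \<open>The static potential and its uniqueness\<close>

definition static_potential :: "real \<Rightarrow> real ^ 'n::finite \<Rightarrow> real" where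
  "static_potential m x = (1 - mass_ratio m x) / (1 + mass_ratio m x)"

lemma one_plus_mass_ratio_pos: "m > 0 \<Longrightarrow> 1 + mass_ratio m x > 0"
  using mass_ratio_nonneg[of m x] by simp

lemma smooth_on_mass_ratio: "smooth_on (- {0}) (mass_ratio m :: real ^ 'n::finite \<Rightarrow> real)"
proof (rule smooth_on_cong)
  show "smooth_on (- {0}) (\<lambda>x :: real ^ 'n. m / 2 * (x \<bullet> x) powr (- real (CARD('n) - 2) / 2))"
    by (intro smooth_intros) auto
  fix x :: "real ^ 'n" assume "x \<in> - {0}"
  then have "norm x > 0" by simp
  then have "(x \<bullet> x) powr (- real (CARD('n) - 2) / 2) = norm x powr (- real (CARD('n) - 2))"
  proof -
    have "x \<bullet> x = norm x powr 2"
      using \<open>norm x > 0\<close> by (simp add: dot_square_norm)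
    then show ?thesis
      by (simp only: powr_powr) simp
  qed
  also have "\<dots> = 1 / norm x ^ (CARD('n) - 2)"
    using \<open>norm x > 0\<close> by (simp add: powr_minus_divide powr_realpow)
  finally show "m / 2 * (x \<bullet> x) powr (- real (CARD('n) - 2) / 2) = mass_ratio m x"
    by (simp add: mass_ratio_def)
qed auto

lemma smooth_on_static_potential:
  assumes "m > 0"
  shows "smooth_on (- {0}) (static_potential m :: real ^ 'n::finite \<Rightarrow> real)"
proof -
  have "1 + mass_ratio m x > 0" for x :: "real ^ 'n"
    using mass_ratio_nonneg[OF assms, of x] by simp
  then show ?thesis
    unfolding static_potential_def[abs_def]
    by (intro smooth_on_divide_pos smooth_intros smooth_on_mass_ratio open_Compl closed_singleton) auto
qed

text \<open>The tangential Ricci curvature doubles as the radial slope of the static potential.\<close>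

lemma has_derivative_static_potential:
  fixes x :: "real ^ 'n::finite"
  assumes "m > 0" "CARD('n) \<ge> 3" "x \<noteq> 0"
  shows "(static_potential m has_derivative (\<lambda>v. ricci_tangential m x * (x \<bullet> v))) (at x)"
proof -
  have s: "1 + mass_ratio m x > 0" using mass_ratio_pos[OF assms(1,3)] by simp
  have xx: "x \<bullet> x > 0" using assms(3) by simp
  show ?thesis
    unfolding static_potential_def[abs_def]
    apply (rule has_derivative_eq_rhs)
     apply (rule derivative_intros has_derivative_mass_ratio[OF assms])+
    using s apply simp
    apply (rule ext)
    using s xx unfolding ricci_tangential_def
    by (simp add: divide_simps) (simp add: algebra_simps power2_eq_square)
qed

text \<open>For a function with gradient \<open>h x\<close>, the Hessian of the metric in a unit direction orthogonal to \<open>x\<close> is \<open>h\<close>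
  times the left-hand side. That it equals the static potential makes the first-order equation for \<open>u\<close> in
  the uniqueness proof symmetric in \<open>u\<close> and the static potential.\<close>

lemma one_plus_log_slope:
  assumes "m > 0" "x \<noteq> 0"
  shows "1 + log_slope m x * (x \<bullet> x) = static_potential m x"
proof -
  have "1 + mass_ratio m x > 0" using mass_ratio_pos[OF assms] by simp
  then have "static_potential m x = 1 + - 2 * mass_ratio m x / (1 + mass_ratio m x)"
    by (simp add: static_potential_def divide_simps)
  then show ?thesis
    using assms(2) by (simp add: log_slope_def)
qed

lemma ricci_tangential_pos:
  fixes x :: "real ^ 'n::finite"
  assumes "m > 0" "CARD('n) \<ge> 3" "x \<noteq> 0"
  shows "ricci_tangential m x > 0"
  unfolding ricci_tangential_def
  using mass_ratio_pos[OF assms(1,3)] assms(2,3) by (intro divide_pos_pos mult_pos_pos) auto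

lemma ricci_radial_pos:
  fixes x :: "real ^ 'n::finite"
  assumes "m > 0" "x \<noteq> 0"
  shows "ricci_radial m x > 0"
  unfolding ricci_radial_def
  using mass_ratio_pos[OF assms] assms(2) by (intro divide_pos_pos mult_pos_pos) auto

lemma has_derivative_ratio_power:
  fixes x :: "real ^ 'n::finite" and c :: real and i :: nat
  assumes "m > 0" "CARD('n) \<ge> 3" "x \<noteq> 0"
  defines "n \<equiv> real CARD('n)" and "s \<equiv> mass_ratio m x"
  shows "((\<lambda>x. c * mass_ratio m x / ((1 + mass_ratio m x) ^ 2 * (x \<bullet> x) ^ Suc i)) has_derivative
     (\<lambda>v. c * s / ((1 + s) ^ 2 * (x \<bullet> x) ^ Suc i) * ((2 * (n - 2) * s / (1 + s) - (n - 2) - 2 * real (Suc i)) / (x \<bullet> x))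
        * (x \<bullet> v))) (at x)"
proof -
  define T P where "T = (\<lambda>x :: real ^ 'n. inverse (1 + mass_ratio m x))" and "P = (\<lambda>x :: real ^ 'n. inverse (x \<bullet> x))"
  define t p where "t = T x" and "p = P x"
  have d: "(mass_ratio m has_derivative (\<lambda>v. - (n - 2) * s * p * (x \<bullet> v))) (at x)"
    using has_derivative_mass_ratio[OF assms(1,2,3)]
    by (simp only: n_def s_def p_def P_def divide_inverse mult.assoc)
  have T: "(T has_derivative (\<lambda>v. t ^ 2 * (n - 2) * s * p * (x \<bullet> v))) (at x)"
  proof -
    have "((\<lambda>x. 1 + mass_ratio m x) has_derivative (\<lambda>v. 0 + - (n - 2) * s * p * (x \<bullet> v))) (at x)"
      by (rule has_derivative_add[OF has_derivative_const d])
    then have "(T has_derivative (\<lambda>v. - (t * (0 + - (n - 2) * s * p * (x \<bullet> v)) * t))) (at x)"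
      unfolding T_def t_def using mass_ratio_pos[OF assms(1,3)] by (intro Deriv.has_derivative_inverse) auto
    then show ?thesis
      by (rule has_derivative_eq_rhs) (simp add: power2_eq_square fun_eq_iff algebra_simps)
  qed
  have P: "(P has_derivative (\<lambda>v. - 2 * p ^ 2 * (x \<bullet> v))) (at x)"
  proof -
    have "(P has_derivative (\<lambda>v. - (p * (2 * (x \<bullet> v)) * p))) (at x)"
      unfolding P_def p_def by (rule Deriv.has_derivative_inverse[OF _ has_derivative_radial_inner]) (use assms(3) in simp)
    then show ?thesis
      by (rule has_derivative_eq_rhs) (simp add: power2_eq_square fun_eq_iff)
  qed
  have "((\<lambda>x. c * mass_ratio m x * (T x) ^ 2 * (P x) ^ Suc i) has_derivative
     (\<lambda>v. c * s * t ^ 2 * p ^ Suc i * ((2 * (n - 2) * s * t - (n - 2) - 2 * real (Suc i)) * p) * (x \<bullet> v))) (at x)"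
    apply (rule has_derivative_eq_rhs)
     apply (rule derivative_intros d T P)+
    apply (rule ext)
    unfolding t_def[symmetric] p_def[symmetric] s_def[symmetric]
    by (simp add: algebra_simps power2_eq_square)
  then show ?thesis
    by (simp only: T_def P_def t_def p_def s_def[symmetric] divide_inverse inverse_mult_distrib power_inverse mult.assoc)
qed

lemma has_derivative_ricci_tangential:
  fixes x :: "real ^ 'n::finite"
  assumes "m > 0" "CARD('n) \<ge> 3" "x \<noteq> 0"
  shows "(ricci_tangential m has_derivative (\<lambda>v. (2 * log_slope m x * ricci_tangential m x
     - (real CARD('n) - 2) * ricci_radial m x * static_potential m x) * (x \<bullet> v))) (at x)"
proof -
  define n s q where "n = real CARD('n)" and "s = mass_ratio m x" and "q = x \<bullet> x"
  have s: "1 + s > 0" using mass_ratio_pos[OF assms(1,3)] by (simp add: s_def)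
  have q: "q > 0" using assms(3) by (simp add: q_def)
  define t p where "t = 1 / (1 + s)" and "p = 1 / q"
  have st: "s * t = 1 - t" using s by (simp add: t_def field_simps)
  have "(2 * (n - 2) * s / (1 + s) - (n - 2) - 2 * real (Suc 0)) = 2 * (n - 2) * (s * t) - (n - 2) - 2"
    by (simp add: t_def)
  also have "\<dots> = - 4 * (s * t) - n * (t - s * t)"
    unfolding st by (simp add: algebra_simps)
  finally have "2 * (n - 2) * s / ((1 + s) ^ 2 * q ^ Suc 0) * ((2 * (n - 2) * s / (1 + s) - (n - 2) - 2 * real (Suc 0)) / q)
     = 2 * (n - 2) * s * t ^ 2 * p * ((- 4 * (s * t) - n * (t - s * t)) * p)"
    by (simp add: t_def p_def power_divide)
  also have "\<dots> = 2 * (- 2 * s * t * p) * (2 * (n - 2) * s * t ^ 2 * p) - (n - 2) * (2 * n * s * t ^ 2 * p ^ 2) * ((1 - s) * t)"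
    by (simp add: algebra_simps power2_eq_square)
  also have "\<dots> = 2 * log_slope m x * ricci_tangential m x - (n - 2) * ricci_radial m x * static_potential m x"
    unfolding log_slope_def ricci_tangential_def ricci_radial_def static_potential_def n_def[symmetric] s_def[symmetric] q_def[symmetric]
    by (simp add: t_def p_def power_divide)
  finally have k: "2 * (n - 2) * s / ((1 + s) ^ 2 * q ^ Suc 0) * ((2 * (n - 2) * s / (1 + s) - (n - 2) - 2 * real (Suc 0)) / q)
     = 2 * log_slope m x * ricci_tangential m x - (n - 2) * ricci_radial m x * static_potential m x" .
  show ?thesis
    using has_derivative_ratio_power[OF assms, of "2 * (n - 2)" 0]
    unfolding n_def[symmetric] s_def[symmetric] q_def[symmetric] k
    by (simp only: ricci_tangential_def[abs_def] n_def[symmetric] power_Suc power_0 mult_1_right)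
qed

lemma has_derivative_ricci_radial:
  fixes x :: "real ^ 'n::finite"
  assumes "m > 0" "CARD('n) \<ge> 3" "x \<noteq> 0"
  shows "\<exists>k. (ricci_radial m has_derivative (\<lambda>v. k * (x \<bullet> v))) (at x)"
  using has_derivative_ratio_power[OF assms, of "2 * real CARD('n)" 1]
  unfolding ricci_radial_def[abs_def] Suc_1 One_nat_def[symmetric] by blast

lemma Lstar_static_potential:
  fixes x :: "real ^ 'n::finite"
  assumes "m > 0" "CARD('n) \<ge> 3" "x \<noteq> 0"
  shows "Lstar (schwarzschild_metric m) (static_potential m) x = 0"
proof -
  let ?u = "static_potential m :: real ^ 'n \<Rightarrow> real"
  have D: "dderiv v ?u y = ricci_tangential m y * (y \<bullet> v)" if "y \<noteq> 0" for y v
    by (rule dderiv_eqI[OF has_derivative_static_potential[OF assms(1,2) that]])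
  have D2: "dderiv v (dderiv w ?u) x = (2 * log_slope m x * ricci_tangential m x
     - (real CARD('n) - 2) * ricci_radial m x * static_potential m x) * (x \<bullet> v) * (x \<bullet> w) + ricci_tangential m x * (v \<bullet> w)" for v w
  proof -
    have "dderiv v (dderiv w ?u) x = dderiv v (\<lambda>y. ricci_tangential m y * (y \<bullet> w)) x"
      by (rule fun_cong[OF frechet_derivative_cong_open[of "- {0}"]]) (use assms(3) in \<open>auto intro: D\<close>)
    also have "\<dots> = ricci_tangential m x * (v \<bullet> w) + (2 * log_slope m x * ricci_tangential m x
     - (real CARD('n) - 2) * ricci_radial m x * static_potential m x) * (x \<bullet> v) * (x \<bullet> w)"
      by (rule dderiv_eqI[OF has_derivative_mult[OF has_derivative_ricci_tangential[OF assms]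
             has_derivative_inner_left[OF has_derivative_ident]]])
    finally show ?thesis by simp
  qed
  have gen: "(2 * l * R - k * B * u) * a * b + R * c - l * (a * (R * b) + b * (R * a) - c * (R * q))
      = u * (R * c - k * B * a * b)" if "1 + l * q = u" for l R k B u a b c q :: real
    unfolding that[symmetric] by (simp add: algebra_simps)
  show ?thesis
    unfolding static_equation[OF assms(1,2) open_delete[OF open_UNIV, of 0, folded Compl_eq_Diff_UNIV] smooth_on_static_potential[OF assms(1)] _ assms(3), simplified, OF assms(3)]
      D[OF assms(3)] D2
    using gen[OF one_plus_log_slope[OF assms(1,3)]] by blast
qed

lemma unit_orthogonal_to_two:
  fixes x c :: "'a::euclidean_space"
  assumes "DIM('a) \<ge> 3"
  obtains e where "norm e = 1" "e \<bullet> x = 0" "e \<bullet> c = 0"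
proof -
  have "dim {x, c} \<le> card {x, c}"
    by (rule dim_le_card') simp
  also have "\<dots> \<le> 2" by (simp add: card_insert_if)
  finally have "dim {x, c} < DIM('a)" using assms by simp
  then obtain y where y: "y \<noteq> 0" "\<And>z. z \<in> span {x, c} \<Longrightarrow> orthogonal y z"
    using orthogonal_to_subspace_exists by metis
  show thesis
    by (rule that[of "y /\<^sub>R norm y"]) (use y(1) y(2)[of x] y(2)[of c] span_base[of _ "{x, c}"] in \<open>auto simp: orthogonal_def\<close>)
qed

text \<open>Symmetry of third derivatives: if the Hessian of \<open>v\<close> is a combination of \<open>x \<otimes> x\<close> and the
  identity, then the coefficient of \<open>x \<otimes> x\<close> has no derivative orthogonal to \<open>x\<close>. With
  \<open>c \<bottom> x\<close>, comparing the third derivatives in the directions \<open>c, e, e\<close>, \<open>e \<bottom> x, c\<close>, shows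
  \<open>D\<mu>(c) = 0\<close>; then the directions \<open>c, x, x\<close> show \<open>Df(c) = 0\<close>.\<close>

lemma radial_hessian_coefficient:
  fixes v f :: "'a::euclidean_space \<Rightarrow> real"
  assumes "DIM('a) \<ge> 3" and S: "open S" "smooth_on S v" "x \<in> S" and "x \<noteq> 0"
    and f: "(f has_derivative f') (at x)"
    and hess: "\<And>y. y \<in> S \<Longrightarrow> \<exists>\<mu>. \<forall>a b. dderiv a (dderiv b v) y = f y * (y \<bullet> a) * (y \<bullet> b) + \<mu> * (a \<bullet> b)"
    and c: "x \<bullet> c = 0"
  shows "f' c = 0"
proof -
  obtain e\<^sub>0 :: 'a where e0: "e\<^sub>0 \<bullet> e\<^sub>0 = 1"
    using unit_orthogonal_to_two[OF assms(1)] by (metis norm_eq_1)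
  define \<mu> where "\<mu> y = dderiv e\<^sub>0 (dderiv e\<^sub>0 v) y - f y * (y \<bullet> e\<^sub>0) * (y \<bullet> e\<^sub>0)" for y
  have hess': "dderiv a (dderiv b v) y = f y * (y \<bullet> a) * (y \<bullet> b) + \<mu> y * (a \<bullet> b)" if y: "y \<in> S" for y a b
    using hess[OF y] by (auto simp: \<mu>_def e0)
  have "\<exists>\<mu>'. (\<mu> has_derivative \<mu>') (at x)"
    unfolding \<mu>_def[abs_def]
    by (rule exI) (rule derivative_intros f smooth_on_has_derivative[OF smooth_on_dderiv[OF smooth_on_dderiv[OF S(2)]] S(3)])+
  then obtain \<mu>' where \<mu>': "(\<mu> has_derivative \<mu>') (at x)" ..
  define Z where "Z w a b = f' w * (x \<bullet> a) * (x \<bullet> b) + f x * ((w \<bullet> a) * (x \<bullet> b) + (x \<bullet> a) * (w \<bullet> b)) + \<mu>' w * (a \<bullet> b)" for w a b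
  have Z: "dderiv w (dderiv a (dderiv b v)) x = Z w a b" for w a b
  proof -
    have "((\<lambda>y. f y * (y \<bullet> a) * (y \<bullet> b) + \<mu> y * (a \<bullet> b)) has_derivative
       (\<lambda>w. (f x * (x \<bullet> a) * (w \<bullet> b) + (f x * (w \<bullet> a) + f' w * (x \<bullet> a)) * (x \<bullet> b)) + \<mu>' w * (a \<bullet> b))) (at x)"
      by (intro has_derivative_add has_derivative_mult has_derivative_mult_left f \<mu>'
          has_derivative_inner_left has_derivative_ident)
    from dderiv_eqI[OF this, of w]
    have "dderiv w (\<lambda>y. f y * (y \<bullet> a) * (y \<bullet> b) + \<mu> y * (a \<bullet> b)) x = Z w a b"
      by (simp add: Z_def algebra_simps)
    moreover have "dderiv w (dderiv a (dderiv b v)) x = dderiv w (\<lambda>y. f y * (y \<bullet> a) * (y \<bullet> b) + \<mu> y * (a \<bullet> b)) x"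
      by (rule fun_cong[OF frechet_derivative_cong_open[OF S(1,3)]]) (rule hess')
    ultimately show ?thesis by simp
  qed
  have sym: "Z w a b = Z a w b" for w a b
    using dderiv_commute_real[OF S(1) smooth_on_dderiv[OF S(2)] S(3), where a = w and b = a] by (simp add: Z)
  obtain e where e: "norm e = 1" "e \<bullet> x = 0" "e \<bullet> c = 0"
    using unit_orthogonal_to_two[OF assms(1)] .
  then have ee: "e \<bullet> e = 1" by (simp add: norm_eq_1)
  have "\<mu>' c = 0"
    using sym[of c e e] e c by (simp add: Z_def ee inner_commute)
  then have "f' c * (x \<bullet> x) * (x \<bullet> x) = 0"
    using sym[of c x x] c by (simp add: Z_def inner_commute)
  then show ?thesis using \<open>x \<noteq> 0\<close> by simp
qed

text \<open>The substitution \<open>u = exp w * v\<close> removes the first-order terms from the Hessian of the metric, up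
  to a multiple of the identity, so the preceding lemma applies to \<open>v\<close>.\<close>

lemma static_solution_radial_derivative:
  fixes u :: "real ^ 'n::finite \<Rightarrow> real"
  assumes "m > 0" "CARD('n) \<ge> 3" and S: "open S" "smooth_on S u" "x \<in> S" and S0: "S \<subseteq> - {0}"
    and L: "\<And>y. y \<in> S \<Longrightarrow> Lstar (schwarzschild_metric m) u y = 0"
    and c: "x \<bullet> c = 0"
  shows "dderiv c u x = 0"
proof -
  define a where "a = - 2 / (real CARD('n) - 2)"
  have gen: "- (- 2 / k * k) = 2" if "k \<noteq> 0" for k :: real
    using that by simp
  have "real CARD('n) - 2 \<noteq> 0" using assms(2) by simp
  then have a: "- (a * (real CARD('n) - 2)) = 2"
    unfolding a_def by (rule gen)
  define \<psi> where "\<psi> y = (1 + mass_ratio m y) powr a" for y :: "real ^ 'n"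
  define v where "v y = \<psi> y * u y" for y
  let ?l = "log_slope m" and ?R = "ricci_tangential m" and ?B = "ricci_radial m"
  have \<psi>pos: "\<psi> y > 0" for y
    using mass_ratio_nonneg[OF assms(1), of y] by (simp add: \<psi>_def)
  have s\<psi>: "smooth_on S \<psi>"
  proof -
    have "smooth_on (- {0}) (\<lambda>y. (1 + mass_ratio m y) powr a :: real)"
      by (intro smooth_intros smooth_on_mass_ratio open_Compl closed_singleton one_plus_mass_ratio_pos assms)
    then show ?thesis
      unfolding \<psi>_def[abs_def] using smooth_on_subset_set S0 by blast
  qed
  have sv: "smooth_on S v"
    unfolding v_def[abs_def] by (intro smooth_intros S s\<psi>)
  have d\<psi>: "(\<psi> has_derivative (\<lambda>w. - ?l y * \<psi> y * (y \<bullet> w))) (at y)" if y: "y \<in> S" for y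
  proof -
    have y0: "y \<noteq> 0" using y S0 by auto
    have s: "1 + mass_ratio m y > 0" using mass_ratio_pos[OF assms(1) y0] by simp
    have d: "((\<lambda>x. 1 + mass_ratio m x) has_derivative
       (\<lambda>w. - (real CARD('n) - 2) * mass_ratio m y / (y \<bullet> y) * (y \<bullet> w))) (at y)"
      using has_derivative_add[OF has_derivative_const has_derivative_mass_ratio[OF assms(1,2) y0]] by simp
    have gen: "p * (0 * z + - k * s / r * b * a / t) = (- (a * k)) * s / (t * r) * p * b" for p z k s r b t :: real
      by (simp add: mult_ac)
    have eq: "(1 + mass_ratio m y) powr a * (0 * ln (1 + mass_ratio m y) + - (real CARD('n) - 2) * mass_ratio m y / (y \<bullet> y) * (y \<bullet> w) * a / (1 + mass_ratio m y))
       = - ?l y * \<psi> y * (y \<bullet> w)" for w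
      unfolding gen a by (simp add: \<psi>_def log_slope_def)
    show ?thesis
      unfolding \<psi>_def[abs_def]
      by (rule has_derivative_eq_rhs[OF has_derivative_powr[OF d has_derivative_const s UNIV_I]])
         (simp only: eq \<psi>_def)
  qed
  have du: "(u has_derivative (\<lambda>w. dderiv w u y)) (at y)" if "y \<in> S" for y
    by (rule smooth_on_has_derivative[OF S(2) that])
  have Dv: "dderiv b v y = \<psi> y * (dderiv b u y - ?l y * (y \<bullet> b) * u y)" if "y \<in> S" for b y
    unfolding v_def[abs_def]
    by (subst dderiv_eqI[OF has_derivative_mult[OF d\<psi>[OF that] du[OF that]]]) (simp add: algebra_simps)
  define f where "f y = - (real CARD('n) - 1) * ?B y * v y" for y
  have hess: "dderiv a (dderiv b v) y = f y * (y \<bullet> a) * (y \<bullet> b) +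
      (\<psi> y * (u y * ?R y - ?l y * dderiv y u y - ?l y * u y)) * (a \<bullet> b)" if y: "y \<in> S" for y a b
  proof -
    have y0: "y \<noteq> 0" using y S0 by auto
    have "((\<lambda>y. \<psi> y * (dderiv b u y - ?l y * (y \<bullet> b) * u y)) has_derivative
      (\<lambda>a. \<psi> y * (dderiv a (dderiv b u) y - (?l y * (y \<bullet> b) * dderiv a u y + (?l y * (a \<bullet> b) + log_slope_slope m y * (y \<bullet> a) * (y \<bullet> b)) * u y))
         + - ?l y * \<psi> y * (y \<bullet> a) * (dderiv b u y - ?l y * (y \<bullet> b) * u y))) (at y)"
      by (intro has_derivative_mult has_derivative_diff d\<psi> du y has_derivative_log_slope assms y0
          has_derivative_inner_left has_derivative_ident smooth_on_has_derivative[OF smooth_on_dderiv[OF S(2)]])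
    note D = dderiv_eqI[OF this, of a]
    have "dderiv a (dderiv b v) y = dderiv a (\<lambda>y. \<psi> y * (dderiv b u y - ?l y * (y \<bullet> b) * u y)) y"
      by (rule fun_cong[OF frechet_derivative_cong_open[OF S(1) y]]) (rule Dv)
    also note D
    finally have 1: "dderiv a (dderiv b v) y =
      \<psi> y * (dderiv a (dderiv b u) y - (?l y * (y \<bullet> b) * dderiv a u y + (?l y * (a \<bullet> b) + log_slope_slope m y * (y \<bullet> a) * (y \<bullet> b)) * u y))
         + - ?l y * \<psi> y * (y \<bullet> a) * (dderiv b u y - ?l y * (y \<bullet> b) * u y)" .
    have 2: "dderiv a (dderiv b u) y = ?l y * ((y \<bullet> a) * dderiv b u y + (y \<bullet> b) * dderiv a u y - (a \<bullet> b) * dderiv y u y)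
       + u y * (?R y * (a \<bullet> b) - (real CARD('n) - 2) * ?B y * (y \<bullet> a) * (y \<bullet> b))"
      using static_equation[OF assms(1,2) S(1,2) y y0] L[OF y] by (simp add: diff_eq_eq)
    show ?thesis
      unfolding 1 2 log_slope_slope_eq[OF assms(1) y0] f_def v_def by (simp add: algebra_simps power2_eq_square)
  qed
  have x0: "x \<noteq> 0" using S S0 by auto
  obtain k where k: "(?B has_derivative (\<lambda>v. k * (x \<bullet> v))) (at x)"
    using has_derivative_ricci_radial[OF assms(1,2) x0] by blast
  have "(f has_derivative (\<lambda>w. - (real CARD('n) - 1) * ?B x * dderiv w v x + - (real CARD('n) - 1) * (k * (x \<bullet> w)) * v x)) (at x)"
    unfolding f_def[abs_def]
    by (intro has_derivative_mult has_derivative_mult_right k smooth_on_has_derivative[OF sv S(3)])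
  from radial_hessian_coefficient[OF _ S(1) sv S(3) x0 this _ c] hess
  have "- (real CARD('n) - 1) * ?B x * dderiv c v x = 0"
    using assms(2) c by fastforce
  then have "dderiv c v x = 0"
    using ricci_radial_pos[OF assms(1) x0] assms(2) by auto
  then show ?thesis
    using Dv[OF S(3), of c] c \<psi>pos[of x] by simp
qed

text \<open>A solution \<open>u\<close> has no derivative orthogonal to \<open>x\<close>, so its gradient is \<open>h x\<close>. The equation in one
  direction orthogonal to \<open>x\<close> is then of first order: \<open>h u\<^sub>0 = u R\<close>, with \<open>u\<^sub>0\<close> the static potential and \<open>R x\<close>
  its gradient. Hence \<open>C = h / R\<close>, which unlike \<open>u / u\<^sub>0\<close> is smooth across the zeros of \<open>u\<^sub>0\<close>, satisfies both
  \<open>u = C u\<^sub>0\<close> and \<open>Du = C Du\<^sub>0\<close>, so that \<open>u\<^sub>0 DC = 0\<close>.\<close>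

theorem static_potential_unique:
  fixes u :: "real ^ 'n::finite \<Rightarrow> real"
  assumes "m > 0" "CARD('n) \<ge> 3" and S: "open S" "connected S" "smooth_on S u" and S0: "S \<subseteq> - {0}"
    and L: "\<And>y. y \<in> S \<Longrightarrow> Lstar (schwarzschild_metric m) u y = 0"
  obtains c where "\<And>x. x \<in> S \<Longrightarrow> u x = c * static_potential m x"
proof -
  let ?l = "log_slope m" and ?R = "ricci_tangential m :: real ^ 'n \<Rightarrow> real" and ?u = "static_potential m :: real ^ 'n \<Rightarrow> real"
  have nz: "x \<noteq> 0" "x \<bullet> x > 0" if "x \<in> S" for x using that S0 by auto
  note R0 = ricci_tangential_pos[OF assms(1,2) nz(1)]
  define h where "h x = dderiv x u x / (x \<bullet> x)" for x
  have sh: "smooth_on S h"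
    unfolding h_def[abs_def] by (intro smooth_on_divide_pos smooth_on_dderiv_field smooth_intros S nz)
  have Du: "dderiv b u x = h x * (x \<bullet> b)" if x: "x \<in> S" for x b
  proof -
    note fd = smooth_on_differentiable[OF S(3) x]
    define d where "d = b - ((x \<bullet> b) / (x \<bullet> x)) *\<^sub>R x"
    have "x \<bullet> d = 0" using nz[OF x] by (simp add: d_def inner_diff_right)
    then have "dderiv d u x = 0"
      using static_solution_radial_derivative[OF assms(1,2) S(1,3) x S0] L by blast
    moreover have "b = d + ((x \<bullet> b) / (x \<bullet> x)) *\<^sub>R x" by (simp add: d_def)
    ultimately have "dderiv b u x = ((x \<bullet> b) / (x \<bullet> x)) * dderiv x u x"
      by (metis add_0 dderiv_add[OF fd] dderiv_cmul[OF fd] real_scaleR_def)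
    then show ?thesis by (simp add: h_def)
  qed
  have hu: "h x * ?u x = u x * ?R x" if x: "x \<in> S" for x
  proof -
    obtain e :: "real ^ 'n" where e: "norm e = 1" "e \<bullet> x = 0"
      using unit_orthogonal_to_two[of x x] assms(2) by auto
    have "dderiv e (dderiv e u) x = dderiv e (\<lambda>y. h y * (y \<bullet> e)) x"
      by (rule fun_cong[OF frechet_derivative_cong_open[OF S(1) x]]) (rule Du)
    also have "\<dots> = h x * (e \<bullet> e) + dderiv e h x * (x \<bullet> e)"
      by (rule dderiv_eqI[OF has_derivative_mult[OF smooth_on_has_derivative[OF sh x] has_derivative_inner_left[OF has_derivative_ident]]])
    finally have 1: "dderiv e (dderiv e u) x = h x"
      using e by (simp add: norm_eq_1 inner_commute)
    have "dderiv e (dderiv e u) x - ?l x * ((x \<bullet> e) * dderiv e u x + (x \<bullet> e) * dderiv e u x - (e \<bullet> e) * dderiv x u x)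
       = u x * (?R x * (e \<bullet> e) - (real CARD('n) - 2) * ricci_radial m x * (x \<bullet> e) * (x \<bullet> e))"
      using static_equation[OF assms(1,2) S(1,3) x nz(1)[OF x]] L[OF x] by blast
    then have "h x * (1 + ?l x * (x \<bullet> x)) = u x * ?R x"
      using e 1 by (simp add: norm_eq_1 inner_commute Du[OF x] algebra_simps)
    then show ?thesis
      unfolding one_plus_log_slope[OF assms(1) nz(1)[OF x]] .
  qed
  define C where "C x = h x / ?R x" for x
  have uC: "u x = C x * ?u x" and hC: "h x = C x * ?R x" if "x \<in> S" for x
    using hu[OF that] R0[OF that] by (simp_all add: C_def field_simps)
  have sR: "smooth_on S ?R"
  proof -
    have "1 + mass_ratio m x > 0" for x :: "real ^ 'n"
      using mass_ratio_nonneg[OF assms(1), of x] by simp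
    then have "(1 + mass_ratio m x) * (1 + mass_ratio m x) * (x \<bullet> x) > 0" if "x \<in> - {0}" for x :: "real ^ 'n"
      using that by (intro mult_pos_pos) auto
    then have "smooth_on (- {0}) ?R"
      unfolding ricci_tangential_def[abs_def] power2_eq_square
      by (intro smooth_on_divide_pos smooth_intros smooth_on_mass_ratio open_Compl closed_singleton)
    then show ?thesis using smooth_on_subset_set S0 by blast
  qed
  have sC: "smooth_on S C"
    unfolding C_def[abs_def] by (intro smooth_on_divide_pos S sh sR R0)
  have uDC: "?u x * dderiv v C x = 0" if x: "x \<in> S" for x v
  proof -
    have "dderiv v u x = dderiv v (\<lambda>x. C x * ?u x) x"
      by (rule fun_cong[OF frechet_derivative_cong_open[OF S(1) x]]) (rule uC)
    also have "\<dots> = C x * (?R x * (x \<bullet> v)) + dderiv v C x * ?u x"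
      by (rule dderiv_eqI[OF has_derivative_mult[OF smooth_on_has_derivative[OF sC x] has_derivative_static_potential[OF assms(1,2) nz(1)[OF x]]]])
    finally show ?thesis
      using Du[OF x, of v] hC[OF x] by auto
  qed
  have DC: "dderiv v C x = 0" if x: "x \<in> S" for x v
  proof (cases "?u x = 0")
    case True
    \<comment> \<open>On the zero set of the potential, \<open>DC = 0\<close> follows by continuity along a ray leaving it.\<close>
    define y where "y k = (1 + 1 / real (Suc k)) *\<^sub>R x" for k
    have "y \<longlonglongrightarrow> (1 + 0) *\<^sub>R x"
      unfolding y_def by (intro tendsto_intros LIMSEQ_Suc[OF lim_1_over_n])
    then have y: "y \<longlonglongrightarrow> x" by simp
    have s: "mass_ratio m x = 1"
      using True mass_ratio_nonneg[OF assms(1), of x] by (simp add: static_potential_def)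
    have "?u (y k) \<noteq> 0" for k
    proof -
      have p: "norm x > 0" using nz(1)[OF x] by simp
      have "norm (y k) = (1 + 1 / real (Suc k)) * norm x"
        by (simp add: y_def)
      moreover have "1 + 1 / real (Suc k) > 1" by simp
      ultimately have "norm x < norm (y k)"
        using p by simp
      then have "norm x ^ (CARD('n) - 2) < norm (y k) ^ (CARD('n) - 2)"
        using assms(2) by (intro power_strict_mono) auto
      then have "mass_ratio m (y k) < mass_ratio m x"
        using p assms(1) \<open>norm x < norm (y k)\<close> unfolding mass_ratio_def
        by (intro divide_strict_left_mono mult_pos_pos zero_less_power) auto
      then show ?thesis
        using s mass_ratio_nonneg[OF assms(1), of "y k"] by (simp add: static_potential_def)
    qed
    then have "dderiv v C (y k) = 0" if "y k \<in> S" for k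
      using uDC[OF that, of v] by auto
    moreover have "\<forall>\<^sub>F k in sequentially. y k \<in> S"
      by (rule topological_tendstoD[OF y S(1) x])
    ultimately have "(\<lambda>k. dderiv v C (y k)) \<longlonglongrightarrow> 0"
      by (intro tendsto_eventually) (auto elim: eventually_mono)
    moreover have "isCont (dderiv v C) x"
      using smooth_on_continuous_on[OF smooth_on_dderiv[OF sC]] continuous_on_eq_continuous_at[OF S(1)] x by blast
    then have "(\<lambda>k. dderiv v C (y k)) \<longlonglongrightarrow> dderiv v C x"
      using isCont_tendsto_compose y by blast
    ultimately show ?thesis
      using LIMSEQ_unique by blast
  qed (use uDC[OF x, of v] in simp)
  have "(C has_derivative (\<lambda>v. 0)) (at x)" if "x \<in> S" for x
    using smooth_on_has_derivative[OF sC that] by (simp add: DC[OF that])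
  then have const: "C x = C y" if "x \<in> S" "y \<in> S" for x y
    using has_derivative_zero_unique_connected[OF S(1,2)] that by blast
  show thesis
  proof (cases "S = {}")
    case True
    then show thesis using that by blast
  next
    case False
    then obtain z where z: "z \<in> S" by blast
    show thesis
    proof
      fix x assume x: "x \<in> S"
      show "u x = C z * static_potential m x"
        using uC[OF x] const[OF x z] by simp
    qed
  qed
qed

section \<open>Unit normals of smooth domains\<close>

definition gradient :: "('a::euclidean_space \<Rightarrow> real) \<Rightarrow> 'a \<Rightarrow> 'a" where
  "gradient \<rho> x = (\<Sum>b\<in>Basis. dderiv b \<rho> x *\<^sub>R b)"

definition unit_normal :: "('a::euclidean_space \<Rightarrow> real) \<Rightarrow> 'a \<Rightarrow> 'a" where
  "unit_normal \<rho> x = (gradient \<rho> x \<bullet> gradient \<rho> x) powr (- 1 / 2) *\<^sub>R gradient \<rho> x"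

text \<open>\<open>defining_function\<close> with its neighbourhood made explicit, so that one chart can serve all the
  boundary points in it.\<close>

definition boundary_chart :: "'a::euclidean_space set \<Rightarrow> 'a set \<Rightarrow> ('a \<Rightarrow> real) \<Rightarrow> bool" where
  "boundary_chart \<Omega> U \<rho> \<longleftrightarrow> open U \<and> 0 \<notin> U \<and> smooth_on U \<rho> \<and>
     (\<forall>x\<in>U. frechet_derivative \<rho> (at x) \<noteq> (\<lambda>v. 0)) \<and> U \<inter> \<Omega> = {x\<in>U. \<rho> x < 0}"

lemma defining_function_iff_chart:
  "defining_function schwarzschild_space \<Omega> p \<rho> \<longleftrightarrow> (\<exists>U. boundary_chart \<Omega> U \<rho> \<and> p \<in> U \<and> \<rho> p = 0)"
  unfolding defining_function_def boundary_chart_def schwarzschild_space_def by blast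

lemma gradient_inner: "\<rho> differentiable (at x) \<Longrightarrow> gradient \<rho> x \<bullet> v = dderiv v \<rho> x"
proof -
  assume fd: "\<rho> differentiable (at x)"
  have "dderiv v \<rho> x = dderiv (\<Sum>b\<in>Basis. (v \<bullet> b) *\<^sub>R b) \<rho> x"
    by (simp add: euclidean_representation)
  also have "\<dots> = (\<Sum>b\<in>Basis. (v \<bullet> b) * dderiv b \<rho> x)"
    by (simp add: dderiv_sum[OF fd] dderiv_cmul[OF fd])
  also have "\<dots> = gradient \<rho> x \<bullet> v"
    unfolding gradient_def inner_sum_left by (rule sum.cong) (simp_all add: inner_commute)
  finally show ?thesis ..
qed

context
  fixes \<Omega> U :: "'a::euclidean_space set" and \<rho> :: "'a \<Rightarrow> real"
  assumes chart: "boundary_chart \<Omega> U \<rho>"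
begin

lemma chart_open: "open U" and chart_0: "0 \<notin> U" and chart_smooth: "smooth_on U \<rho>"
  and chart_iff: "x \<in> U \<Longrightarrow> x \<in> \<Omega> \<longleftrightarrow> \<rho> x < 0"
  using chart by (auto simp: boundary_chart_def)

lemma chart_gradient_inner: "x \<in> U \<Longrightarrow> gradient \<rho> x \<bullet> v = dderiv v \<rho> x"
  by (rule gradient_inner[OF smooth_on_differentiable[OF chart_smooth]])

lemma chart_gradient_nonzero:
  assumes "x \<in> U" shows "gradient \<rho> x \<noteq> 0"
proof
  assume "gradient \<rho> x = 0"
  then have "frechet_derivative \<rho> (at x) = (\<lambda>v. 0)"
    using chart_gradient_inner[OF assms] by (auto simp: fun_eq_iff)
  then show False
    using chart assms by (auto simp: boundary_chart_def)
qed

lemma unit_normal_eq: "x \<in> U \<Longrightarrow> unit_normal \<rho> x = gradient \<rho> x /\<^sub>R norm (gradient \<rho> x)"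
proof -
  have "(v \<bullet> v) powr (- 1 / 2) = inverse (norm v)" for v :: 'a
    by (simp add: powr_minus powr_half_sqrt norm_eq_sqrt_inner minus_divide_left[symmetric])
  then show ?thesis by (simp add: unit_normal_def)
qed

lemma unit_normal_norm: "x \<in> U \<Longrightarrow> unit_normal \<rho> x \<bullet> unit_normal \<rho> x = 1"
  using chart_gradient_nonzero[of x] by (simp add: unit_normal_eq flip: power2_norm_eq_inner)

lemma unit_normal_inner:
  "x \<in> U \<Longrightarrow> unit_normal \<rho> x \<bullet> v = dderiv v \<rho> x / norm (gradient \<rho> x)"
  by (simp add: unit_normal_eq chart_gradient_inner divide_inverse mult.commute)

lemma unit_normal_orthogonal_iff: "x \<in> U \<Longrightarrow> unit_normal \<rho> x \<bullet> v = 0 \<longleftrightarrow> dderiv v \<rho> x = 0"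
  using chart_gradient_nonzero[of x] by (simp add: unit_normal_inner)

lemma unit_normal_dderiv_pos: "x \<in> U \<Longrightarrow> dderiv (unit_normal \<rho> x) \<rho> x > 0"
  using unit_normal_inner[of x "unit_normal \<rho> x"] unit_normal_norm[of x] chart_gradient_nonzero[of x]
  by (metis less_numeral_extra(1) zero_less_divide_iff zero_less_norm_iff order_less_asym)

lemma smooth_on_unit_normal: "smooth_on U (unit_normal \<rho>)"
proof -
  have "smooth_on U (gradient \<rho>)"
    unfolding gradient_def[abs_def]
    by (intro smooth_intros chart_open smooth_on_dderiv chart_smooth finite_Basis)
  then show ?thesis
    unfolding unit_normal_def[abs_def]
    by (intro smooth_intros chart_open) (simp_all add: chart_gradient_nonzero)
qed

text \<open>The first-order behaviour of \<open>\<rho>\<close> along a line decides on which side of the boundary it lies.\<close>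

lemma chart_line_derivative:
  assumes "p \<in> U"
  shows "((\<lambda>t. \<rho> (p + t *\<^sub>R v)) has_real_derivative dderiv v \<rho> p) (at 0)"
proof -
  note fd = smooth_on_differentiable[OF chart_smooth assms]
  have "((\<lambda>t. p + t *\<^sub>R v) has_derivative (\<lambda>t. t *\<^sub>R v)) (at 0)"
    by (auto intro!: derivative_eq_intros)
  moreover have "(\<rho> has_derivative (\<lambda>v. dderiv v \<rho> p)) (at (p + 0 *\<^sub>R v))"
    using smooth_on_has_derivative[OF chart_smooth assms] by simp
  ultimately have "((\<lambda>t. \<rho> (p + t *\<^sub>R v)) has_derivative (\<lambda>t. dderiv (t *\<^sub>R v) \<rho> p)) (at 0)"
    by (rule has_derivative_compose)
  then show ?thesis
    by (rule has_derivative_imp_has_field_derivative) (simp add: dderiv_cmul[OF fd])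
qed

lemma chart_line_in_U:
  assumes "p \<in> U"
  obtains d where "d > 0" "\<And>t::real. \<bar>t\<bar> < d \<Longrightarrow> p + t *\<^sub>R v \<in> U"
proof -
  have "open ((\<lambda>t::real. p + t *\<^sub>R v) -` U)"
    by (intro open_vimage chart_open continuous_intros)
  moreover have "0 \<in> (\<lambda>t::real. p + t *\<^sub>R v) -` U" using assms by simp
  ultimately obtain d where "d > 0" "ball 0 d \<subseteq> (\<lambda>t::real. p + t *\<^sub>R v) -` U"
    by (meson open_contains_ball)
  then show thesis using that[of d] by (auto simp: subset_iff)
qed

lemma chart_line_outside:
  assumes "p \<in> U" "\<rho> p = 0" "dderiv v \<rho> p > 0"
  obtains d where "d > 0" "\<And>t. 0 < t \<Longrightarrow> t < d \<Longrightarrow> p + t *\<^sub>R v \<in> U \<and> \<rho> (p + t *\<^sub>R v) > 0"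
proof -
  obtain d where d: "d > 0" "\<And>h. 0 < h \<Longrightarrow> h < d \<Longrightarrow> \<rho> (p + 0 *\<^sub>R v) < \<rho> (p + (0 + h) *\<^sub>R v)"
    using DERIV_pos_inc_right[OF chart_line_derivative[OF assms(1)] assms(3)] by blast
  obtain d' where d': "d' > 0" "\<And>t::real. \<bar>t\<bar> < d' \<Longrightarrow> p + t *\<^sub>R v \<in> U"
    by (rule chart_line_in_U[OF assms(1)], rule that)
  show thesis
    by (rule that[of "min d d'"]) (use d d' assms(2) in auto)
qed

lemma chart_line_inside:
  assumes "p \<in> U" "\<rho> p = 0" "dderiv v \<rho> p > 0"
  obtains d where "d > 0" "\<And>t. 0 < t \<Longrightarrow> t < d \<Longrightarrow> p - t *\<^sub>R v \<in> \<Omega>"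
proof -
  obtain d where d: "d > 0" "\<And>h. 0 < h \<Longrightarrow> h < d \<Longrightarrow> \<rho> (p + (0 - h) *\<^sub>R v) < \<rho> (p + 0 *\<^sub>R v)"
    using DERIV_pos_inc_left[OF chart_line_derivative[OF assms(1)] assms(3)] by blast
  obtain d' where d': "d' > 0" "\<And>t::real. \<bar>t\<bar> < d' \<Longrightarrow> p + t *\<^sub>R v \<in> U"
    by (rule chart_line_in_U[OF assms(1)], rule that)
  have "p - t *\<^sub>R v \<in> \<Omega>" if "0 < t" "t < min d d'" for t
    using chart_iff[of "p - t *\<^sub>R v"] d(2)[of t] d'(2)[of "- t"] that assms(2) by simp
  then show thesis
    using that[of "min d d'"] d(1) d'(1) by simp
qed

lemma chart_frontier_iff:
  assumes "open \<Omega>" "x \<in> U"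
  shows "x \<in> frontier \<Omega> \<longleftrightarrow> \<rho> x = 0"
proof
  assume "x \<in> frontier \<Omega>"
  then have "x \<notin> \<Omega>" "x \<in> closure \<Omega>"
    using assms(1) by (auto simp: frontier_def interior_open)
  then have "\<rho> x \<ge> 0" using chart_iff[OF assms(2)] by simp
  moreover have "\<not> \<rho> x > 0"
  proof
    assume pos: "\<rho> x > 0"
    have "open (U \<inter> \<rho> -` {0<..})"
      by (rule continuous_open_preimage[OF smooth_on_continuous_on[OF chart_smooth] chart_open open_greaterThan])
    moreover have "x \<in> U \<inter> \<rho> -` {0<..}" using pos assms(2) by simp
    ultimately have "(U \<inter> \<rho> -` {0<..}) \<inter> \<Omega> \<noteq> {}"
      using \<open>x \<in> closure \<Omega>\<close> open_Int_closure_eq_empty by blast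
    then show False using chart_iff by auto
  qed
  ultimately show "\<rho> x = 0" by simp
next
  assume 0: "\<rho> x = 0"
  obtain d where d: "d > 0" "\<And>t. 0 < t \<Longrightarrow> t < d \<Longrightarrow> x - t *\<^sub>R unit_normal \<rho> x \<in> \<Omega>"
    by (rule chart_line_inside[OF assms(2) 0 unit_normal_dderiv_pos[OF assms(2)]], rule that)
  have "x \<in> closure \<Omega>"
  proof (rule closure_approachable[THEN iffD2], intro allI impI)
    fix e :: real assume "e > 0"
    define t where "t = min d e / 2"
    have t: "0 < t" "t < d" "t < e" using d(1) \<open>e > 0\<close> by (auto simp: t_def)
    moreover have "dist (x - t *\<^sub>R unit_normal \<rho> x) x = t"
      using unit_normal_norm[OF assms(2)] t(1) by (simp add: dist_norm norm_eq_1[symmetric])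
    ultimately show "\<exists>y\<in>\<Omega>. dist y x < e" using d(2) by metis
  qed
  moreover have "x \<notin> \<Omega>" using chart_iff[OF assms(2)] 0 by simp
  ultimately show "x \<in> frontier \<Omega>"
    using assms(1) by (simp add: frontier_def interior_open)
qed

end

text \<open>Two defining functions have the same unit normal: a direction that leaves the domain to first
  order with respect to one of them cannot enter it with respect to the other, so the two gradients
  define the same half-space.\<close>

lemma unit_normal_unique:
  assumes c: "boundary_chart \<Omega> U \<rho>" and c': "boundary_chart \<Omega> U' \<rho>'"
    and p: "p \<in> U" "\<rho> p = 0" "p \<in> U'" "\<rho>' p = 0"
  shows "unit_normal \<rho>' p = unit_normal \<rho> p"
proof -
  let ?n = "gradient \<rho> p" and ?n' = "gradient \<rho>' p"
  have half: "?n' \<bullet> v \<ge> 0" if "?n \<bullet> v > 0" for v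
  proof (rule ccontr)
    assume "\<not> ?n' \<bullet> v \<ge> 0"
    then have neg: "dderiv (- v) \<rho>' p > 0" by (simp flip: chart_gradient_inner[OF c' p(3)])
    have pos: "dderiv v \<rho> p > 0" using that by (simp add: chart_gradient_inner[OF c p(1)])
    obtain d where d: "d > 0" "\<And>t. 0 < t \<Longrightarrow> t < d \<Longrightarrow> p + t *\<^sub>R v \<in> U \<and> \<rho> (p + t *\<^sub>R v) > 0"
      by (rule chart_line_outside[OF c p(1,2) pos], rule that)
    obtain d' where d': "d' > 0" "\<And>t. 0 < t \<Longrightarrow> t < d' \<Longrightarrow> p - t *\<^sub>R (- v) \<in> \<Omega>"
      by (rule chart_line_inside[OF c' p(3,4) neg], rule that)
    define t where "t = min d d' / 2"
    have t: "0 < t" "t < d" "t < d'" using d(1) d'(1) by (auto simp: t_def)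
    then show False
      using d(2)[of t] d'(2)[of t] chart_iff[OF c, of "p + t *\<^sub>R v"] by simp
  qed
  have nn: "?n \<bullet> ?n > 0" using chart_gradient_nonzero[OF c p(1)] by simp
  define k where "k = (?n' \<bullet> ?n) / (?n \<bullet> ?n)"
  define w where "w = ?n' - k *\<^sub>R ?n"
  have nw: "?n \<bullet> w = 0" using nn by (simp add: w_def k_def inner_diff_right inner_commute)
  then have n'w: "?n' \<bullet> w = w \<bullet> w" by (simp add: w_def inner_diff_left)
  have "w = 0"
  proof (rule ccontr)
    assume "w \<noteq> 0"
    then have ww: "w \<bullet> w > 0" by simp
    \<comment> \<open>Adding a large multiple of \<open>- w\<close>, which is tangent for \<open>\<rho>\<close>, to \<open>?n\<close> would enter the domain for \<open>\<rho>'\<close>.\<close>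
    define s where "s = (?n' \<bullet> ?n + 1) / (w \<bullet> w)"
    have "?n' \<bullet> (?n - s *\<^sub>R w) \<ge> 0"
      by (rule half) (use nn nw in \<open>simp add: inner_diff_right\<close>)
    then have "?n' \<bullet> ?n - s * (w \<bullet> w) \<ge> 0" by (simp add: inner_diff_right n'w)
    then show False using ww by (simp add: s_def)
  qed
  then have eq: "?n' = k *\<^sub>R ?n" by (simp add: w_def)
  have "k \<ge> 0" using half[OF nn] nn by (simp add: k_def)
  moreover have "k \<noteq> 0" using eq chart_gradient_nonzero[OF c' p(3)] by auto
  ultimately have "k > 0" by simp
  then show ?thesis
    unfolding unit_normal_eq[OF c p(1)] unit_normal_eq[OF c' p(3)] eq by simp
qed

lemma boundary_tangent_space_eq:
  assumes c: "boundary_chart \<Omega> U \<rho>" and p: "p \<in> U" "\<rho> p = 0"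
  shows "boundary_tangent_space schwarzschild_space \<Omega> p = {v. unit_normal \<rho> p \<bullet> v = 0}"
  unfolding boundary_tangent_space_def defining_function_iff_chart
  using c p unit_normal_unique[OF c _ p] unit_normal_orthogonal_iff by (metis (no_types, opaque_lifting))

lemma outward_normal_eq:
  fixes \<Omega> :: "(real ^ 'n::finite) set"
  assumes "m > 0" "CARD('n) \<ge> 3" and c: "boundary_chart \<Omega> U \<rho>" and p: "p \<in> U" "\<rho> p = 0"
  shows "outward_normal schwarzschild_space (schwarzschild_metric m) \<Omega> p
    = (1 / sqrt (conformal_factor m p)) *\<^sub>R unit_normal \<rho> p"
proof -
  define C where "C = conformal_factor m p"
  have C: "C > 0" using conformal_factor_ge_1[OF assms(1,2), of p] by (simp add: C_def)
  let ?N = "unit_normal \<rho> p"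
  have N1: "?N \<bullet> ?N = 1" by (rule unit_normal_norm[OF c p(1)])
  show ?thesis
    unfolding outward_normal_def metric_ip_schwarzschild C_def[symmetric] boundary_tangent_space_eq[OF c p]
  proof (rule the_equality)
    have "dderiv ((1 / sqrt C) *\<^sub>R ?N) \<rho> p > 0"
      using unit_normal_dderiv_pos[OF c p(1)] C
      by (simp add: dderiv_cmul[OF smooth_on_differentiable[OF chart_smooth[OF c] p(1)]])
    then show "C * ((1 / sqrt C) *\<^sub>R ?N \<bullet> (1 / sqrt C) *\<^sub>R ?N) = 1 \<and>
       (\<forall>v\<in>{v. ?N \<bullet> v = 0}. C * ((1 / sqrt C) *\<^sub>R ?N \<bullet> v) = 0) \<and>
       (\<exists>\<rho>. defining_function schwarzschild_space \<Omega> p \<rho> \<and> dderiv ((1 / sqrt C) *\<^sub>R ?N) \<rho> p > 0)"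
      using C N1 c p by (auto simp: defining_function_iff_chart)
  next
    fix \<nu> assume \<nu>: "C * (\<nu> \<bullet> \<nu>) = 1 \<and> (\<forall>v\<in>{v. ?N \<bullet> v = 0}. C * (\<nu> \<bullet> v) = 0) \<and>
       (\<exists>\<rho>. defining_function schwarzschild_space \<Omega> p \<rho> \<and> dderiv \<nu> \<rho> p > 0)"
    define k where "k = ?N \<bullet> \<nu>"
    define w where "w = \<nu> - k *\<^sub>R ?N"
    have "?N \<bullet> w = 0" by (simp add: w_def k_def inner_diff_right N1)
    moreover from this have "\<nu> \<bullet> w = 0" using \<nu> C by auto
    ultimately have "w \<bullet> w = 0" by (simp add: w_def inner_diff_left)
    then have \<nu>k: "\<nu> = k *\<^sub>R ?N" by (simp add: w_def)
    obtain \<rho>' U' where c': "boundary_chart \<Omega> U' \<rho>'" "p \<in> U'" "\<rho>' p = 0" "dderiv \<nu> \<rho>' p > 0"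
      using \<nu> by (auto simp: defining_function_iff_chart)
    have "unit_normal \<rho>' p \<bullet> \<nu> > 0"
      using c'(4) chart_gradient_nonzero[OF c'(1,2)] by (simp add: unit_normal_inner[OF c'(1,2)])
    then have "k > 0" using unit_normal_unique[OF c c'(1) p c'(2,3)] by (simp add: k_def)
    moreover have "C * k\<^sup>2 = 1" using \<nu> by (simp add: \<nu>k N1 power2_eq_square)
    ultimately have "k = 1 / sqrt C"
      using C by (metis nonzero_mult_div_cancel_left order_less_irrefl real_sqrt_divide real_sqrt_one real_sqrt_unique order_less_imp_le)
    then show "\<nu> = (1 / sqrt C) *\<^sub>R ?N" using \<nu>k by simp
  qed
qed

lemma closure_line_inside:
  assumes c: "boundary_chart \<Omega> U \<rho>" and p: "p \<in> U" "\<rho> p = 0" and "dderiv v \<rho> p > 0"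
    and "open \<Omega>" "0 \<notin> \<Omega>"
  obtains d where "d > 0" "\<And>t. t \<le> 0 \<Longrightarrow> - d < t \<Longrightarrow> p + t *\<^sub>R v \<in> closure_in schwarzschild_space \<Omega>"
proof -
  obtain d where d: "d > 0" "\<And>t. 0 < t \<Longrightarrow> t < d \<Longrightarrow> p - t *\<^sub>R v \<in> \<Omega>"
    by (rule chart_line_inside[OF c p assms(4)], rule that)
  show thesis
  proof (rule that[OF d(1)])
    fix t :: real assume t: "t \<le> 0" "- d < t"
    have "p \<in> frontier \<Omega>" "p \<noteq> 0"
      using chart_frontier_iff[OF c assms(5) p(1)] p chart_0[OF c] by auto
    then show "p + t *\<^sub>R v \<in> closure_in schwarzschild_space \<Omega>"
      using d(2)[of "- t"] t \<open>0 \<notin> \<Omega>\<close> closure_subset[of \<Omega>]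
      by (cases "t = 0") (auto simp: closure_in_def schwarzschild_space_def frontier_def)
  qed
qed

lemma normal_deriv_eq:
  fixes \<Omega> :: "(real ^ 'n::finite) set"
  assumes m: "m > 0" "CARD('n) \<ge> 3" and c: "boundary_chart \<Omega> U \<rho>" and p: "p \<in> U" "\<rho> p = 0"
    and \<Omega>: "open \<Omega>" "0 \<notin> \<Omega>"
    and f: "(f has_derivative f') (at p)" "\<And>x. x \<in> closure_in schwarzschild_space \<Omega> \<Longrightarrow> u x = f x"
  shows "normal_deriv schwarzschild_space (schwarzschild_metric m) \<Omega> u p
     = (1 / sqrt (conformal_factor m p)) * f' (unit_normal \<rho> p)"
proof -
  define \<nu> where "\<nu> = (1 / sqrt (conformal_factor m p)) *\<^sub>R unit_normal \<rho> p"
  have "conformal_factor m p > 0" using conformal_factor_ge_1[OF m, of p] by simp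
  then have pos: "dderiv \<nu> \<rho> p > 0"
    using unit_normal_dderiv_pos[OF c p(1)]
    by (simp add: \<nu>_def dderiv_cmul[OF smooth_on_differentiable[OF chart_smooth[OF c] p(1)]])
  obtain d where d: "d > 0" "\<And>t. t \<le> 0 \<Longrightarrow> - d < t \<Longrightarrow> p + t *\<^sub>R \<nu> \<in> closure_in schwarzschild_space \<Omega>"
    by (rule closure_line_inside[OF c p pos \<Omega>], rule that)
  have "((\<lambda>t. p + t *\<^sub>R \<nu>) has_derivative (\<lambda>t. t *\<^sub>R \<nu>)) (at 0)"
    by (auto intro!: derivative_eq_intros)
  moreover have "(f has_derivative f') (at (p + 0 *\<^sub>R \<nu>))"
    using f(1) by simp
  ultimately have "((\<lambda>t. f (p + t *\<^sub>R \<nu>)) has_derivative (\<lambda>t. f' (t *\<^sub>R \<nu>))) (at 0)"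
    by (rule has_derivative_compose)
  then have "((\<lambda>t. f (p + t *\<^sub>R \<nu>)) has_vector_derivative f' \<nu>) (at 0)"
    unfolding has_vector_derivative_def
    using linear_cmul[OF has_derivative_linear[OF f(1)]] by simp
  then have "((\<lambda>t. f (p + t *\<^sub>R \<nu>)) has_vector_derivative f' \<nu>) (at 0 within {..0})"
    by (rule has_vector_derivative_at_within)
  then have "((\<lambda>t. u (p + t *\<^sub>R \<nu>)) has_vector_derivative f' \<nu>) (at 0 within {..0})"
    by (rule has_vector_derivative_transform_within[OF _ d(1)]) (use d(2) f(2) in \<open>auto simp: dist_real_def\<close>)
  moreover have "at (0::real) within {..0} \<noteq> bot"
  proof -
    have "{..0::real} - {0} = {..<0}" by auto
    then show ?thesis by (simp add: at_within_eq_bot_iff)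
  qed
  ultimately have "vector_derivative (\<lambda>t. u (p + t *\<^sub>R \<nu>)) (at 0 within {..0}) = f' \<nu>"
    by (rule vector_derivative_within[rotated])
  also have "f' \<nu> = (1 / sqrt (conformal_factor m p)) * f' (unit_normal \<rho> p)"
    using linear_cmul[OF has_derivative_linear[OF f(1)]] by (simp add: \<nu>_def)
  finally show ?thesis
    unfolding normal_deriv_def outward_normal_eq[OF m c p] \<nu>_def .
qed

text \<open>The derivative of a tangent field has the normal component that the Weingarten map prescribes,
  because \<open>N \<bullet> Y = 0\<close> along the boundary.\<close>

lemma weingarten:
  assumes c: "boundary_chart \<Omega> U \<rho>" and p: "p \<in> U" "\<rho> p = 0" and "open \<Omega>" "open V" "p \<in> V"
    and Y: "smooth_on V Y" "\<And>q. q \<in> V \<Longrightarrow> q \<in> U \<Longrightarrow> \<rho> q = 0 \<Longrightarrow> unit_normal \<rho> q \<bullet> Y q = 0"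
    and v: "unit_normal \<rho> p \<bullet> v = 0"
  shows "unit_normal \<rho> p \<bullet> dderiv v Y p = - (dderiv v (unit_normal \<rho>) p \<bullet> Y p)"
proof -
  let ?N = "unit_normal \<rho>"
  have U: "open (U \<inter> V)" "smooth_on (U \<inter> V) \<rho>" "p \<in> U \<inter> V"
    using chart_open[OF c] chart_smooth[OF c] assms by (auto intro: smooth_on_subset_set)
  have ne: "dderiv (?N p) \<rho> p \<noteq> 0"
    using unit_normal_dderiv_pos[OF c p(1)] by simp
  have "((\<lambda>q. ?N q \<bullet> Y q) has_derivative (\<lambda>v. ?N p \<bullet> dderiv v Y p + dderiv v ?N p \<bullet> Y p)) (at p)"
    by (intro has_derivative_inner smooth_on_has_derivative[OF smooth_on_unit_normal[OF c] p(1)]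
        smooth_on_has_derivative[OF Y(1) \<open>p \<in> V\<close>])
  then have "?N p \<bullet> dderiv v Y p + dderiv v ?N p \<bullet> Y p = 0"
    by (rule level_set_tangential_derivative_0[OF U p(2) ne])
       (use Y(2) v unit_normal_orthogonal_iff[OF c p(1)] in auto)
  then show ?thesis by simp
qed

text \<open>The boundary condition for a multiple \<open>k\<close> of the static potential, in Euclidean terms. All powers
  of the conformal factor cancel.\<close>

lemma boundary_condition_iff:
  fixes \<Omega> :: "(real ^ 'n::finite) set"
  assumes m: "m > 0" "CARD('n) \<ge> 3" and c: "boundary_chart \<Omega> U \<rho>" and p: "p \<in> U" "\<rho> p = 0"
    and \<Omega>: "open \<Omega>" "0 \<notin> \<Omega>"
    and u: "\<And>x. x \<in> closure_in schwarzschild_space \<Omega> \<Longrightarrow> u x = k * static_potential m x" and "k \<noteq> 0"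
    and V: "open V" "p \<in> V" and X: "boundary_tangent_field schwarzschild_space \<Omega> V X"
    and Y: "boundary_tangent_field schwarzschild_space \<Omega> V Y"
  shows "normal_deriv schwarzschild_space (schwarzschild_metric m) \<Omega> u p * metric_ip (schwarzschild_metric m) p (X p) (Y p)
       = u p * second_fundamental_form schwarzschild_space (schwarzschild_metric m) \<Omega> X Y p
     \<longleftrightarrow> (ricci_tangential m p - log_slope m p * static_potential m p) * (p \<bullet> unit_normal \<rho> p) * (X p \<bullet> Y p)
       = static_potential m p * (dderiv (X p) (unit_normal \<rho>) p \<bullet> Y p)"
proof -
  let ?N = "unit_normal \<rho> p" and ?u0 = "static_potential m p" and ?l = "log_slope m p" and ?R = "ricci_tangential m p"
  define C where "C = sqrt (conformal_factor m p)"
  have "conformal_factor m p > 0" using conformal_factor_ge_1[OF m, of p] by simp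
  then have C: "C > 0" and CC: "conformal_factor m p = C * C" by (simp_all add: C_def)
  have p0: "p \<noteq> 0" using chart_0[OF c] p(1) by blast
  have fr: "q \<in> boundary_in schwarzschild_space \<Omega>" if "q \<in> U" "\<rho> q = 0" for q
    using chart_frontier_iff[OF c \<Omega>(1) that(1)] that chart_0[OF c] by (auto simp: boundary_in_def schwarzschild_space_def)
  have tang: "unit_normal \<rho> q \<bullet> Z q = 0"
    if "boundary_tangent_field schwarzschild_space \<Omega> V Z" "q \<in> V" "q \<in> U" "\<rho> q = 0" for Z q
    using that(1,2) fr[OF that(3,4)] boundary_tangent_space_eq[of \<Omega> U \<rho> q] c that(3,4)
    by (auto simp: boundary_tangent_field_def)
  have NX: "?N \<bullet> X p = 0" and NY: "?N \<bullet> Y p = 0"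
    using tang X Y V p by auto
  have sY: "smooth_on V Y" using Y by (simp add: boundary_tangent_field_def)
  have w: "?N \<bullet> dderiv (X p) Y p = - (dderiv (X p) (unit_normal \<rho>) p \<bullet> Y p)"
    by (rule weingarten[OF c p \<Omega>(1) V sY _ NX]) (use tang[OF Y] in auto)
  have "p \<in> closure_in schwarzschild_space \<Omega>"
    using fr[OF p] by (simp add: boundary_in_def closure_in_def frontier_def)
  note up = u[OF this]
  have "((\<lambda>x. k * static_potential m x) has_derivative (\<lambda>v. k * (?R * (p \<bullet> v)))) (at p)"
    by (rule has_derivative_mult_right[OF has_derivative_static_potential[OF m p0]])
  from normal_deriv_eq[OF m c p \<Omega> this u]
  have nd: "normal_deriv schwarzschild_space (schwarzschild_metric m) \<Omega> u p = k * ?R * (p \<bullet> ?N) / C"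
    by (simp add: C_def)
  have "second_fundamental_form schwarzschild_space (schwarzschild_metric m) \<Omega> X Y p
     = - (C * C * ((1 / C) * (?N \<bullet> (dderiv (X p) Y p + ?l *\<^sub>R ((p \<bullet> X p) *\<^sub>R Y p + (p \<bullet> Y p) *\<^sub>R X p - (X p \<bullet> Y p) *\<^sub>R p)))))"
    unfolding second_fundamental_form_def metric_ip_schwarzschild CC outward_normal_eq[OF m c p]
      cov_deriv_schwarzschild[OF m p0] using C by simp
  also have "\<dots> = - (C * (- (dderiv (X p) (unit_normal \<rho>) p \<bullet> Y p) - ?l * (X p \<bullet> Y p) * (p \<bullet> ?N)))"
    using C by (simp add: inner_add_right inner_diff_right NX NY w inner_commute[of ?N p])
  finally have sff: "second_fundamental_form schwarzschild_space (schwarzschild_metric m) \<Omega> X Y p = \<dots>" .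
  have "normal_deriv schwarzschild_space (schwarzschild_metric m) \<Omega> u p * metric_ip (schwarzschild_metric m) p (X p) (Y p)
      - u p * second_fundamental_form schwarzschild_space (schwarzschild_metric m) \<Omega> X Y p
    = (k * C) * ((?R - ?l * ?u0) * (p \<bullet> ?N) * (X p \<bullet> Y p) - ?u0 * (dderiv (X p) (unit_normal \<rho>) p \<bullet> Y p))"
    unfolding nd sff up metric_ip_schwarzschild CC using C by (simp add: algebra_simps)
  moreover have "k * C \<noteq> 0" using \<open>k \<noteq> 0\<close> C by simp
  ultimately show ?thesis
    by (metis (no_types) eq_iff_diff_eq_0 mult_eq_0_iff)
qed

section \<open>Boundaries of non-generic domains\<close>

lemma smooth_on_subset_imp_smooth_on:
  assumes "smooth_on_subset A u" "open W" "W \<subseteq> A"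
  shows "smooth_on W u"
proof (rule smooth_on_local)
  fix x assume x: "x \<in> W"
  then obtain V F where V: "open V" "x \<in> V" "smooth_on V F" "\<And>y. y \<in> V \<inter> A \<Longrightarrow> F y = u y"
    using assms(1,3) unfolding smooth_on_subset_def by (metis subsetD)
  have "smooth_on (V \<inter> W) u"
    by (rule smooth_on_cong[of _ F]) (use V assms(2,3) in \<open>auto intro: smooth_on_subset_set\<close>)
  then show "\<exists>T. open T \<and> x \<in> T \<and> smooth_on T u"
    using V x assms(2) by (intro exI[of _ "V \<inter> W"]) auto
qed

lemma smooth_on_subset_eq_on_closure:
  fixes f u :: "real ^ 'n::finite \<Rightarrow> real"
  assumes u: "smooth_on_subset (closure_in schwarzschild_space \<Omega>) u" and "continuous_on (- {0}) f"
    and eq: "\<And>x. x \<in> \<Omega> \<Longrightarrow> u x = f x" and "0 \<notin> \<Omega>" and x: "x \<in> closure_in schwarzschild_space \<Omega>"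
  shows "u x = f x"
proof (rule ccontr)
  assume ne: "u x \<noteq> f x"
  obtain V F where V: "open V" "x \<in> V" "smooth_on V F" "\<And>y. y \<in> V \<inter> closure_in schwarzschild_space \<Omega> \<Longrightarrow> F y = u y"
    using u x unfolding smooth_on_subset_def by metis
  let ?W = "V - {0}"
  have W: "open ?W" "x \<in> ?W"
    using V x by (auto simp: closure_in_def schwarzschild_space_def open_delete)
  have "continuous_on ?W (\<lambda>y. F y - f y)"
    using smooth_on_continuous_on[OF V(3)] assms(2) by (intro continuous_intros) (auto intro: continuous_on_subset)
  then have "open (?W \<inter> (\<lambda>y. F y - f y) -` (- {0}))"
    by (rule continuous_open_preimage[OF _ W(1)]) auto
  moreover have "x \<in> ?W \<inter> (\<lambda>y. F y - f y) -` (- {0})"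
    using W ne V(4)[of x] x V(2) by simp
  moreover have "x \<in> closure \<Omega>" using x by (simp add: closure_in_def)
  ultimately have "(?W \<inter> (\<lambda>y. F y - f y) -` (- {0})) \<inter> \<Omega> \<noteq> {}"
    using open_Int_closure_eq_empty by blast
  then obtain y where "y \<in> (?W \<inter> (\<lambda>y. F y - f y) -` (- {0})) \<inter> \<Omega>"
    by blast
  then have "y \<in> \<Omega>" "y \<in> V" "F y \<noteq> f y"
    by simp_all
  have "y \<in> closure_in schwarzschild_space \<Omega>"
    using \<open>y \<in> \<Omega>\<close> \<open>0 \<notin> \<Omega>\<close> closure_subset[of \<Omega>] by (auto simp: closure_in_def schwarzschild_space_def)
  then show False using V(4)[of y] eq[of y] \<open>y \<in> \<Omega>\<close> \<open>y \<in> V\<close> \<open>F y \<noteq> f y\<close> by simp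
qed

text \<open>In Euclidean terms: by uniqueness of the static potential, the boundary of a non-generic domain
  satisfies this umbilicity equation with an explicitly known principal curvature.\<close>

lemma non_generic_umbilicity:
  fixes \<Omega> :: "(real ^ 'n::finite) set"
  assumes m: "m > 0" "CARD('n) \<ge> 3" and dom: "riem_domain schwarzschild_space g \<Omega> S"
    and ng: "non_generic schwarzschild_space (schwarzschild_metric m) \<Omega> S"
    and c: "boundary_chart \<Omega> U \<rho>" and p: "p \<in> U" "\<rho> p = 0"
    and a: "unit_normal \<rho> p \<bullet> a = 0" and b: "unit_normal \<rho> p \<bullet> b = 0"
  shows "(ricci_tangential m p - log_slope m p * static_potential m p) * (p \<bullet> unit_normal \<rho> p) * (a \<bullet> b)
       = static_potential m p * (dderiv a (unit_normal \<rho>) p \<bullet> b)"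
proof -
  have \<Omega>: "open \<Omega>" "connected \<Omega>" "0 \<notin> \<Omega>" "S = boundary_in schwarzschild_space \<Omega>"
    using dom by (auto simp: riem_domain_def schwarzschild_space_def)
  obtain u where u: "smooth_on_subset (closure_in schwarzschild_space \<Omega>) u"
    "\<exists>x\<in>closure_in schwarzschild_space \<Omega>. u x \<noteq> 0"
    "\<And>x. x \<in> \<Omega> \<Longrightarrow> Lstar (schwarzschild_metric m) u x = 0"
    and bc: "\<And>p V X Y. p \<in> S \<Longrightarrow> open V \<Longrightarrow> p \<in> V \<Longrightarrow> V \<subseteq> schwarzschild_space \<Longrightarrow>
             boundary_tangent_field schwarzschild_space \<Omega> V X \<Longrightarrow> boundary_tangent_field schwarzschild_space \<Omega> V Y \<Longrightarrow>
             normal_deriv schwarzschild_space (schwarzschild_metric m) \<Omega> u p * metric_ip (schwarzschild_metric m) p (X p) (Y p)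
               = u p * second_fundamental_form schwarzschild_space (schwarzschild_metric m) \<Omega> X Y p"
    using ng unfolding non_generic_def by metis
  have "\<Omega> \<subseteq> closure_in schwarzschild_space \<Omega>"
    using \<Omega>(3) closure_subset[of \<Omega>] by (auto simp: closure_in_def schwarzschild_space_def)
  then have "smooth_on \<Omega> u"
    using smooth_on_subset_imp_smooth_on[OF u(1) \<Omega>(1)] by simp
  moreover have "\<Omega> \<subseteq> - {0}" using \<Omega>(3) by auto
  ultimately obtain k where k: "\<And>x. x \<in> \<Omega> \<Longrightarrow> u x = k * static_potential m x"
    using static_potential_unique[OF m \<Omega>(1,2)] u(3) by metis
  have "continuous_on (- {0}) (\<lambda>x :: real ^ 'n. k * static_potential m x)"
    by (intro continuous_intros smooth_on_continuous_on smooth_on_static_potential m)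
  from smooth_on_subset_eq_on_closure[OF u(1) this k \<Omega>(3)]
  have uk: "\<And>x. x \<in> closure_in schwarzschild_space \<Omega> \<Longrightarrow> u x = k * static_potential m x" .
  then have "k \<noteq> 0" using u(2) by auto
  \<comment> \<open>The boundary condition quantifies over tangent fields; these realise all tangent vectors at \<open>p\<close>.\<close>
  let ?T = "\<lambda>a q. a - (unit_normal \<rho> q \<bullet> a) *\<^sub>R unit_normal \<rho> q"
  have tf: "boundary_tangent_field schwarzschild_space \<Omega> U (?T a)" for a
    unfolding boundary_tangent_field_def
  proof (intro conjI ballI)
    show "smooth_on U (?T a)"
      by (intro smooth_intros chart_open[OF c] smooth_on_unit_normal[OF c])
    fix q assume q: "q \<in> U \<inter> boundary_in schwarzschild_space \<Omega>"
    then have "\<rho> q = 0" using chart_frontier_iff[OF c \<Omega>(1)] by (auto simp: boundary_in_def)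
    then show "?T a q \<in> boundary_tangent_space schwarzschild_space \<Omega> q"
      using q boundary_tangent_space_eq[OF c, of q] unit_normal_norm[OF c, of q] by (simp add: inner_diff_right)
  qed
  have "p \<in> S"
    using chart_frontier_iff[OF c \<Omega>(1) p(1)] p chart_0[OF c] \<Omega>(4) by (auto simp: boundary_in_def schwarzschild_space_def)
  moreover have "U \<subseteq> schwarzschild_space" using chart_0[OF c] by (auto simp: schwarzschild_space_def)
  ultimately have "normal_deriv schwarzschild_space (schwarzschild_metric m) \<Omega> u p * metric_ip (schwarzschild_metric m) p (?T a p) (?T b p)
               = u p * second_fundamental_form schwarzschild_space (schwarzschild_metric m) \<Omega> (?T a) (?T b) p"
    using bc chart_open[OF c] p(1) tf by blast
  then show ?thesis
    using boundary_condition_iff[OF m c p \<Omega>(1,3) uk \<open>k \<noteq> 0\<close> chart_open[OF c] p(1) tf tf, of a b] a b by simp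
qed

text \<open>Codazzi's equation. Along an umbilical hypersurface, \<open>DN(T\<^sub>a) = \<kappa> T\<^sub>a\<close> for the tangential part \<open>T\<^sub>a\<close>
  of each constant vector \<open>a\<close>. Differentiating in a tangential direction \<open>b\<close> and using that \<open>D\<^sup>2N(a, b)\<close>
  is symmetric leaves \<open>D\<kappa>(b) a = D\<kappa>(a) b\<close>, which forces \<open>D\<kappa> = 0\<close> when there are two independent tangential
  directions.\<close>

lemma codazzi:
  fixes \<kappa> :: "'a::euclidean_space \<Rightarrow> real"
  assumes dim: "DIM('a) \<ge> 3" and c: "boundary_chart \<Omega> U \<rho>" and p: "p \<in> U" "\<rho> p = 0"
    and W: "open W" "p \<in> W"
    and \<kappa>: "(\<kappa> has_derivative \<kappa>') (at p)"
    and umb: "\<And>q v. q \<in> W \<Longrightarrow> q \<in> U \<Longrightarrow> \<rho> q = 0 \<Longrightarrow> unit_normal \<rho> q \<bullet> v = 0 \<Longrightarrow> dderiv v (unit_normal \<rho>) q = \<kappa> q *\<^sub>R v"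
    and b: "unit_normal \<rho> p \<bullet> b = 0"
  shows "\<kappa>' b = 0"
proof -
  let ?N = "unit_normal \<rho>"
  have dN: "(?N has_derivative (\<lambda>v. dderiv v ?N p)) (at p)"
    by (rule smooth_on_has_derivative[OF smooth_on_unit_normal[OF c] p(1)])
  have U: "open (U \<inter> W)" "smooth_on (U \<inter> W) \<rho>" "p \<in> U \<inter> W"
    using chart_open[OF c] chart_smooth[OF c] W p by (auto intro: smooth_on_subset_set)
  have ne: "dderiv (?N p) \<rho> p \<noteq> 0"
    using unit_normal_dderiv_pos[OF c p(1)] by simp
  have key: "dderiv w (dderiv a ?N) p = (\<kappa> p * (w \<bullet> a)) *\<^sub>R dderiv (?N p) ?N p + \<kappa>' w *\<^sub>R a - (\<kappa> p * (\<kappa> p * (w \<bullet> a))) *\<^sub>R ?N p"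
    if a: "?N p \<bullet> a = 0" and w: "?N p \<bullet> w = 0" for a w
  proof -
    define T where "T q = a - (?N q \<bullet> a) *\<^sub>R ?N q" for q
    define T' where "T' v = - ((?N p \<bullet> a) *\<^sub>R dderiv v ?N p + (dderiv v ?N p \<bullet> a) *\<^sub>R ?N p)" for v
    have T: "(T has_derivative T') (at p)"
      unfolding T_def[abs_def] T'_def[abs_def]
      by (rule has_derivative_eq_rhs[OF has_derivative_diff[OF has_derivative_const
            has_derivative_scaleR[OF has_derivative_inner_left[OF dN] dN]]]) simp
    have Tp: "T p = a" by (simp add: T_def a)
    have Dw: "dderiv w ?N p = \<kappa> p *\<^sub>R w"
      by (rule umb[OF W(2) p w])
    have T'w: "T' w = - (\<kappa> p * (w \<bullet> a)) *\<^sub>R ?N p"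
      by (simp add: T'_def a Dw)
    have fd: "?N differentiable (at p)"
      by (rule smooth_on_differentiable[OF smooth_on_unit_normal[OF c] p(1)])
    have "((\<lambda>q. dderiv (T q) ?N q - \<kappa> q *\<^sub>R T q) has_derivative
       (\<lambda>v. (dderiv v (dderiv (T p) ?N) p + dderiv (T' v) ?N p) - (\<kappa> p *\<^sub>R T' v + \<kappa>' v *\<^sub>R T p))) (at p)"
      by (intro has_derivative_diff has_derivative_scaleR has_derivative_dderiv_field[OF chart_open[OF c] smooth_on_unit_normal[OF c] p(1)] T \<kappa>)
    then have "(dderiv w (dderiv (T p) ?N) p + dderiv (T' w) ?N p) - (\<kappa> p *\<^sub>R T' w + \<kappa>' w *\<^sub>R T p) = 0"
    proof (rule level_set_tangential_derivative_0[OF U p(2) ne])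
      fix q assume q: "q \<in> U \<inter> W" "\<rho> q = 0"
      have "?N q \<bullet> T q = 0"
        using q by (simp add: T_def inner_diff_right unit_normal_norm[OF c])
      then show "dderiv (T q) ?N q - \<kappa> q *\<^sub>R T q = 0"
        using umb[of q "T q"] q by simp
    next
      show "dderiv w \<rho> p = 0" using w unit_normal_orthogonal_iff[OF c p(1)] by simp
    qed
    then show ?thesis
      unfolding Tp T'w dderiv_cmul[OF fd] by (simp add: algebra_simps)
  qed
  obtain a where a: "norm a = 1" "a \<bullet> b = 0" "a \<bullet> ?N p = 0"
    using unit_orthogonal_to_two[OF dim] by blast
  have "dderiv b (dderiv a ?N) p = dderiv a (dderiv b ?N) p"
    by (rule dderiv_commute[OF chart_open[OF c] smooth_on_unit_normal[OF c] p(1)])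
  then have "\<kappa>' b *\<^sub>R a = \<kappa>' a *\<^sub>R b"
    using key[of a b] key[of b a] a b by (simp add: inner_commute)
  then have "(\<kappa>' b *\<^sub>R a) \<bullet> a = (\<kappa>' a *\<^sub>R b) \<bullet> a" by simp
  then show ?thesis
    using a(2) by (simp add: inner_commute[of b a] a(1)[unfolded norm_eq_1])
qed

text \<open>With \<open>f\<close> the ratio of the principal curvature to \<open>x \<bullet> N\<close>, this says that \<open>f\<close> has gradient \<open>f\<^sub>1 x\<close> with
  \<open>f\<^sub>1 + f\<^sup>2 = - (n - 1) B\<close>, where \<open>B\<close> is the radial Ricci coefficient. The sum \<open>f\<^sub>1 + f\<^sup>2\<close> is what appears
  in the derivative of the principal curvature.\<close>

lemma has_derivative_curvature_factor:
  fixes x :: "real ^ 'n::finite"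
  assumes m: "m > 0" "CARD('n) \<ge> 3" and x: "x \<noteq> 0" "static_potential m x \<noteq> 0"
  defines "f \<equiv> (\<lambda>x. ricci_tangential m x / static_potential m x - log_slope m x)"
  shows "(f has_derivative (\<lambda>v. - (f x ^ 2 + (real CARD('n) - 1) * ricci_radial m x) * (x \<bullet> v))) (at x)"
proof -
  define R u l B n where "R = ricci_tangential m x" and "u = static_potential m x" and "l = log_slope m x"
    and "B = ricci_radial m x" and "n = real CARD('n)"
  note folds = R_def[symmetric] u_def[symmetric] l_def[symmetric] B_def[symmetric] n_def[symmetric]
  have u: "u \<noteq> 0" using x by (simp add: u_def)
  have d1: "(ricci_tangential m has_derivative (\<lambda>v. (2 * l * R - (n - 2) * B * u) * (x \<bullet> v))) (at x)"
    using has_derivative_ricci_tangential[OF m x(1)] unfolding folds .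
  have d2: "(static_potential m has_derivative (\<lambda>v. R * (x \<bullet> v))) (at x)"
    using has_derivative_static_potential[OF m x(1)] unfolding folds .
  have d3: "(log_slope m has_derivative (\<lambda>v. (B + l ^ 2) * (x \<bullet> v))) (at x)"
    using has_derivative_log_slope[OF m x(1)] unfolding log_slope_slope_eq[OF m(1) x(1)] folds .
  have eq: "((2 * l * R - (n - 2) * B * u) * y * u - R * (R * y)) / (u * u) - (B + l ^ 2) * y
     = - ((R / u - l) ^ 2 + (n - 1) * B) * y" for y
    using u by (simp add: field_simps power2_eq_square)
  have "(f has_derivative (\<lambda>v. ((2 * l * R - (n - 2) * B * u) * (x \<bullet> v) * u - R * (R * (x \<bullet> v))) / (u * u) - (B + l ^ 2) * (x \<bullet> v))) (at x)"
    unfolding f_def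
    by (rule has_derivative_diff[OF has_derivative_divide'[OF d1 d2 x(2)] d3, folded R_def u_def])
  then show ?thesis
    unfolding eq by (simp only: f_def folds)
qed

text \<open>The unit normal does not depend on the chart, so it is a function on the whole boundary.\<close>

definition euclid_normal :: "'a::euclidean_space set \<Rightarrow> 'a \<Rightarrow> 'a" where
  "euclid_normal \<Omega> p = (SOME N. \<exists>U \<rho>. boundary_chart \<Omega> U \<rho> \<and> p \<in> U \<and> \<rho> p = 0 \<and> N = unit_normal \<rho> p)"

lemma euclid_normal_eq:
  assumes "boundary_chart \<Omega> U \<rho>" "p \<in> U" "\<rho> p = 0"
  shows "euclid_normal \<Omega> p = unit_normal \<rho> p"
  unfolding euclid_normal_def
  by (rule some_equality) (use assms unit_normal_unique[OF assms(1)] in blast)+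

lemma connected_locally_constant:
  assumes "connected S" "\<And>p. p \<in> S \<Longrightarrow> \<exists>V. open V \<and> p \<in> V \<and> (\<forall>x\<in>V \<inter> S. f x = f p)"
    and "p \<in> S" "q \<in> S"
  shows "f p = f q"
proof (rule connected_local_const[OF assms(1,3,4)], intro ballI)
  fix a assume "a \<in> S"
  then obtain V where "open V" "a \<in> V" "\<forall>x\<in>V \<inter> S. f x = f a"
    using assms(2) by blast
  then show "\<forall>\<^sub>F b in at a within S. f a = f b"
    unfolding eventually_at_topological by (metis IntI)
qed

text \<open>The boundary is the part of the frontier in \<open>H\<close>, hence closed in \<open>H\<close>; being open in it as well, it is all
  of \<open>H\<close> by connectedness.\<close>

lemma boundary_fills_hypersurface:
  assumes "connected H" "H \<subseteq> schwarzschild_space" "S = boundary_in schwarzschild_space \<Omega>" "S \<subseteq> H" "S \<noteq> {}"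
    and "\<And>p. p \<in> S \<Longrightarrow> \<exists>V. open V \<and> p \<in> V \<and> V \<inter> H \<subseteq> S"
  shows "S = H"
proof -
  have "S = H \<inter> frontier \<Omega>"
    using assms(2-4) by (auto simp: boundary_in_def)
  then have "closedin (top_of_set H) S"
    using closedin_closed_Int[OF frontier_closed, of H \<Omega>] by simp
  moreover have "openin (top_of_set H) S"
  proof (rule openin_subopen[THEN iffD2], intro ballI)
    fix p assume p: "p \<in> S"
    then obtain V where V: "open V" "p \<in> V" "V \<inter> H \<subseteq> S" using assms(6) by blast
    show "\<exists>T. openin (top_of_set H) T \<and> p \<in> T \<and> T \<subseteq> S"
      by (rule exI[of _ "H \<inter> V"]) (use V p assms(4) in \<open>auto intro: openin_open_Int\<close>)
  qed
  ultimately show ?thesis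
    using assms(1,5) connected_clopen[of H] by blast
qed

context
  fixes m :: real and \<Omega> S :: "(real ^ 'n::finite) set"
  assumes m: "m > 0" "CARD('n) \<ge> 3"
    and dom: "riem_domain schwarzschild_space (schwarzschild_metric m) \<Omega> S"
    and ng: "non_generic schwarzschild_space (schwarzschild_metric m) \<Omega> S"
begin

abbreviation (input) "curvature_factor x \<equiv> ricci_tangential m x / static_potential m x - log_slope m x"

lemma non_generic_weingarten:
  assumes c: "boundary_chart \<Omega> U \<rho>" and p: "p \<in> U" "\<rho> p = 0" and u: "static_potential m p \<noteq> 0"
    and v: "unit_normal \<rho> p \<bullet> v = 0"
  shows "dderiv v (unit_normal \<rho>) p = (curvature_factor p * (p \<bullet> unit_normal \<rho> p)) *\<^sub>R v"
proof -
  let ?N = "unit_normal \<rho>" and ?k = "curvature_factor p * (p \<bullet> unit_normal \<rho> p)"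
  define w where "w = dderiv v ?N p - ?k *\<^sub>R v"
  have 1: "((\<lambda>q. ?N q \<bullet> ?N q) has_derivative (\<lambda>v. ?N p \<bullet> dderiv v ?N p + dderiv v ?N p \<bullet> ?N p)) (at p)"
    by (intro has_derivative_inner smooth_on_has_derivative[OF smooth_on_unit_normal[OF c] p(1)])
  have 2: "((\<lambda>q. ?N q \<bullet> ?N q) has_derivative (\<lambda>v. 0)) (at p)"
    by (rule has_derivative_transform_within_open[OF has_derivative_const chart_open[OF c] p(1)])
       (simp add: unit_normal_norm[OF c])
  have "?N p \<bullet> dderiv v ?N p + dderiv v ?N p \<bullet> ?N p = 0"
    by (rule fun_cong[OF has_derivative_unique[OF 1 2]])
  then have "?N p \<bullet> dderiv v ?N p = 0" by (simp add: inner_commute)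
  then have Nw: "?N p \<bullet> w = 0" by (simp add: w_def inner_diff_right v)
  have "w \<bullet> b = 0" if b: "?N p \<bullet> b = 0" for b
  proof -
    have "static_potential m p * curvature_factor p = ricci_tangential m p - log_slope m p * static_potential m p"
      using u by (simp add: right_diff_distrib)
    then have "static_potential m p * (w \<bullet> b) = static_potential m p * (dderiv v ?N p \<bullet> b)
       - (ricci_tangential m p - log_slope m p * static_potential m p) * (p \<bullet> ?N p) * (v \<bullet> b)"
      by (simp add: w_def inner_diff_left right_diff_distrib flip: mult.assoc)
    also have "\<dots> = 0"
      using non_generic_umbilicity[OF m dom ng c p v b] by simp
    finally show ?thesis using u by simp
  qed
  from this[OF Nw] show ?thesis by (simp add: w_def)
qed

lemma tangent_exists:
  obtains v :: "real ^ 'n" where "norm v = 1" "N \<bullet> v = 0"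
  using unit_orthogonal_to_two[of N N] m(2) by (auto simp: inner_commute)

text \<open>Where the static potential does not vanish, the principal curvature is \<open>\<kappa> = f (x \<bullet> N)\<close> with \<open>f\<close> radial.
  Its tangential derivative is \<open>- (n - 1) B (x \<bullet> N) (x \<bullet> v)\<close>, where \<open>B > 0\<close> is the radial
  Ricci coefficient, so Codazzi's equation forces \<open>x \<bullet> N = 0\<close> or \<open>x \<bullet> v = 0\<close>.\<close>

lemma non_generic_dichotomy:
  assumes c: "boundary_chart \<Omega> U \<rho>" and p: "p \<in> U" "\<rho> p = 0"
  shows "p \<bullet> unit_normal \<rho> p = 0 \<or> (\<forall>v. unit_normal \<rho> p \<bullet> v = 0 \<longrightarrow> p \<bullet> v = 0)"
proof (cases "static_potential m p = 0")
  case True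
  obtain v :: "real ^ 'n" where v: "norm v = 1" "unit_normal \<rho> p \<bullet> v = 0"
    using tangent_exists by blast
  have "p \<noteq> 0" using chart_0[OF c] p(1) by blast
  then have "ricci_tangential m p > 0" by (rule ricci_tangential_pos[OF m])
  moreover have "ricci_tangential m p * (p \<bullet> unit_normal \<rho> p) = 0"
    using non_generic_umbilicity[OF m dom ng c p v(2) v(2)] True v(1)[unfolded norm_eq_1] by simp
  ultimately show ?thesis by simp
next
  case False
  let ?N = "unit_normal \<rho>" and ?f = "\<lambda>x. curvature_factor x"
  have p0: "p \<noteq> 0" using chart_0[OF c] p(1) by blast
  let ?W = "(- {0}) \<inter> (static_potential m :: real ^ 'n \<Rightarrow> real) -` (- {0})"
  have W: "open ?W" "p \<in> ?W"
    using False p0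
    by (auto intro!: continuous_open_preimage[OF smooth_on_continuous_on[OF smooth_on_static_potential[OF m(1)]]] open_Compl)
  have dN: "(?N has_derivative (\<lambda>v. dderiv v ?N p)) (at p)"
    by (rule smooth_on_has_derivative[OF smooth_on_unit_normal[OF c] p(1)])
  have \<kappa>: "((\<lambda>x. ?f x * (x \<bullet> ?N x)) has_derivative
     (\<lambda>v. ?f p * (p \<bullet> dderiv v ?N p + v \<bullet> ?N p) + - (?f p ^ 2 + (real CARD('n) - 1) * ricci_radial m p) * (p \<bullet> v) * (p \<bullet> ?N p))) (at p)"
    by (intro has_derivative_mult has_derivative_curvature_factor[OF m p0 False] has_derivative_inner has_derivative_ident dN)
  have "(real CARD('n) - 1) * ricci_radial m p * ((p \<bullet> v) * (p \<bullet> ?N p)) = 0" if v: "?N p \<bullet> v = 0" for v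
  proof -
    have "?f p * (p \<bullet> dderiv v ?N p + v \<bullet> ?N p) + - (?f p ^ 2 + (real CARD('n) - 1) * ricci_radial m p) * (p \<bullet> v) * (p \<bullet> ?N p) = 0"
      by (rule codazzi[OF _ c p W \<kappa> _ v]) (use m(2) non_generic_weingarten[OF c] in auto)
    then have eq: "?f p * (?f p * (p \<bullet> ?N p) * (p \<bullet> v) + 0)
        + - (?f p ^ 2 + (real CARD('n) - 1) * ricci_radial m p) * (p \<bullet> v) * (p \<bullet> ?N p) = 0"
      unfolding non_generic_weingarten[OF c p False v] inner_scaleR_right using v by (simp only: inner_commute[of v])
    have gen: "f * (f * q * a + 0) + - (f ^ 2 + k) * a * q = - (k * (a * q))" for f q a k :: real
      by (simp add: algebra_simps power2_eq_square)
    show ?thesis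
      using eq unfolding gen by (simp only: neg_equal_0_iff_equal)
  qed
  moreover have "(real CARD('n) - 1) * ricci_radial m p \<noteq> 0"
    using ricci_radial_pos[OF m(1) p0] m(2) by simp
  ultimately have "(p \<bullet> v) * (p \<bullet> ?N p) = 0" if "?N p \<bullet> v = 0" for v
    using that by (metis mult_eq_0_iff)
  then show ?thesis by auto
qed

lemma boundary_charts:
  assumes "p \<in> S"
  obtains U \<rho> where "boundary_chart \<Omega> U \<rho>" "p \<in> U" "\<rho> p = 0"
  using assms dom unfolding riem_domain_def defining_function_iff_chart by blast

lemma chart_boundary_iff: "boundary_chart \<Omega> U \<rho> \<Longrightarrow> x \<in> U \<Longrightarrow> x \<in> S \<longleftrightarrow> \<rho> x = 0"
proof -
  assume c: "boundary_chart \<Omega> U \<rho>" and x: "x \<in> U"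
  have "open \<Omega>" "S = boundary_in schwarzschild_space \<Omega>"
    using dom by (auto simp: riem_domain_def)
  moreover have "x \<noteq> 0" using chart_0[OF c] x by blast
  ultimately show ?thesis
    using chart_frontier_iff[OF c _ x] by (simp add: boundary_in_def schwarzschild_space_def)
qed

text \<open>The function \<open>\<bar>x \<bullet> N\<bar> / \<bar>x\<bar>\<close> is continuous on the boundary and has only the values \<open>0\<close> and \<open>1\<close>, so
  the same alternative holds at all points of a connected boundary.\<close>

lemma dichotomy_global:
  assumes "connected S"
  shows "(\<forall>p\<in>S. p \<bullet> euclid_normal \<Omega> p = 0) \<or>
    (\<forall>p\<in>S. p \<bullet> euclid_normal \<Omega> p \<noteq> 0 \<and> (\<forall>v. euclid_normal \<Omega> p \<bullet> v = 0 \<longrightarrow> p \<bullet> v = 0))"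
proof -
  let ?q = "\<lambda>p. \<bar>p \<bullet> euclid_normal \<Omega> p\<bar> / norm p"
  have p0: "p \<noteq> 0" if "p \<in> S" for p
    using that dom by (auto simp: riem_domain_def boundary_in_def schwarzschild_space_def)
  have N1: "euclid_normal \<Omega> p \<bullet> euclid_normal \<Omega> p = 1" if "p \<in> S" for p
    using boundary_charts[OF that] euclid_normal_eq unit_normal_norm by metis
  have dich: "p \<bullet> euclid_normal \<Omega> p = 0 \<or> (\<forall>v. euclid_normal \<Omega> p \<bullet> v = 0 \<longrightarrow> p \<bullet> v = 0)" if "p \<in> S" for p
    using boundary_charts[OF that] euclid_normal_eq non_generic_dichotomy by metis
  have q1: "?q p = 1" if p: "p \<in> S" and ne: "p \<bullet> euclid_normal \<Omega> p \<noteq> 0" for p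
  proof -
    let ?N = "euclid_normal \<Omega> p"
    define w where "w = p - (p \<bullet> ?N) *\<^sub>R ?N"
    have Nw: "?N \<bullet> w = 0" by (simp add: w_def inner_diff_right N1[OF p] inner_commute)
    then have "p \<bullet> w = 0" using dich[OF p] ne by blast
    then have "w \<bullet> w = 0" using Nw by (simp add: w_def inner_diff_left)
    then have eq: "p = (p \<bullet> ?N) *\<^sub>R ?N" by (simp add: w_def)
    have "norm ?N = 1" using N1[OF p] by (simp add: norm_eq_1)
    then have "norm p = \<bar>p \<bullet> ?N\<bar>" by (metis eq mult.right_neutral norm_scaleR)
    then show ?thesis using p0[OF p] ne by simp
  qed
  have "continuous_on S ?q"
    unfolding continuous_on_eq_continuous_within
  proof
    fix p assume p: "p \<in> S"
    obtain U \<rho> where c: "boundary_chart \<Omega> U \<rho>" "p \<in> U" "\<rho> p = 0"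
      by (rule boundary_charts[OF p], rule that)
    have "continuous_on U (\<lambda>x. \<bar>x \<bullet> unit_normal \<rho> x\<bar> / norm x)"
      using chart_0[OF c(1)]
      by (intro continuous_intros smooth_on_continuous_on[OF smooth_on_unit_normal[OF c(1)]]) auto
    then have "continuous (at p) (\<lambda>x. \<bar>x \<bullet> unit_normal \<rho> x\<bar> / norm x)"
      using continuous_on_eq_continuous_at[OF chart_open[OF c(1)]] c(2) by blast
    then have 1: "continuous (at p within S) (\<lambda>x. \<bar>x \<bullet> unit_normal \<rho> x\<bar> / norm x)"
      by (rule continuous_at_imp_continuous_at_within)
    obtain d where d: "d > 0" "ball p d \<subseteq> U"
      using chart_open[OF c(1)] c(2) open_contains_ball by blast
    show "continuous (at p within S) ?q"
    proof (rule continuous_transform_within[OF 1 d(1) p])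
      fix x assume "x \<in> S" "dist x p < d"
      then have "x \<in> U" "\<rho> x = 0"
        using d(2) chart_boundary_iff[OF c(1)] by (auto simp: dist_commute subset_iff)
      then show "\<bar>x \<bullet> unit_normal \<rho> x\<bar> / norm x = ?q x"
        using euclid_normal_eq[OF c(1)] by simp
    qed
  qed
  moreover have "?q ` S \<subseteq> {0, 1}"
    using q1 by force
  then have "finite (?q ` S)" by (rule finite_subset) simp
  ultimately have "?q constant_on S"
    using continuous_finite_range_constant[OF assms] by blast
  then obtain k where k: "\<And>p. p \<in> S \<Longrightarrow> ?q p = k" unfolding constant_on_def by blast
  show ?thesis
  proof (cases "k = 0")
    case True
    then have "p \<bullet> euclid_normal \<Omega> p = 0" if "p \<in> S" for p
      using k[OF that] p0[OF that] by simp
    then show ?thesis by blast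
  next
    case False
    then have "p \<bullet> euclid_normal \<Omega> p \<noteq> 0" if "p \<in> S" for p
      using k[OF that] by auto
    then show ?thesis using dich by blast
  qed
qed

text \<open>If \<open>x \<bullet> N = 0\<close> throughout, then \<open>DN = 0\<close> on tangent vectors: directly where the static potential does
  not vanish, and by continuity elsewhere, because the potential cannot vanish on an open part of the
  boundary when \<open>x\<close> is tangent to it.\<close>

lemma tangential_position_weingarten_0:
  assumes q0: "\<forall>p\<in>S. p \<bullet> euclid_normal \<Omega> p = 0"
    and c: "boundary_chart \<Omega> U \<rho>" and p: "p \<in> U" "\<rho> p = 0" and v: "unit_normal \<rho> p \<bullet> v = 0"
  shows "dderiv v (unit_normal \<rho>) p = 0"
proof (rule ccontr)
  let ?N = "unit_normal \<rho>"
  assume ne: "dderiv v ?N p \<noteq> 0"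
  define T where "T q = v - (?N q \<bullet> v) *\<^sub>R ?N q" for q
  define H where "H q = dderiv (T q) ?N q" for q
  have "smooth_on U H"
    unfolding H_def[abs_def] T_def[abs_def]
    by (intro smooth_on_dderiv_field smooth_intros chart_open[OF c] smooth_on_unit_normal[OF c])
  then have "open (U \<inter> H -` (- {0}))"
    by (intro continuous_open_preimage smooth_on_continuous_on chart_open[OF c]) auto
  moreover have "p \<in> U \<inter> H -` (- {0})"
    using p ne v by (simp add: H_def T_def)
  ultimately have W: "open (U \<inter> H -` (- {0}))" "smooth_on (U \<inter> H -` (- {0})) \<rho>" "p \<in> U \<inter> H -` (- {0})"
    using smooth_on_subset_set[OF chart_smooth[OF c]] by auto
  have xN: "x \<bullet> ?N x = 0" if "x \<in> U" "\<rho> x = 0" for x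
    using q0 chart_boundary_iff[OF c that(1)] that euclid_normal_eq[OF c that] by auto
  have u0: "static_potential m x = 0" if x: "x \<in> U \<inter> H -` (- {0})" "\<rho> x = 0" for x
  proof (rule ccontr)
    assume "static_potential m x \<noteq> 0"
    moreover have "?N x \<bullet> T x = 0"
      using x by (simp add: T_def inner_diff_right unit_normal_norm[OF c])
    ultimately have "H x = (curvature_factor x * (x \<bullet> ?N x)) *\<^sub>R T x"
      unfolding H_def using non_generic_weingarten[OF c] x by auto
    then show False using xN[of x] x by simp
  qed
  have p0: "p \<noteq> 0" using chart_0[OF c] p by auto
  have "ricci_tangential m p * (p \<bullet> p) = 0"
  proof (rule level_set_tangential_derivative_0[OF W p(2) _ has_derivative_static_potential[OF m p0] u0])
    show "dderiv (?N p) \<rho> p \<noteq> 0"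
      using unit_normal_dderiv_pos[OF c p(1)] by simp
    show "dderiv p \<rho> p = 0"
      using xN[OF p] unit_normal_orthogonal_iff[OF c p(1)] by (simp add: inner_commute)
  qed
  then show False
    using ricci_tangential_pos[OF m p0] p0 by simp
qed

text \<open>The unit normal is then locally constant, hence constant, and the boundary lies in the hyperplane
  orthogonal to it; since the normal is transversal, the boundary is open in that hyperplane.\<close>

lemma hyperplane_case:
  assumes S: "connected S" and q0: "\<forall>p\<in>S. p \<bullet> euclid_normal \<Omega> p = 0"
  shows "\<exists>a. a \<noteq> 0 \<and> S = {x. a \<bullet> x = 0} - {0}"
proof -
  have S': "S = boundary_in schwarzschild_space \<Omega>" "S \<noteq> {}"
    using dom by (auto simp: riem_domain_def)
  then obtain p\<^sub>0 where p0: "p\<^sub>0 \<in> S" by blast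
  define a where "a = euclid_normal \<Omega> p\<^sub>0"
  have const: "euclid_normal \<Omega> p = a" if "p \<in> S" for p
    unfolding a_def
  proof (rule connected_locally_constant[OF S _ that p0])
    fix p assume p: "p \<in> S"
    obtain U \<rho> where c: "boundary_chart \<Omega> U \<rho>" "p \<in> U" "\<rho> p = 0"
      by (rule boundary_charts[OF p], rule that)
    have ne: "dderiv (unit_normal \<rho> p) \<rho> p \<noteq> 0"
      using unit_normal_dderiv_pos[OF c(1,2)] by simp
    obtain V where V: "open V" "p \<in> V" "V \<subseteq> U" "\<And>x. x \<in> V \<Longrightarrow> \<rho> x = 0 \<Longrightarrow> unit_normal \<rho> x = unit_normal \<rho> p"
    proof (rule level_set_locally_constant[OF chart_open[OF c(1)] chart_smooth[OF c(1)] c(2,3) ne])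
      fix x assume "x \<in> U" "\<rho> x = 0"
      then show "(unit_normal \<rho> has_derivative (\<lambda>v. dderiv v (unit_normal \<rho>) x)) (at x)"
        by (intro smooth_on_has_derivative[OF smooth_on_unit_normal[OF c(1)]])
    next
      fix x v assume "x \<in> U" "\<rho> x = 0" "dderiv v \<rho> x = 0"
      then show "dderiv v (unit_normal \<rho>) x = 0"
        using tangential_position_weingarten_0[OF q0 c(1)] unit_normal_orthogonal_iff[OF c(1)] by simp
    qed blast
    have "euclid_normal \<Omega> x = euclid_normal \<Omega> p" if "x \<in> V \<inter> S" for x
      using that V euclid_normal_eq[OF c(1)] c chart_boundary_iff[OF c(1)] by (metis IntE subsetD)
    then show "\<exists>V. open V \<and> p \<in> V \<and> (\<forall>x\<in>V \<inter> S. euclid_normal \<Omega> x = euclid_normal \<Omega> p)"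
      using V(1,2) by blast
  qed
  obtain U\<^sub>0 \<rho>\<^sub>0 where c0: "boundary_chart \<Omega> U\<^sub>0 \<rho>\<^sub>0" "p\<^sub>0 \<in> U\<^sub>0" "\<rho>\<^sub>0 p\<^sub>0 = 0"
    by (rule boundary_charts[OF p0], rule that)
  have a1: "a \<bullet> a = 1"
    using unit_normal_norm[OF c0(1,2)] euclid_normal_eq[OF c0] by (simp add: a_def)
  then have a0: "a \<noteq> 0" "norm a = 1" by (auto simp: norm_eq_1)
  let ?H = "{x. a \<bullet> x = 0} - {0}"
  have "aff_dim {x. a \<bullet> x = 0} \<noteq> 1"
    using aff_dim_hyperplane[OF a0(1), of 0] m(2) by simp
  then have "connected ?H"
    by (intro path_connected_imp_connected path_connected_punctured_convex convex_hyperplane)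
  then have "S = ?H"
  proof (rule boundary_fills_hypersurface[OF _ _ S'(1) _ S'(2)])
    show "?H \<subseteq> schwarzschild_space" by (auto simp: schwarzschild_space_def)
    show SH: "S \<subseteq> ?H"
      using q0 const dom by (auto simp: inner_commute riem_domain_def boundary_in_def schwarzschild_space_def)
    fix p assume p: "p \<in> S"
    obtain U \<rho> where c: "boundary_chart \<Omega> U \<rho>" "p \<in> U" "\<rho> p = 0"
      by (rule boundary_charts[OF p], rule that)
    have ne: "dderiv a \<rho> p \<noteq> 0"
      using unit_normal_dderiv_pos[OF c(1,2)] const[OF p] euclid_normal_eq[OF c] by simp
    obtain V where V: "open V" "p \<in> V" "\<And>x. x \<in> V \<Longrightarrow> \<exists>t. x + t *\<^sub>R a \<in> U \<inter> ball p 1 \<and> \<rho> (x + t *\<^sub>R a) = 0"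
      by (rule level_set_meets_lines[OF chart_open[OF c(1)] chart_smooth[OF c(1)] c(2,3) a0(2) ne zero_less_one], rule that)
    have "x \<in> S" if x: "x \<in> V" "x \<in> ?H" for x
    proof -
      obtain t where t: "x + t *\<^sub>R a \<in> U" "\<rho> (x + t *\<^sub>R a) = 0"
        using V(3)[OF x(1)] by auto
      then have "x + t *\<^sub>R a \<in> S" using chart_boundary_iff[OF c(1)] by simp
      moreover from this have "a \<bullet> (x + t *\<^sub>R a) = 0" using SH by blast
      then have "t = 0" using x(2) a1 by (simp add: inner_add_right)
      ultimately show ?thesis by simp
    qed
    then show "\<exists>V. open V \<and> p \<in> V \<and> V \<inter> ?H \<subseteq> S"
      using V(1,2) by blast
  qed
  then show ?thesis using a0(1) by blast
qed

text \<open>If \<open>x\<close> is normal to the boundary, then \<open>x \<bullet> x\<close> is locally constant, and the boundary is open in a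
  centred sphere. Differentiating \<open>x = (x \<bullet> N) N\<close> gives the Euclidean principal curvature \<open>1 / (x \<bullet> N)\<close>,
  which turns the umbilicity equation into the equation for the radius.\<close>

lemma sphere_case:
  assumes S: "connected S"
    and qn: "\<forall>p\<in>S. p \<bullet> euclid_normal \<Omega> p \<noteq> 0 \<and> (\<forall>v. euclid_normal \<Omega> p \<bullet> v = 0 \<longrightarrow> p \<bullet> v = 0)"
  obtains r where "r > 0" "S = sphere 0 r"
    "\<And>p. p \<in> S \<Longrightarrow> (ricci_tangential m p - log_slope m p * static_potential m p) * r ^ 2 = static_potential m p"
proof -
  have S': "S = boundary_in schwarzschild_space \<Omega>" "S \<noteq> {}"
    using dom by (auto simp: riem_domain_def)
  then obtain p\<^sub>0 where p0: "p\<^sub>0 \<in> S" by blast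
  define r where "r = norm p\<^sub>0"
  have nz: "p \<noteq> 0" if "p \<in> S" for p
    using that S' by (auto simp: boundary_in_def schwarzschild_space_def)
  have r0: "r > 0" using nz[OF p0] by (simp add: r_def)
  have tang: "x \<bullet> v = 0"
    if "boundary_chart \<Omega> U \<rho>" "x \<in> U" "\<rho> x = 0" "unit_normal \<rho> x \<bullet> v = 0" for U \<rho> x v
    using qn chart_boundary_iff[OF that(1,2)] euclid_normal_eq[OF that(1-3)] that(3,4) by auto
  have "p \<bullet> p = p\<^sub>0 \<bullet> p\<^sub>0" if "p \<in> S" for p
  proof (rule connected_locally_constant[OF S _ that p0])
    fix p assume p: "p \<in> S"
    obtain U \<rho> where c: "boundary_chart \<Omega> U \<rho>" "p \<in> U" "\<rho> p = 0"
      by (rule boundary_charts[OF p], rule that)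
    have ne: "dderiv (unit_normal \<rho> p) \<rho> p \<noteq> 0"
      using unit_normal_dderiv_pos[OF c(1,2)] by simp
    obtain V where V: "open V" "p \<in> V" "V \<subseteq> U" "\<And>x. x \<in> V \<Longrightarrow> \<rho> x = 0 \<Longrightarrow> x \<bullet> x = p \<bullet> p"
    proof (rule level_set_locally_constant[OF chart_open[OF c(1)] chart_smooth[OF c(1)] c(2,3) ne])
      fix x assume "x \<in> U" "\<rho> x = 0"
      show "((\<lambda>x. x \<bullet> x) has_derivative (\<lambda>v. 2 * (x \<bullet> v))) (at x)"
        by (rule has_derivative_radial_inner)
    next
      fix x v assume "x \<in> U" "\<rho> x = 0" "dderiv v \<rho> x = 0"
      then show "2 * (x \<bullet> v) = 0"
        using tang[OF c(1)] unit_normal_orthogonal_iff[OF c(1)] by simp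
    qed blast
    then show "\<exists>V. open V \<and> p \<in> V \<and> (\<forall>x\<in>V \<inter> S. x \<bullet> x = p \<bullet> p)"
      using chart_boundary_iff[OF c(1)] by blast
  qed
  then have Sr: "norm p = r" if "p \<in> S" for p
    using that by (simp add: r_def norm_eq_sqrt_inner)
  have "connected (sphere (0 :: real ^ 'n) r)"
    using m(2) by (simp add: connected_sphere_eq)
  then have "S = sphere 0 r"
  proof (rule boundary_fills_hypersurface[OF _ _ S'(1) _ S'(2)])
    show "sphere 0 r \<subseteq> schwarzschild_space" using r0 by (auto simp: schwarzschild_space_def)
    show SH: "S \<subseteq> sphere 0 r" using Sr by auto
    fix p assume p: "p \<in> S"
    obtain U \<rho> where c: "boundary_chart \<Omega> U \<rho>" "p \<in> U" "\<rho> p = 0"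
      by (rule boundary_charts[OF p], rule that)
    define e where "e = p /\<^sub>R r"
    have e1: "norm e = 1" "p = r *\<^sub>R e" using Sr[OF p] r0 by (auto simp: e_def)
    then have ee: "e \<bullet> e = 1" by (simp add: norm_eq_1)
    have ne: "dderiv e \<rho> p \<noteq> 0"
    proof
      assume "dderiv e \<rho> p = 0"
      then have "p \<bullet> e = 0" using tang[OF c] unit_normal_orthogonal_iff[OF c(1,2)] by simp
      then show False using e1(2) r0 ee by simp
    qed
    obtain V where V: "open V" "p \<in> V" "\<And>x. x \<in> V \<Longrightarrow> \<exists>t. x + t *\<^sub>R e \<in> U \<inter> ball p r \<and> \<rho> (x + t *\<^sub>R e) = 0"
      by (rule level_set_meets_lines[OF chart_open[OF c(1)] chart_smooth[OF c(1)] c(2,3) e1(1) ne r0], rule that)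
    \<comment> \<open>The line in the direction \<open>e\<close> meets the sphere twice; points near \<open>p\<close> lie on the same cap.\<close>
    have pos: "e \<bullet> y > 0" if "y \<in> ball p r" for y
    proof -
      have "e \<bullet> (p - y) \<le> norm e * norm (p - y)" by (rule norm_cauchy_schwarz)
      also have "\<dots> < r" using that e1(1) by (simp add: dist_norm)
      finally show ?thesis using e1(2) ee by (simp add: inner_diff_right)
    qed
    have "x \<in> S" if x: "x \<in> V \<inter> ball p r" "x \<in> sphere 0 r" for x
    proof -
      obtain t where t: "x + t *\<^sub>R e \<in> U" "x + t *\<^sub>R e \<in> ball p r" "\<rho> (x + t *\<^sub>R e) = 0"
        using V(3) x(1) by auto
      then have yS: "x + t *\<^sub>R e \<in> S" using chart_boundary_iff[OF c(1)] by simp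
      then have "(x + t *\<^sub>R e) \<bullet> (x + t *\<^sub>R e) = x \<bullet> x"
        using Sr[OF yS] x(2) by (simp add: dot_square_norm)
      then have "t * (e \<bullet> x + e \<bullet> (x + t *\<^sub>R e)) = 0"
        using ee by (simp add: inner_commute algebra_simps)
      moreover have "e \<bullet> x + e \<bullet> (x + t *\<^sub>R e) > 0"
        using pos[OF t(2)] pos[of x] x(1) by simp
      ultimately have "t = 0" by simp
      then show ?thesis using yS by simp
    qed
    moreover have "p \<in> V \<inter> ball p r" using V(2) r0 by simp
    ultimately show "\<exists>V. open V \<and> p \<in> V \<and> V \<inter> sphere 0 r \<subseteq> S"
      using V(1) by (intro exI[of _ "V \<inter> ball p r"]) auto
  qed
  moreover have "(ricci_tangential m p - log_slope m p * static_potential m p) * r ^ 2 = static_potential m p" if p: "p \<in> S" for p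
  proof -
    obtain U \<rho> where c: "boundary_chart \<Omega> U \<rho>" "p \<in> U" "\<rho> p = 0"
      by (rule boundary_charts[OF p], rule that)
    let ?N = "unit_normal \<rho>"
    define q where "q = p \<bullet> ?N p"
    have dN: "(?N has_derivative (\<lambda>v. dderiv v ?N p)) (at p)"
      by (rule smooth_on_has_derivative[OF smooth_on_unit_normal[OF c(1)] c(2)])
    have xN: "x = (x \<bullet> ?N x) *\<^sub>R ?N x" if x: "x \<in> U" "\<rho> x = 0" for x
    proof -
      define w where "w = x - (x \<bullet> ?N x) *\<^sub>R ?N x"
      have Nw: "?N x \<bullet> w = 0"
        by (simp add: w_def inner_diff_right unit_normal_norm[OF c(1) x(1)] inner_commute)
      then have "x \<bullet> w = 0" using tang[OF c(1) x] by blast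
      then have "w \<bullet> w = 0" using Nw by (simp add: w_def inner_diff_left)
      then show ?thesis by (simp add: w_def)
    qed
    have pq: "p = q *\<^sub>R ?N p" using xN[OF c(2,3)] by (simp add: q_def)
    have "p \<bullet> p = q ^ 2"
      by (subst (1 2) pq) (simp add: unit_normal_norm[OF c(1,2)] power2_eq_square)
    then have q2: "q ^ 2 = r ^ 2" using Sr[OF p] by (simp add: dot_square_norm)
    obtain v :: "real ^ 'n" where v: "norm v = 1" "?N p \<bullet> v = 0"
      using tangent_exists by blast
    have vv: "v \<bullet> v = 1" using v(1) by (simp add: norm_eq_1)
    have G: "((\<lambda>x. x - (x \<bullet> ?N x) *\<^sub>R ?N x) has_derivative
        (\<lambda>v. v - ((p \<bullet> ?N p) *\<^sub>R dderiv v ?N p + (p \<bullet> dderiv v ?N p + v \<bullet> ?N p) *\<^sub>R ?N p))) (at p)"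
      by (intro has_derivative_diff has_derivative_ident has_derivative_scaleR has_derivative_inner dN)
    have ne: "dderiv (?N p) \<rho> p \<noteq> 0" and tv: "dderiv v \<rho> p = 0"
      using unit_normal_dderiv_pos[OF c(1,2)] v(2) unit_normal_orthogonal_iff[OF c(1,2)] by simp_all
    have G0: "x - (x \<bullet> ?N x) *\<^sub>R ?N x = 0" if "x \<in> U" "\<rho> x = 0" for x
      using xN[OF that] by simp
    have "v - ((p \<bullet> ?N p) *\<^sub>R dderiv v ?N p + (p \<bullet> dderiv v ?N p + v \<bullet> ?N p) *\<^sub>R ?N p) = 0"
      using level_set_tangential_derivative_0[OF chart_open[OF c(1)] chart_smooth[OF c(1)] c(2,3) ne G G0 tv] .
    then have "(v - (q *\<^sub>R dderiv v ?N p + (p \<bullet> dderiv v ?N p + v \<bullet> ?N p) *\<^sub>R ?N p)) \<bullet> v = 0"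
      by (simp add: q_def)
    then have qD: "q * (dderiv v ?N p \<bullet> v) = 1"
      using v(2) by (simp add: inner_diff_left inner_add_left vv)
    have "(ricci_tangential m p - log_slope m p * static_potential m p) * q * (v \<bullet> v) = static_potential m p * (dderiv v ?N p \<bullet> v)"
      using non_generic_umbilicity[OF m dom ng c v(2) v(2)] unfolding q_def .
    then have "(ricci_tangential m p - log_slope m p * static_potential m p) * q ^ 2 = static_potential m p * (q * (dderiv v ?N p \<bullet> v))"
      by (simp add: vv power2_eq_square)
    then show ?thesis using q2 qD by simp
  qed
  ultimately show thesis using that r0 by blast
qed

end

section \<open>Completeness\<close>

lemma metric_norm_schwarzschild:
  fixes x :: "real ^ 'n::finite"
  assumes "m > 0" "CARD('n) \<ge> 3"
  shows "sqrt (metric_ip (schwarzschild_metric m) x v v) = sqrt (conformal_factor m x) * norm v"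
  by (simp add: metric_ip_schwarzschild real_sqrt_mult norm_eq_sqrt_inner)

lemma continuous_on_conformal_factor:
  assumes "m > 0" "CARD('n) \<ge> 3" "A \<subseteq> - {0}"
  shows "continuous_on A (conformal_factor m :: real ^ 'n::finite \<Rightarrow> real)"
proof (rule continuous_at_imp_continuous_on, intro ballI)
  fix x assume "x \<in> A"
  then have "x \<noteq> 0" using assms(3) by auto
  then show "isCont (conformal_factor m) x"
    by (rule has_derivative_continuous[OF has_derivative_conformal_factor[OF assms(1,2)]])
qed

text \<open>The length of a path bounds the variation of every map whose derivative is no larger than the
  metric. If the length is infinite there is nothing to show; otherwise the speed is integrable and
  dominates the derivative of \<open>\<eta> \<circ> c\<close> in the fundamental theorem of calculus.\<close>

lemma variation_le_riem_length:
  fixes \<eta> :: "real ^ 'n::finite \<Rightarrow> 'b::euclidean_space"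
  assumes m: "m > 0" "CARD('n) \<ge> 3" and c: "valid_path c" and A: "path_image c \<subseteq> A" "0 \<notin> A"
    and \<eta>: "\<And>x. x \<in> A \<Longrightarrow> (\<eta> has_derivative \<eta>' x) (at x)"
    and bound: "\<And>x v. x \<in> A \<Longrightarrow> norm (\<eta>' x v) \<le> sqrt (conformal_factor m x) * norm v"
  shows "ennreal (norm (\<eta> (pathfinish c) - \<eta> (pathstart c))) \<le> riem_length (schwarzschild_metric m) c"
proof (cases "riem_length (schwarzschild_metric m) c = top")
  case False
  have c01: "c t \<in> A" if "t \<in> {0..1}" for t
    using A(1) that by (auto simp: path_image_def)
  have cont: "continuous_on {0..1} c"
    using c by (simp add: valid_path_def piecewise_C1_differentiable_on_def)
  obtain T where T: "finite T" "c C1_differentiable_on ({0..1} - T)"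
    using c by (auto simp: valid_path_def piecewise_C1_differentiable_on_def)
  then obtain D where D: "\<And>t. t \<in> {0..1} - T \<Longrightarrow> (c has_vector_derivative D t) (at t)" "continuous_on ({0..1} - T) D"
    unfolding C1_differentiable_on_def by blast
  define sp where "sp t = indicator ({0..1} - T) t *\<^sub>R (sqrt (conformal_factor m (c t)) * norm (D t))" for t
  have "c ` ({0..1} - T) \<subseteq> A" using c01 by auto
  then have "continuous_on (c ` ({0..1} - T)) (conformal_factor m)"
    using A(2) by (intro continuous_on_conformal_factor[OF m]) auto
  then have "continuous_on ({0..1} - T) (\<lambda>t. sqrt (conformal_factor m (c t)) * norm (D t))"
    by (intro continuous_intros D(2) continuous_on_compose2[of _ "conformal_factor m" _ c]
        continuous_on_subset[OF cont]) auto
  then have meas: "sp \<in> borel_measurable borel"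
    unfolding sp_def[abs_def] using T(1)
    by (intro borel_measurable_continuous_on_indicator sets.Diff) (auto intro: borel_closed finite_imp_closed)
  have nonneg: "sp t \<ge> 0" for t
    using conformal_factor_ge_1[OF m, of "c t"] by (simp add: sp_def)
  have "AE t in lborel. t \<notin> T"
    using T(1) by (intro AE_not_in finite_imp_null_set_lborel)
  then have "riem_length (schwarzschild_metric m) c = (\<integral>\<^sup>+ t. ennreal (sp t) \<partial>lborel)"
    unfolding riem_length_def metric_norm_schwarzschild[OF m]
    by (intro nn_integral_cong_AE) (auto elim!: eventually_mono simp: sp_def indicator_def vector_derivative_at[OF D(1)])
  with False obtain r where r: "r \<ge> 0" "(\<integral>\<^sup>+ t. ennreal (sp t) \<partial>lborel) = ennreal r"
    and len: "riem_length (schwarzschild_metric m) c = ennreal r"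
    by (metis ennreal_cases)
  have sp_int: "(sp has_integral r) UNIV"
    by (rule nn_integral_has_integral[OF meas nonneg r(2) r(1)])
  have "((\<lambda>t. \<eta>' (c t) (D t)) has_integral (\<eta> (c 1) - \<eta> (c 0))) {0..1}"
  proof (rule fundamental_theorem_of_calculus_strong[OF T(1)])
    fix t assume t: "t \<in> {0..1::real} - T"
    have "(\<eta> has_derivative \<eta>' (c t)) (at (c t))" using \<eta> c01 t by auto
    from vector_derivative_diff_chain_within[OF D(1)[OF t] has_derivative_at_withinI[OF this]]
    show "((\<lambda>t. \<eta> (c t)) has_vector_derivative \<eta>' (c t) (D t)) (at t)" by (simp add: o_def)
  next
    have "continuous_on A \<eta>"
      by (rule continuous_at_imp_continuous_on) (blast intro: has_derivative_continuous[OF \<eta>])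
    then show "continuous_on {0..1} (\<lambda>t. \<eta> (c t))"
      by (rule continuous_on_compose2[OF _ cont]) (use c01 in auto)
  qed simp
  then have "((\<lambda>t. if t \<in> {0..1} - T then \<eta>' (c t) (D t) else 0) has_integral (\<eta> (c 1) - \<eta> (c 0))) {0..1}"
    by (rule has_integral_spike_finite[OF T(1), rotated]) auto
  then have "((\<lambda>t. if t \<in> {0..1} then if t \<in> {0..1} - T then \<eta>' (c t) (D t) else 0 else 0) has_integral (\<eta> (c 1) - \<eta> (c 0))) UNIV"
    by (simp only: has_integral_restrict_UNIV)
  then have "((\<lambda>t. if t \<in> {0..1} - T then \<eta>' (c t) (D t) else 0) has_integral (\<eta> (c 1) - \<eta> (c 0))) UNIV"
    by (rule has_integral_eq[rotated]) auto
  moreover have "norm (if t \<in> {0..1} - T then \<eta>' (c t) (D t) else 0) \<le> sp t" for t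
    using bound[OF c01] by (auto simp: sp_def)
  ultimately have "norm (\<eta> (c 1) - \<eta> (c 0)) \<le> r"
    using integral_norm_bound_integral[of "\<lambda>t. if t \<in> {0..1} - T then \<eta>' (c t) (D t) else 0" UNIV sp] sp_int
    by (auto simp: integral_unique has_integral_integrable)
  then show ?thesis
    unfolding len pathfinish_def pathstart_def using r(1) by (simp add: ennreal_leI)
qed simp

lemma variation_le_riem_dist:
  fixes \<eta> :: "real ^ 'n::finite \<Rightarrow> 'b::euclidean_space"
  assumes "m > 0" "CARD('n) \<ge> 3" "0 \<notin> A"
    and "\<And>x. x \<in> A \<Longrightarrow> (\<eta> has_derivative \<eta>' x) (at x)"
    and "\<And>x v. x \<in> A \<Longrightarrow> norm (\<eta>' x v) \<le> sqrt (conformal_factor m x) * norm v"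
  shows "ennreal (norm (\<eta> y - \<eta> x)) \<le> riem_dist (schwarzschild_metric m) A x y"
  unfolding riem_dist_def
proof (rule INF_greatest)
  fix c assume "c \<in> {c. valid_path c \<and> path_image c \<subseteq> A \<and> pathstart c = x \<and> pathfinish c = y}"
  then show "ennreal (norm (\<eta> y - \<eta> x)) \<le> riem_length (schwarzschild_metric m) c"
    using variation_le_riem_length[OF assms(1,2) _ _ assms(3-5), of c] by auto
qed

lemma euclid_dist_le_riem_dist:
  fixes x y :: "real ^ 'n::finite"
  assumes m: "m > 0" "CARD('n) \<ge> 3" and "0 \<notin> A"
  shows "ennreal (norm (y - x)) \<le> riem_dist (schwarzschild_metric m) A x y"
proof (rule variation_le_riem_dist[OF assms, of "\<lambda>x. x" "\<lambda>_ v. v"])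
  fix x v :: "real ^ 'n"
  show "norm v \<le> sqrt (conformal_factor m x) * norm v"
    using conformal_factor_ge_1[OF m, of x] by (simp add: mult_le_cancel_right1)
qed simp

text \<open>The origin is infinitely far away, because near it the conformal factor dominates that of the
  inversion: the metric is at least \<open>K\<^sup>2 / r\<^sup>4\<close> times the Euclidean one.\<close>

lemma conformal_factor_inversion_bound:
  fixes x :: "real ^ 'n::finite"
  assumes m: "m > 0" "CARD('n) \<ge> 3" and "x \<noteq> 0"
  shows "(m / 2) powr (2 / (real CARD('n) - 2)) / (norm x) ^ 2 \<le> sqrt (conformal_factor m x)"
proof -
  define a where "a = 2 / (real CARD('n) - 2)"
  have n2: "real (CARD('n) - 2) = real CARD('n) - 2" using m(2) by simp
  have a0: "a \<ge> 0" using m(2) by (simp add: a_def)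
  have gen: "k * (2 / k) = 2" if "k \<noteq> 0" for k :: real using that by simp
  have "real CARD('n) - 2 \<noteq> 0" using m(2) by simp
  then have an: "real (CARD('n) - 2) * a = 2" unfolding n2 a_def by (rule gen)
  have r: "norm x > 0" using assms(3) by simp
  have "norm x ^ 2 = norm x powr (real (CARD('n) - 2) * a)"
    unfolding an using r by simp
  also have "\<dots> = (norm x ^ (CARD('n) - 2)) powr a"
    using r by (simp only: powr_powr[symmetric] powr_realpow)
  finally have "(m / 2) powr a / (norm x) ^ 2 = (m / 2) powr a / (norm x ^ (CARD('n) - 2)) powr a"
    by simp
  also have "\<dots> = (m / 2 / norm x ^ (CARD('n) - 2)) powr a"
    by (rule powr_divide[symmetric])
  also have "\<dots> = mass_ratio m x powr a"
    by (simp add: mass_ratio_def)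
  also have "\<dots> \<le> (1 + mass_ratio m x) powr a"
    using mass_ratio_nonneg[OF m(1), of x] by (intro powr_mono2 a0) auto
  also have "\<dots> = sqrt (conformal_factor m x)"
  proof -
    have "4 / (real CARD('n) - 2) = a * 2" by (simp add: a_def)
    then have "conformal_factor m x = ((1 + mass_ratio m x) powr a) ^ 2"
      using one_plus_mass_ratio_pos[OF m(1), of x] unfolding conformal_factor_def
      by (simp add: powr_powr[symmetric])
    then show ?thesis by simp
  qed
  finally show ?thesis by (simp add: a_def)
qed

lemma inverse_radius_le_riem_dist:
  fixes x y :: "real ^ 'n::finite"
  assumes m: "m > 0" "CARD('n) \<ge> 3" and "0 \<notin> A"
  defines "K \<equiv> (m / 2) powr (2 / (real CARD('n) - 2))"
  shows "ennreal \<bar>K / norm y - K / norm x\<bar> \<le> riem_dist (schwarzschild_metric m) A x y"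
proof -
  have K: "K > 0" using m(1) by (simp add: K_def)
  have "ennreal (norm (K / norm y - K / norm x)) \<le> riem_dist (schwarzschild_metric m) A x y"
  proof (rule variation_le_riem_dist[OF m assms(3), of "\<lambda>x. K / norm x" "\<lambda>x v. - (K / (norm x) ^ 2) * (sgn x \<bullet> v)"])
    fix x :: "real ^ 'n" assume "x \<in> A"
    then have x: "x \<noteq> 0" using assms(3) by auto
    define N :: "real ^ 'n \<Rightarrow> real" where "N = norm"
    have N: "(N has_derivative (\<lambda>v. sgn x \<bullet> v)) (at x)"
      unfolding N_def using has_derivative_norm[OF x] by (simp add: inner_commute)
    have "((\<lambda>x. K / N x) has_derivative (\<lambda>v. - (K / (norm x) ^ 2) * (sgn x \<bullet> v))) (at x)"
      apply (rule has_derivative_eq_rhs)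
       apply (rule derivative_intros N)+
      using x apply (simp add: N_def)
      by (simp add: N_def fun_eq_iff power2_eq_square divide_inverse mult_ac)
    then show "((\<lambda>x. K / norm x) has_derivative (\<lambda>v. - (K / (norm x) ^ 2) * (sgn x \<bullet> v))) (at x)"
      by (simp only: N_def)
    fix v
    have "norm (- (K / (norm x) ^ 2) * (sgn x \<bullet> v)) = K / (norm x) ^ 2 * \<bar>sgn x \<bullet> v\<bar>"
      using K by (simp add: abs_mult)
    also have "\<dots> \<le> K / (norm x) ^ 2 * norm v"
      using Cauchy_Schwarz_ineq2[of "sgn x" v] x K by (intro mult_left_mono) (simp_all add: norm_sgn)
    also have "\<dots> \<le> sqrt (conformal_factor m x) * norm v"
      unfolding K_def by (intro mult_right_mono conformal_factor_inversion_bound m x) simp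
    finally show "norm (- (K / (norm x) ^ 2) * (sgn x \<bullet> v)) \<le> sqrt (conformal_factor m x) * norm v" .
  qed
  then show ?thesis by simp
qed

text \<open>A Cauchy sequence converges in the Euclidean sense, to a nonzero limit because \<open>1 / r\<close> stays bounded
  along it. Near the limit, segments stay in the convex set and have small length.\<close>

lemma riem_complete_convex:
  fixes C :: "(real ^ 'n::finite) set"
  assumes m: "m > 0" "CARD('n) \<ge> 3" and C: "closed C" "convex C"
  shows "riem_complete (schwarzschild_metric m) (C - {0})"
  unfolding riem_complete_def
proof (intro allI impI)
  fix s :: "nat \<Rightarrow> real ^ 'n"
  let ?d = "riem_dist (schwarzschild_metric m) (C - {0})"
  assume "(\<forall>i. s i \<in> C - {0}) \<and> (\<forall>e>0. \<exists>N. \<forall>i\<ge>N. \<forall>j\<ge>N. ?d (s i) (s j) < e)"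
  then have s: "\<And>i. s i \<in> C" "\<And>i. s i \<noteq> 0"
    and cauchy: "\<And>e. e > 0 \<Longrightarrow> \<exists>N. \<forall>i\<ge>N. \<forall>j\<ge>N. ?d (s i) (s j) < e"
    by auto
  have "Cauchy s"
  proof (rule CauchyI)
    fix e :: real assume "e > 0"
    then obtain N where N: "\<And>i j. i \<ge> N \<Longrightarrow> j \<ge> N \<Longrightarrow> ?d (s i) (s j) < ennreal e"
      using cauchy[of "ennreal e"] by auto
    have "norm (s i - s j) < e" if "i \<ge> N" "j \<ge> N" for i j
      using le_less_trans[OF euclid_dist_le_riem_dist[OF m] N[OF that(2,1)]] \<open>e > 0\<close>
      by (simp add: ennreal_less_iff)
    then show "\<exists>N. \<forall>i\<ge>N. \<forall>j\<ge>N. norm (s i - s j) < e" by blast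
  qed
  then obtain x where x: "s \<longlonglongrightarrow> x"
    using Cauchy_convergent convergent_def by blast
  then have xC: "x \<in> C"
    using closed_sequentially[OF C(1)] s(1) by blast
  define K where "K = (m / 2) powr (2 / (real CARD('n) - 2))"
  have K: "K > 0" using m(1) by (simp add: K_def)
  obtain N where N: "\<And>i j. i \<ge> N \<Longrightarrow> j \<ge> N \<Longrightarrow> ?d (s i) (s j) < 1"
    using cauchy[of 1] by auto
  define L where "L = K / norm (s N) + 1"
  have L: "L > 0" using K s(2)[of N] by (simp add: L_def add_nonneg_pos)
  have "K / L \<le> norm (s i)" if "i \<ge> N" for i
  proof -
    have "ennreal \<bar>K / norm (s i) - K / norm (s N)\<bar> < ennreal 1"
      using le_less_trans[OF inverse_radius_le_riem_dist[OF m, of "C - {0}" "s i" "s N"] N[of N i]] that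
      by (simp add: K_def)
    then have "\<bar>K / norm (s i) - K / norm (s N)\<bar> < 1"
      by (subst (asm) ennreal_less_iff) auto
    then have "K / norm (s i) \<le> L" by (simp add: L_def)
    then show ?thesis using s(2)[of i] L by (simp add: field_simps)
  qed
  then have "K / L \<le> norm x"
    by (intro LIMSEQ_le_const[OF tendsto_norm[OF x]]) blast
  then have "norm x > 0" using divide_pos_pos[OF K L] by linarith
  then have x0: "x \<noteq> 0" by simp
  let ?B = "cball x (norm x / 2)"
  have B0: "0 \<notin> ?B" using x0 by simp
  have "continuous_on ?B (\<lambda>y. sqrt (conformal_factor m y))"
    by (intro continuous_intros continuous_on_conformal_factor[OF m]) (use B0 in auto)
  then have "compact ((\<lambda>y. sqrt (conformal_factor m y)) ` ?B)"
    by (rule compact_continuous_image) simp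
  then obtain b where b: "\<And>y. y \<in> ?B \<Longrightarrow> sqrt (conformal_factor m y) \<le> b"
    using compact_imp_bounded bounded_imp_bdd_above by (metis bdd_above.E image_eqI)
  have near: "?d y x \<le> ennreal (b * norm (x - y))" if y: "y \<in> C" "y \<in> ?B" for y
  proof -
    let ?c = "linepath y x"
    have seg: "closed_segment y x \<subseteq> C \<inter> ?B"
      using y xC C(2) by (intro closed_segment_subset convex_Int) auto
    have im: "?c t \<in> ?B" if "t \<in> {0..1}" for t
      using seg that linepath_in_path by blast
    have "?d y x \<le> riem_length (schwarzschild_metric m) ?c"
      unfolding riem_dist_def by (rule INF_lower) (use seg B0 in auto)
    also have "\<dots> \<le> (\<integral>\<^sup>+ t\<in>{0..1::real}. ennreal (b * norm (x - y)) \<partial>lborel)"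
      unfolding riem_length_def metric_norm_schwarzschild[OF m] vector_derivative_linepath_at
      by (intro nn_integral_mono) (use b im in \<open>auto simp: indicator_def intro!: ennreal_leI mult_right_mono\<close>)
    also have "\<dots> = ennreal (b * norm (x - y))"
      by (simp add: nn_integral_cmult_indicator)
    finally show ?thesis .
  qed
  have "\<forall>\<^sub>F i in sequentially. s i \<in> ball x (norm x / 2)"
    by (rule topological_tendstoD[OF x]) (use x0 in auto)
  then have "\<forall>\<^sub>F i in sequentially. ?d (s i) x \<le> ennreal (b * norm (x - s i))"
    by (rule eventually_mono) (use near s(1) in auto)
  moreover have "(\<lambda>i. b * norm (x - s i)) \<longlonglongrightarrow> b * norm (x - x)"
    by (intro tendsto_intros x)
  then have "(\<lambda>i. ennreal (b * norm (x - s i))) \<longlonglongrightarrow> ennreal 0"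
    by (intro tendsto_ennrealI) simp
  ultimately have "(\<lambda>i. ?d (s i) x) \<longlonglongrightarrow> 0"
    by (intro tendsto_sandwich[of "\<lambda>_. 0" "\<lambda>i. ?d (s i) x" sequentially "\<lambda>i. ennreal (b * norm (x - s i))"]) auto
  then show "\<exists>x\<in>C - {0}. (\<lambda>i. ?d (s i) x) \<longlonglongrightarrow> 0"
    using xC x0 by blast
qed

section \<open>Spheres and hyperplanes\<close>

lemma power_eq_iff_powr:
  fixes r y :: real
  assumes "r > 0" "y > 0" "k > 0"
  shows "r ^ k = y \<longleftrightarrow> r = y powr (1 / real k)"
proof
  assume "r ^ k = y"
  then have "y powr (1 / real k) = (r powr real k) powr (1 / real k)"
    using assms(1) by (simp add: powr_realpow)
  then show "r = y powr (1 / real k)"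
    using assms by (simp add: powr_powr)
next
  assume "r = y powr (1 / real k)"
  then have "r ^ k = (y powr (1 / real k)) powr real k"
    using assms by (simp flip: powr_realpow)
  then show "r ^ k = y"
    using assms by (simp add: powr_powr)
qed

text \<open>The boundary equation for a centred sphere is a quadratic equation for the mass ratio \<open>s\<close>. Its
  roots \<open>n - 1 \<plusminus> sqrt (n\<^sup>2 - 2n)\<close> are inverse to each other, which exchanges the signs in the radii.\<close>

lemma schwarzschild_radius_iff:
  fixes p :: "real ^ 'n::finite"
  assumes m: "m > 0" "CARD('n) \<ge> 3" and r: "r > 0" "norm p = r"
  shows "(ricci_tangential m p - log_slope m p * static_potential m p) * r ^ 2 = static_potential m p
    \<longleftrightarrow> r = schwarzschild_radius_plus CARD('n) m \<or> r = schwarzschild_radius_minus CARD('n) m"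
proof -
  define n s d where "n = real CARD('n)" and "s = mass_ratio m p" and "d = sqrt (n ^ 2 - 2 * n)"
  have n3: "n \<ge> 3" using m(2) by (simp add: n_def)
  have p0: "p \<noteq> 0" using r by auto
  have s0: "s > 0" using mass_ratio_pos[OF m(1) p0] by (simp add: s_def)
  have pp: "p \<bullet> p = r ^ 2" using r(2) by (simp add: dot_square_norm)
  have d2: "d ^ 2 = n ^ 2 - 2 * n"
    using n3 mult_right_mono[of 2 n n] by (simp add: d_def power2_eq_square)
  have d0: "d \<ge> 0" using n3 mult_right_mono[of 2 n n] by (simp add: d_def power2_eq_square)
  have dn: "d < n - 1"
    by (rule power2_less_imp_less) (use d2 n3 in \<open>simp_all add: power2_eq_square algebra_simps\<close>)
  have prod: "(n - 1 + d) * (n - 1 - d) = 1"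
    using d2 by (simp add: algebra_simps power2_eq_square)
  have R: "ricci_tangential m p * r ^ 2 = 2 * (n - 2) * s / (1 + s) ^ 2"
    using r by (simp add: ricci_tangential_def pp n_def s_def)
  have l: "log_slope m p * r ^ 2 = - 2 * s / (1 + s)"
    using r by (simp add: log_slope_def pp s_def)
  have u: "static_potential m p = (1 - s) / (1 + s)"
    by (simp add: static_potential_def s_def)
  have inv: "s = x \<longleftrightarrow> 1 / s = y" if "x * y = 1" for x y
  proof -
    have "y \<noteq> 0" using that by auto
    then have "s = x \<longleftrightarrow> s * y = 1" using that by (metis mult_right_cancel)
    also have "\<dots> \<longleftrightarrow> 1 / s = y" using s0 by (auto simp: field_simps)
    finally show ?thesis .
  qed
  have "(ricci_tangential m p - log_slope m p * static_potential m p) * r ^ 2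
     = ricci_tangential m p * r ^ 2 - (log_slope m p * r ^ 2) * static_potential m p"
    by (simp add: left_diff_distrib)
  also have "\<dots> = (2 * (n - 2) * s + 2 * s * (1 - s)) / (1 + s) ^ 2"
    unfolding R l u by (simp add: power2_eq_square add_divide_distrib)
  finally have eq: "(ricci_tangential m p - log_slope m p * static_potential m p) * r ^ 2
     = (2 * (n - 2) * s + 2 * s * (1 - s)) / (1 + s) ^ 2" .
  have u': "static_potential m p = (1 - s) * (1 + s) / (1 + s) ^ 2"
    unfolding u using s0 by (simp add: power2_eq_square)
  have "(ricci_tangential m p - log_slope m p * static_potential m p) * r ^ 2 = static_potential m p
    \<longleftrightarrow> 2 * (n - 2) * s + 2 * s * (1 - s) = (1 - s) * (1 + s)"
    unfolding eq unfolding u' using s0 by simp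
  also have "\<dots> \<longleftrightarrow> (s - (n - 1 + d)) * (s - (n - 1 - d)) = 0"
    using prod by (auto simp: algebra_simps)
  also have "\<dots> \<longleftrightarrow> s = n - 1 - d \<or> s = n - 1 + d" by auto
  also have "s = n - 1 - d \<longleftrightarrow> 1 / s = n - 1 + d"
    by (rule inv) (use prod in \<open>simp add: mult.commute\<close>)
  also have "s = n - 1 + d \<longleftrightarrow> 1 / s = n - 1 - d"
    by (rule inv[OF prod])
  finally have 1: "(ricci_tangential m p - log_slope m p * static_potential m p) * r ^ 2 = static_potential m p
    \<longleftrightarrow> 1 / s = n - 1 + d \<or> 1 / s = n - 1 - d" .
  have 2: "1 / s = y \<longleftrightarrow> r = (y / 2 * m) powr (1 / (n - 2))" if "y > 0" for y
  proof -
    have k: "CARD('n) - 2 > 0" "real (CARD('n) - 2) = n - 2" using m(2) by (auto simp: n_def)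
    have "1 / s = y \<longleftrightarrow> r ^ (CARD('n) - 2) = y / 2 * m"
      using m(1) by (auto simp: s_def mass_ratio_def r(2) field_simps)
    also have "\<dots> \<longleftrightarrow> r = (y / 2 * m) powr (1 / (n - 2))"
      using power_eq_iff_powr[OF r(1) _ k(1), of "y / 2 * m"] that m(1) by (simp add: k(2))
    finally show ?thesis .
  qed
  show ?thesis
    unfolding 1 schwarzschild_radius_plus_def schwarzschild_radius_minus_def n_def[symmetric] d_def[symmetric]
    using 2[of "n - 1 + d"] 2[of "n - 1 - d"] dn d0 by simp
qed

lemma schwarzschild_radii_pos:
  assumes "m > 0" "n \<ge> 3"
  shows "schwarzschild_radius_plus n m > 0" "schwarzschild_radius_minus n m > 0"
proof -
  define d where "d = sqrt (real n ^ 2 - 2 * real n)"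
  have "d < real n - 1"
    unfolding d_def by (rule real_less_lsqrt) (use assms(2) in \<open>simp_all add: power2_eq_square algebra_simps\<close>)
  moreover have "d \<ge> 0"
    using assms(2) mult_right_mono[of 2 "real n" "real n"] by (simp add: d_def power2_eq_square)
  ultimately have "real n - 1 + d > 0" "real n - 1 - d > 0"
    using assms(2) by auto
  then have "(real n - 1 + d) / 2 * m > 0" "(real n - 1 - d) / 2 * m > 0"
    using assms(1) by simp_all
  then have "((real n - 1 + d) / 2 * m) powr (1 / (real n - 2)) > 0" "((real n - 1 - d) / 2 * m) powr (1 / (real n - 2)) > 0"
    by (simp_all only: powr_gt_zero)
  then show "schwarzschild_radius_plus n m > 0" "schwarzschild_radius_minus n m > 0"
    by (simp_all only: schwarzschild_radius_plus_def schwarzschild_radius_minus_def d_def)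
qed

text \<open>Both examples have a defining function on all of space without the origin and a convex closure.\<close>

context
  fixes m :: real and \<Omega> :: "(real ^ 'n::finite) set" and \<rho> :: "real ^ 'n \<Rightarrow> real"
  assumes m: "m > 0" "CARD('n) \<ge> 3"
    and chart: "boundary_chart \<Omega> (- {0}) \<rho>" and \<Omega>: "open \<Omega>" "0 \<notin> \<Omega>" "\<Omega> \<noteq> {}"
begin

lemma global_chart_frontier: "x \<noteq> 0 \<Longrightarrow> x \<in> frontier \<Omega> \<longleftrightarrow> \<rho> x = 0"
  by (rule chart_frontier_iff[OF chart \<Omega>(1)]) simp

lemma global_chart_riem_domain:
  assumes "connected \<Omega>" "closed C" "convex C" "\<And>x. x \<noteq> 0 \<Longrightarrow> x \<in> C \<longleftrightarrow> \<rho> x \<le> 0"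
    and S: "S \<noteq> {}" "S = {x. x \<noteq> 0 \<and> \<rho> x = 0}"
  shows "riem_domain schwarzschild_space (schwarzschild_metric m) \<Omega> S"
proof -
  have "closure_in schwarzschild_space \<Omega> = C - {0}"
  proof (rule set_eqI)
    fix x :: "real ^ 'n"
    show "x \<in> closure_in schwarzschild_space \<Omega> \<longleftrightarrow> x \<in> C - {0}"
    proof (cases "x = 0")
      case False
      have "x \<in> closure \<Omega> \<longleftrightarrow> x \<in> \<Omega> \<or> x \<in> frontier \<Omega>"
        using \<Omega>(1) closure_subset[of \<Omega>] by (auto simp: frontier_def interior_open)
      also have "\<dots> \<longleftrightarrow> \<rho> x \<le> 0"
        using chart_iff[OF chart, of x] global_chart_frontier[OF False] False by auto
      finally show ?thesis
        using assms(4)[OF False] False by (simp add: closure_in_def schwarzschild_space_def)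
    qed (simp add: closure_in_def schwarzschild_space_def)
  qed
  moreover have "S = boundary_in schwarzschild_space \<Omega>"
    using global_chart_frontier S(2) by (auto simp: boundary_in_def schwarzschild_space_def)
  moreover have "\<Omega> \<subseteq> schwarzschild_space"
    using \<Omega>(2) by (auto simp: schwarzschild_space_def)
  moreover have "\<exists>\<rho>. defining_function schwarzschild_space \<Omega> p \<rho>" if "p \<in> S" for p
    unfolding defining_function_iff_chart using that chart S(2) by blast
  ultimately show ?thesis
    unfolding riem_domain_def using \<Omega> assms(1) S(1) riem_complete_convex[OF m assms(2,3)] by simp
qed

text \<open>The static potential itself is the function \<open>u\<close>, so only the umbilicity equation is left to check.\<close>

lemma global_chart_non_generic:
  assumes S: "S = {x. x \<noteq> 0 \<and> \<rho> x = 0}"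
    and eq: "\<And>p a b. p \<in> S \<Longrightarrow> unit_normal \<rho> p \<bullet> a = 0 \<Longrightarrow> unit_normal \<rho> p \<bullet> b = 0 \<Longrightarrow>
      (ricci_tangential m p - log_slope m p * static_potential m p) * (p \<bullet> unit_normal \<rho> p) * (a \<bullet> b)
       = static_potential m p * (dderiv a (unit_normal \<rho>) p \<bullet> b)"
  shows "non_generic schwarzschild_space (schwarzschild_metric m) \<Omega> S"
  unfolding non_generic_def
proof (intro exI[of _ "static_potential m"] conjI ballI allI impI)
  show "smooth_on_subset (closure_in schwarzschild_space \<Omega>) (static_potential m)"
    unfolding smooth_on_subset_def
    using smooth_on_static_potential[OF m(1)]
    by (intro ballI exI[of _ "- {0}"] exI[of _ "static_potential m"]) (auto simp: closure_in_def schwarzschild_space_def)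
  show "\<exists>x\<in>closure_in schwarzschild_space \<Omega>. static_potential m x \<noteq> 0"
  proof (rule ccontr)
    assume "\<not> ?thesis"
    then have z: "static_potential m x = 0" if "x \<in> \<Omega>" for x
      using that \<Omega>(2) closure_subset[of \<Omega>] by (auto simp: closure_in_def schwarzschild_space_def)
    obtain x where x: "x \<in> \<Omega>" using \<Omega>(3) by blast
    then have x0: "x \<noteq> 0" using \<Omega>(2) by auto
    have "(static_potential m has_derivative (\<lambda>v. 0)) (at x)"
      by (rule has_derivative_transform_within_open[OF has_derivative_const \<Omega>(1) x]) (simp add: z)
    from fun_cong[OF has_derivative_unique[OF this has_derivative_static_potential[OF m x0]], of x]
    show False using ricci_tangential_pos[OF m x0] x0 by simp
  qed
  show "Lstar (schwarzschild_metric m) (static_potential m) x = 0" if "x \<in> \<Omega>" for x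
    using that \<Omega>(2) by (intro Lstar_static_potential[OF m]) auto
next
  fix p V X Y
  assume p: "p \<in> S" and V: "open V \<and> p \<in> V \<and> V \<subseteq> schwarzschild_space \<and>
             boundary_tangent_field schwarzschild_space \<Omega> V X \<and> boundary_tangent_field schwarzschild_space \<Omega> V Y"
  have pU: "p \<in> - {0}" "\<rho> p = 0" using p S by auto
  have "unit_normal \<rho> p \<bullet> Z p = 0" if "boundary_tangent_field schwarzschild_space \<Omega> V Z" for Z
    using that V global_chart_frontier[of p] pU boundary_tangent_space_eq[OF chart pU]
    by (auto simp: boundary_tangent_field_def boundary_in_def schwarzschild_space_def)
  then have "unit_normal \<rho> p \<bullet> X p = 0" "unit_normal \<rho> p \<bullet> Y p = 0" using V by auto
  note e = eq[OF p this]
  have b: "normal_deriv schwarzschild_space (schwarzschild_metric m) \<Omega> (static_potential m) p * metric_ip (schwarzschild_metric m) p (X p) (Y p)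
      = static_potential m p * second_fundamental_form schwarzschild_space (schwarzschild_metric m) \<Omega> X Y p \<longleftrightarrow>
      (ricci_tangential m p - log_slope m p * static_potential m p) * (p \<bullet> unit_normal \<rho> p) * (X p \<bullet> Y p)
       = static_potential m p * (dderiv (X p) (unit_normal \<rho>) p \<bullet> Y p)"
    by (rule boundary_condition_iff[OF m chart pU \<Omega>(1,2), of "static_potential m" 1 V]) (use V in auto)
  show "normal_deriv schwarzschild_space (schwarzschild_metric m) \<Omega> (static_potential m) p * metric_ip (schwarzschild_metric m) p (X p) (Y p)
      = static_potential m p * second_fundamental_form schwarzschild_space (schwarzschild_metric m) \<Omega> X Y p"
    unfolding b by (rule e)
qed

end

text \<open>The punctured ball is used rather than the exterior of the sphere because its closure is convex up to
  the origin.\<close>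

lemma sphere_non_generic:
  assumes m: "m > 0" "CARD('n::finite) \<ge> 3" and r: "r > 0"
    and eq: "r = schwarzschild_radius_plus CARD('n) m \<or> r = schwarzschild_radius_minus CARD('n) m"
  defines "\<Omega> \<equiv> ball 0 r - {0 :: real ^ 'n}"
  shows "riem_domain schwarzschild_space (schwarzschild_metric m) \<Omega> (sphere 0 r)"
    "non_generic schwarzschild_space (schwarzschild_metric m) \<Omega> (sphere 0 r)"
proof -
  define \<rho> where "\<rho> x = x \<bullet> x - r ^ 2" for x :: "real ^ 'n"
  have d\<rho>: "(\<rho> has_derivative (\<lambda>v. 2 * (x \<bullet> v))) (at x)" for x
    unfolding \<rho>_def[abs_def]
    by (rule has_derivative_eq_rhs[OF has_derivative_diff[OF has_derivative_radial_inner has_derivative_const]]) simp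
  have \<rho>: "\<rho> x < 0 \<longleftrightarrow> norm x < r" "\<rho> x = 0 \<longleftrightarrow> norm x = r" for x
  proof -
    have "norm x ^ 2 < r ^ 2 \<longleftrightarrow> norm x < r"
      using r by (auto intro: power_less_imp_less_base power_strict_mono)
    then show "\<rho> x < 0 \<longleftrightarrow> norm x < r" "\<rho> x = 0 \<longleftrightarrow> norm x = r"
      using r by (simp_all add: \<rho>_def dot_square_norm power_eq_iff_eq_base)
  qed
  have ne: "\<Omega> \<noteq> {}"
  proof -
    obtain x :: "real ^ 'n" where "norm x = r / 2"
      using vector_choose_size[of "r / 2"] r by auto
    then have "x \<in> \<Omega>" using r by (auto simp: \<Omega>_def)
    then show ?thesis by blast
  qed
  have chart: "boundary_chart \<Omega> (- {0}) \<rho>"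
    unfolding boundary_chart_def
  proof (intro conjI ballI)
    show "smooth_on (- {0}) \<rho>"
      unfolding \<rho>_def[abs_def] by (intro smooth_intros open_Compl closed_singleton)
    show "frechet_derivative \<rho> (at x) \<noteq> (\<lambda>v. 0)" if "x \<in> - {0}" for x
    proof
      assume "frechet_derivative \<rho> (at x) = (\<lambda>v. 0)"
      then have "2 * (x \<bullet> x) = 0" using dderiv_eqI[OF d\<rho>, of x x] by simp
      then show False using that by simp
    qed
    show "- {0} \<inter> \<Omega> = {x \<in> - {0}. \<rho> x < 0}"
      by (auto simp: \<rho> \<Omega>_def)
  qed (auto simp: open_Compl)
  have S: "sphere 0 r = {x. x \<noteq> 0 \<and> \<rho> x = 0}" using r by (auto simp: \<rho>)
  have \<Omega>: "open \<Omega>" "0 \<notin> \<Omega>" by (auto simp: \<Omega>_def open_delete)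
  show "riem_domain schwarzschild_space (schwarzschild_metric m) \<Omega> (sphere 0 r)"
  proof (rule global_chart_riem_domain[OF m chart \<Omega> ne, of "cball 0 r"])
    show "connected \<Omega>"
      unfolding \<Omega>_def using aff_dim_open[of "ball (0 :: real ^ 'n) r"] m(2) r
      by (intro path_connected_imp_connected path_connected_punctured_convex convex_ball) auto
    show "x \<in> cball 0 r \<longleftrightarrow> \<rho> x \<le> 0" for x :: "real ^ 'n"
      using \<rho>[of x] by (auto simp: order_le_less)
    show "sphere (0 :: real ^ 'n) r \<noteq> {}" using r by simp
  qed (simp_all add: S)
  show "non_generic schwarzschild_space (schwarzschild_metric m) \<Omega> (sphere 0 r)"
  proof (rule global_chart_non_generic[OF m chart \<Omega> ne S])
    fix p a b assume p: "p \<in> sphere 0 r" and a: "unit_normal \<rho> p \<bullet> a = 0"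
    have N: "unit_normal \<rho> x = (1 / r) *\<^sub>R x" if "x \<in> - {0}" "\<rho> x = 0" for x
    proof -
      have "\<forall>v. gradient \<rho> x \<bullet> v = (2 *\<^sub>R x) \<bullet> v"
        using chart_gradient_inner[OF chart that(1)] dderiv_eqI[OF d\<rho>] by simp
      then have g: "gradient \<rho> x = 2 *\<^sub>R x" by (rule vector_eq_rdot[THEN iffD1])
      have "norm x = r" using that(2) \<rho>(2)[of x] by blast
      then have "unit_normal \<rho> x = (inverse (2 * r) * 2) *\<^sub>R x"
        unfolding unit_normal_eq[OF chart that(1)] g by simp
      moreover have "inverse (2 * r) * 2 = 1 / r"
        using r by (simp add: field_simps)
      ultimately show ?thesis by (simp only:)
    qed
    have pU: "p \<in> - {0}" "\<rho> p = 0" using p S by auto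
    have d: "((\<lambda>x. unit_normal \<rho> x - (1 / r) *\<^sub>R x) has_derivative (\<lambda>v. dderiv v (unit_normal \<rho>) p - (1 / r) *\<^sub>R v)) (at p)"
      by (intro has_derivative_diff has_derivative_scaleR_right has_derivative_ident
          smooth_on_has_derivative[OF smooth_on_unit_normal[OF chart] pU(1)])
    have ne: "dderiv (unit_normal \<rho> p) \<rho> p \<noteq> 0" and ta: "dderiv a \<rho> p = 0"
      using unit_normal_dderiv_pos[OF chart pU(1)] a unit_normal_orthogonal_iff[OF chart pU(1)] by simp_all
    have N0: "unit_normal \<rho> x - (1 / r) *\<^sub>R x = 0" if "x \<in> - {0}" "\<rho> x = 0" for x
      using N[OF that] by simp
    have "dderiv a (unit_normal \<rho>) p - (1 / r) *\<^sub>R a = 0"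
      using level_set_tangential_derivative_0[OF chart_open[OF chart] chart_smooth[OF chart] pU ne d N0 ta] .
    then have D: "dderiv a (unit_normal \<rho>) p = (1 / r) *\<^sub>R a" by simp
    have q: "p \<bullet> unit_normal \<rho> p = r"
    proof -
      have "norm p = r" using p by simp
      then show ?thesis unfolding N[OF pU] inner_scaleR_right dot_square_norm using r by (simp add: power2_eq_square)
    qed
    have "(ricci_tangential m p - log_slope m p * static_potential m p) * r ^ 2 = static_potential m p"
      using schwarzschild_radius_iff[OF m r, of p] p eq by simp
    then have "(ricci_tangential m p - log_slope m p * static_potential m p) * r * r = static_potential m p"
      by (simp only: power2_eq_square mult.assoc)
    then have "(ricci_tangential m p - log_slope m p * static_potential m p) * r = static_potential m p / r"
      using r by (intro nonzero_eq_divide_eq[THEN iffD2]) auto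
    then show "(ricci_tangential m p - log_slope m p * static_potential m p) * (p \<bullet> unit_normal \<rho> p) * (a \<bullet> b)
       = static_potential m p * (dderiv a (unit_normal \<rho>) p \<bullet> b)"
      unfolding D q by simp
  qed
qed

lemma connected_punctured_hyperplane:
  fixes a :: "'a::euclidean_space"
  assumes "a \<noteq> 0" "DIM('a) \<ge> 3"
  shows "connected ({x. a \<bullet> x = 0} - {0})"
  using assms aff_dim_hyperplane[OF assms(1), of 0]
  by (intro path_connected_imp_connected path_connected_punctured_convex convex_hyperplane) simp

text \<open>Both sides of the umbilicity equation vanish: \<open>x \<bullet> N = 0\<close> and \<open>N\<close> is constant.\<close>

lemma hyperplane_non_generic:
  fixes a :: "real ^ 'n::finite"
  assumes m: "m > 0" "CARD('n) \<ge> 3" and a: "a \<noteq> 0"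
  defines "\<Omega> \<equiv> {x. a \<bullet> x < 0}" and "S \<equiv> {x. a \<bullet> x = 0} - {0}"
  shows "riem_domain schwarzschild_space (schwarzschild_metric m) \<Omega> S"
    "non_generic schwarzschild_space (schwarzschild_metric m) \<Omega> S"
proof -
  define \<rho> where "\<rho> x = a \<bullet> x" for x
  have d\<rho>: "(\<rho> has_derivative (\<lambda>v. a \<bullet> v)) (at x)" for x
    unfolding \<rho>_def[abs_def] by (intro has_derivative_inner_right has_derivative_ident)
  have chart: "boundary_chart \<Omega> (- {0}) \<rho>"
    unfolding boundary_chart_def
  proof (intro conjI ballI)
    show "smooth_on (- {0}) \<rho>"
      unfolding \<rho>_def[abs_def] by (intro smooth_intros open_Compl closed_singleton)
    show "frechet_derivative \<rho> (at x) \<noteq> (\<lambda>v. 0)" for x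
    proof
      assume "frechet_derivative \<rho> (at x) = (\<lambda>v. 0)"
      then have "a \<bullet> a = 0" using dderiv_eqI[OF d\<rho>, of x a] by simp
      then show False using a by simp
    qed
    show "- {0} \<inter> \<Omega> = {x \<in> - {0}. \<rho> x < 0}"
      by (auto simp: \<rho>_def \<Omega>_def)
  qed (auto simp: open_Compl)
  have S: "S = {x. x \<noteq> 0 \<and> \<rho> x = 0}" by (auto simp: S_def \<rho>_def)
  have \<Omega>: "open \<Omega>" "0 \<notin> \<Omega>" by (auto simp: \<Omega>_def open_halfspace_lt)
  have "- a \<in> \<Omega>" using a by (simp add: \<Omega>_def)
  then have ne: "\<Omega> \<noteq> {}" by blast
  obtain e where e: "norm e = 1" "e \<bullet> a = 0"
    using unit_orthogonal_to_two[of a a] m(2) by auto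
  show "riem_domain schwarzschild_space (schwarzschild_metric m) \<Omega> S"
  proof (rule global_chart_riem_domain[OF m chart \<Omega> ne, of "{x. a \<bullet> x \<le> 0}"])
    show "connected \<Omega>"
      unfolding \<Omega>_def by (intro convex_connected convex_halfspace_lt)
    have "e \<in> S" using e by (auto simp: S_def inner_commute)
    then show "S \<noteq> {}" by blast
  qed (simp_all add: S \<rho>_def closed_halfspace_le convex_halfspace_le)
  show "non_generic schwarzschild_space (schwarzschild_metric m) \<Omega> S"
  proof (rule global_chart_non_generic[OF m chart \<Omega> ne S])
    fix p v b assume p: "p \<in> S"
    have N: "unit_normal \<rho> x = a /\<^sub>R norm a" if "x \<in> - {0}" for x
    proof -
      have "\<forall>v. gradient \<rho> x \<bullet> v = a \<bullet> v"
        using chart_gradient_inner[OF chart that] dderiv_eqI[OF d\<rho>] by simp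
      then have "gradient \<rho> x = a" by (simp add: vector_eq_rdot)
      then show ?thesis by (simp add: unit_normal_eq[OF chart that])
    qed
    have pU: "p \<in> - {0}" "a \<bullet> p = 0" using p by (auto simp: S_def)
    have "(unit_normal \<rho> has_derivative (\<lambda>v. 0)) (at p)"
      by (rule has_derivative_transform_within_open[OF has_derivative_const chart_open[OF chart] pU(1)]) (simp add: N)
    then have "dderiv v (unit_normal \<rho>) p = 0" by (rule dderiv_eqI)
    moreover have "p \<bullet> unit_normal \<rho> p = 0" using N[OF pU(1)] pU(2) by (simp add: inner_commute)
    ultimately show "(ricci_tangential m p - log_slope m p * static_potential m p) * (p \<bullet> unit_normal \<rho> p) * (v \<bullet> b)
       = static_potential m p * (dderiv v (unit_normal \<rho>) p \<bullet> b)"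
      by simp
  qed
qed

lemma simple_boundary_iff: "simple_boundary S \<longleftrightarrow> connected S \<and> S \<noteq> {}"
proof
  assume s: "simple_boundary S"
  then obtain C where C: "C \<in> components S" "\<And>D. D \<in> components S \<Longrightarrow> D = C"
    unfolding simple_boundary_def by blast
  then have "components S = {C}" by blast
  then have "S = C" using Union_components[of S] by simp
  then show "connected S \<and> S \<noteq> {}"
    using in_components_connected[OF C(1)] in_components_nonempty[OF C(1)] by simp
next
  assume "connected S \<and> S \<noteq> {}"
  then show "simple_boundary S"
    using components_eq_sing_iff[of S] unfolding simple_boundary_def by force
qed

theorem theorem4p22:
  fixes m :: real and S :: "(real ^ 'n::finite) set"
  assumes "CARD('n) \<ge> 3" and "m > 0"
    and "S \<subseteq> schwarzschild_space"
  shows "(\<exists>\<Omega>. riem_domain schwarzschild_space (schwarzschild_metric m) \<Omega> S \<and>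
              simple_boundary S \<and>
              non_generic schwarzschild_space (schwarzschild_metric m) \<Omega> S)
         \<longleftrightarrow>
         (S = sphere 0 (schwarzschild_radius_plus CARD('n) m) \<or>
          S = sphere 0 (schwarzschild_radius_minus CARD('n) m) \<or>
          (\<exists>a::real ^ 'n. a \<noteq> 0 \<and> S = {x. a \<bullet> x = 0} - {0}))"
  (is "?L \<longleftrightarrow> ?R")
proof
  assume ?L
  then obtain \<Omega> where dom: "riem_domain schwarzschild_space (schwarzschild_metric m) \<Omega> S"
    and "simple_boundary S" and ng: "non_generic schwarzschild_space (schwarzschild_metric m) \<Omega> S"
    by blast
  then have S: "connected S" "S \<noteq> {}" by (simp_all add: simple_boundary_iff)
  from dichotomy_global[OF assms(2,1) dom ng S(1)] show ?R
  proof
    assume "\<forall>p\<in>S. p \<bullet> euclid_normal \<Omega> p = 0"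
    then show ?R using hyperplane_case[OF assms(2,1) dom ng S(1)] by blast
  next
    assume "\<forall>p\<in>S. p \<bullet> euclid_normal \<Omega> p \<noteq> 0 \<and> (\<forall>v. euclid_normal \<Omega> p \<bullet> v = 0 \<longrightarrow> p \<bullet> v = 0)"
    note sphere = sphere_case[OF assms(2,1) dom ng S(1) this]
    obtain r where r: "r > 0" "S = sphere 0 r"
      "\<And>p. p \<in> S \<Longrightarrow> (ricci_tangential m p - log_slope m p * static_potential m p) * r ^ 2 = static_potential m p"
      by (rule sphere, rule that)
    obtain p where "p \<in> S" using S(2) by auto
    then show ?R
      using schwarzschild_radius_iff[OF assms(2,1) r(1), of p] r(2,3) by auto
  qed
next
  assume ?R
  then consider (sphere) r where "r = schwarzschild_radius_plus CARD('n) m \<or> r = schwarzschild_radius_minus CARD('n) m" "S = sphere 0 r"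
    | (plane) a :: "real ^ 'n" where "a \<noteq> 0" "S = {x. a \<bullet> x = 0} - {0}"
    by blast
  then show ?L
  proof cases
    case sphere
    then have r: "r > 0" using schwarzschild_radii_pos[OF assms(2,1)] by auto
    then have "connected S" "S \<noteq> {}" using assms(1) sphere(2) by (auto simp: connected_sphere_eq)
    then show ?L
      using sphere_non_generic[OF assms(2,1) r sphere(1)] sphere(2) simple_boundary_iff by blast
  next
    case plane
    note h = hyperplane_non_generic[OF assms(2,1) plane(1), folded plane(2)]
    have "connected S"
      unfolding plane(2) by (rule connected_punctured_hyperplane) (use plane(1) assms(1) in auto)
    moreover have "S \<noteq> {}" using h(1) unfolding riem_domain_def by blast
    ultimately show ?L using h simple_boundary_iff by blast
  qed
qed

end
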